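(* Let $(X_i)_{i\ge 1}$ be a Markov chain with values in a measurable space $(E,\Sigma)$, with transition kernel $P$ and initial distribution $\chi$ (the law of $X_1$). Assume: (1) the chain is $\psi$-irreducible for some maximal irreducibility measure $\psi$ on $\Sigma$, and there exist an integer $m\ge 1$, $\delta_m>0$ and a probability measure $\mu$ such that $\delta_m\,\mu(D)\le P^m(x,D)$ for all $x\in E$, $D\in\Sigma$; denote by $\pi$ the unique invariant distribution of the chain; (2) there exist $\delta_M>0$ and a probability measure $\nu$ such that $P(x,D)\le \delta_M\,\nu(D)$ for all $x\in E$, $D\in\Sigma$. Then there exist two constants $\beta,\kappa>0$, not depending on $n$, on $u$ or on the kernels $h_{i,j}$, such that the following holds for every $n\ge 2$ and every family $(h_{i,j})_{i,j\in[n]}$ of bounded measurable $\pi$-canonical kernels $h_{i,j}:E^2\to\mathbb R$. a) If for all $i,j\in[n]$ one has $h_{i,j}\equiv h_{1,j}$ (the kernels do not depend on $i$), then for any $u>0$, with probability at least $1-\beta e^{-u}\log(n)$, $$U_{\mathrm{stat}}(n)\le \kappa\log(n)\Big([A\log(n)\sqrt n]\sqrt u+[A+B_n\sqrt n]\,u+[2A\sqrt n]\,u^{3/2}+A[u^2+n]\Big).$$ b) If $\chi$ is absolutely continuous with respect to $\pi$ and its density $\frac{d\chi}{d\pi}$ has finite $p$-moment for some $p\in(1,\infty]$, i.e. $\left\|\frac{d\chi}{d\pi}\right\|_{\pi,p}<\infty$, then for any $u>0$, with probability at least $1-\beta e^{-u}\log(n)$, $$U_{\mathrm{stat}}(n)\le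 \kappa\log(n)\Big([C_n+A\log(n)\sqrt n]\sqrt u+[A+B_n\sqrt n]\,u+[2A\sqrt n]\,u^{3/2}+A[u^2+n]\Big).$$
   Context: Notation: $[n]=\{1,\dots,n\}$; $\|\omega\|_{\mathrm{TV}}=\sup_{D\in\Sigma}|\omega(D)|$ for a measure $\omega$ on $(E,\Sigma)$; $P^0(y,\cdot)$ is the Dirac measure at $y$. $\pi$-canonical: $h_{i,j}$ is $\pi$-canonical if for all $x,y\in E$, $\mathbb E_{X\sim\pi}[h_{i,j}(X,x)]=\mathbb E_{X\sim\pi}[h_{i,j}(X,y)]=\mathbb E_{X\sim\pi}[h_{i,j}(x,X)]=\mathbb E_{X\sim\pi}[h_{i,j}(y,X)]$; the common value is denoted $\mathbb E_\pi[h_{i,j}]$. $\left\|\frac{d\chi}{d\pi}\right\|_{\pi,p}=\left[\int\left|\frac{d\chi}{d\pi}\right|^p d\pi\right]^{1/p}$ if $p<\infty$ and $\mathrm{ess\,sup}\left|\frac{d\chi}{d\pi}\right|$ if $p=\infty$. Hypothesis (1) is equivalent to uniform ergodicity: there exist constants $0<\rho<1$ and $L>0$ with $\|P^k(x,\cdot)-\pi\|_{\mathrm{TV}}\le L\rho^k$ for all $k\ge0$ and $\pi$-a.e. $x\in E$. Such $L,\rho$ are fixed, together with a real $r>2(\log(1/\rho))^{-1}$, and $t_n:=\lfloor r\log n\rfloor$. The constants $\beta,\kappa$ may depend on the chain, on the constants attached to the hypotheses on the chain, and on $r$. The U-statistic is $U_{\mathrm{stat}}(n)=\sum_{1\le i<j\le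 n}\big(h_{i,j}(X_i,X_j)-\mathbb E[h_{i,j}(X_i,X_j)]\big)$. Put $p_{i,j}(x,y)=h_{i,j}(x,y)-\mathbb E_\pi[h_{i,j}]$ and $$A=2\max_{i,j}\|h_{i,j}\|_\infty,\qquad C_n^2=\sum_{j=2}^n\sum_{i=1}^{j-1}\mathbb E\big[\mathbb E_{X'\sim\nu}[p_{i,j}^2(X_i,X')]\big],$$ $$B_n^2=\max\Big[\max_{0\le k\le t_n}\max_i\sup_x\sum_{j=i+1}^n\mathbb E_{X'\sim\nu}\big(\mathbb E_{X\sim P^k(X',\cdot)}\,p_{i,j}(x,X)\big)^2,\ \max_{0\le k\le t_n}\max_j\sup_y\sum_{i=1}^{j-1}\mathbb E_{\tilde X\sim\pi}\big(\mathbb E_{X\sim P^k(y,\cdot)}\,p_{i,j}(\tilde X,X)\big)^2\Big],$$ with $A,B_n,C_n\ge0$. *)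

theory Defs
  imports "HOL-Probability.Probability" "HOL-Probability.Essential_Supremum"
begin

text \<open>
  Throughout, a measurable space \<open>(E, \<Sigma>)\<close> is given by \<open>M :: 'a measure\<close>, of which only
  \<open>space M\<close> and \<open>sets M\<close> matter, and a Markov kernel on it is an element of
  \<open>M \<rightarrow>\<^sub>M prob_algebra M\<close>. Probability measures on \<open>(E, \<Sigma>)\<close> are the elements of
  \<open>space (prob_algebra M)\<close>. The index set of the chain is \<open>{1, 2, ...}\<close>; the value at index
  \<open>0\<close> is never used.
\<close>

primrec kernel_pow :: "'a measure \<Rightarrow> ('a \<Rightarrow> 'a measure) \<Rightarrow> nat \<Rightarrow> 'a \<Rightarrow> 'a measure" where
  "kernel_pow M P 0 x = return M x"
| "kernel_pow M P (Suc k) x = kernel_pow M P k x \<bind> P"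

definition gen_sigma ::
  "'w measure \<Rightarrow> 'a measure \<Rightarrow> (nat \<Rightarrow> 'w \<Rightarrow> 'a) \<Rightarrow> nat \<Rightarrow> 'w measure" where
  "gen_sigma \<Omega> M X n =
     sigma (space \<Omega>) {X i -` D \<inter> space \<Omega> | i D. i \<in> {1..n} \<and> D \<in> sets M}"

definition markov_chain ::
  "'w measure \<Rightarrow> 'a measure \<Rightarrow> ('a \<Rightarrow> 'a measure) \<Rightarrow> 'a measure \<Rightarrow> (nat \<Rightarrow> 'w \<Rightarrow> 'a) \<Rightarrow> bool" where
  "markov_chain \<Omega> M P chi X \<longleftrightarrow>
     prob_space \<Omega> \<and> P \<in> M \<rightarrow>\<^sub>M prob_algebra M \<and>
     (\<forall>i\<ge>1. X i \<in> \<Omega> \<rightarrow>\<^sub>M M) \<and>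
     distr \<Omega> M (X 1) = chi \<and>
     (\<forall>n\<ge>1. \<forall>D\<in>sets M. AE \<omega> in \<Omega>.
        real_cond_exp \<Omega> (gen_sigma \<Omega> M X n) (indicator (X (Suc n) -` D \<inter> space \<Omega>)) \<omega>
          = measure (P (X n \<omega>)) D)"

definition irreducibility_measure ::
  "'a measure \<Rightarrow> ('a \<Rightarrow> 'a measure) \<Rightarrow> 'a measure \<Rightarrow> bool" where
  "irreducibility_measure M P \<phi> \<longleftrightarrow>
     sigma_finite_measure \<phi> \<and> sets \<phi> = sets M \<and> emeasure \<phi> (space M) \<noteq> 0 \<and>
     (\<forall>x\<in>space M. \<forall>D\<in>sets M. emeasure \<phi> D > 0 \<longrightarrow>
        (\<exists>k\<ge>1. measure (kernel_pow M P k x) D > 0))"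

definition maximal_irreducibility_measure ::
  "'a measure \<Rightarrow> ('a \<Rightarrow> 'a measure) \<Rightarrow> 'a measure \<Rightarrow> bool" where
  "maximal_irreducibility_measure M P \<psi> \<longleftrightarrow>
     irreducibility_measure M P \<psi> \<and>
     (\<forall>\<phi>. irreducibility_measure M P \<phi> \<longrightarrow> absolutely_continuous \<psi> \<phi>)"

definition invariant_distribution ::
  "'a measure \<Rightarrow> ('a \<Rightarrow> 'a measure) \<Rightarrow> 'a measure \<Rightarrow> bool" where
  "invariant_distribution M P \<pi> \<longleftrightarrow> \<pi> \<in> space (prob_algebra M) \<and> \<pi> \<bind> P = \<pi>"

text \<open>Here \<open>\<omega>\<close> is the set function of a finite signed measure, which need not be a
  \<^typ>\<open>'a measure\<close>.\<close>

definition tv_norm :: "'a measure \<Rightarrow> ('a set \<Rightarrow> real) \<Rightarrow> real" where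
  "tv_norm M \<omega> = (SUP D\<in>sets M. \<bar>\<omega> D\<bar>)"

text \<open>Real powers on \<^typ>\<open>ennreal\<close>, for exponents \<open>a > 0\<close> only.\<close>

definition ennreal_powr :: "ennreal \<Rightarrow> real \<Rightarrow> ennreal" where
  "ennreal_powr x a = (if x = \<top> then \<top> else ennreal (enn2real x powr a))"

text \<open>The \<open>L\<^sup>p\<close> norm of the density of \<open>chi\<close> with respect to \<open>\<pi>\<close>, meaningful when
  \<open>chi\<close> is absolutely continuous with respect to \<open>\<pi>\<close>.\<close>

definition density_norm :: "'a measure \<Rightarrow> ennreal \<Rightarrow> 'a measure \<Rightarrow> ennreal" where
  "density_norm \<pi> p chi =
     (if p = \<top> then esssup \<pi> (RN_deriv \<pi> chi)
      else ennreal_powr (\<integral>\<^sup>+x. ennreal_powr (RN_deriv \<pi> chi x) (enn2real p) \<partial>\<pi>) (1 / enn2real p))"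

definition bounded_kernel :: "'a measure \<Rightarrow> ('a \<Rightarrow> 'a \<Rightarrow> real) \<Rightarrow> bool" where
  "bounded_kernel M f \<longleftrightarrow>
     case_prod f \<in> borel_measurable (M \<Otimes>\<^sub>M M) \<and> (\<exists>c. \<forall>x\<in>space M. \<forall>y\<in>space M. \<bar>f x y\<bar> \<le> c)"

definition canonical :: "'a measure \<Rightarrow> ('a \<Rightarrow> 'a \<Rightarrow> real) \<Rightarrow> bool" where
  "canonical \<pi> f \<longleftrightarrow>
     (\<forall>x\<in>space \<pi>. \<forall>y\<in>space \<pi>.
        (\<integral>z. f z x \<partial>\<pi>) = (\<integral>z. f z y \<partial>\<pi>) \<and>
        (\<integral>z. f z y \<partial>\<pi>) = (\<integral>z. f x z \<partial>\<pi>) \<and>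
        (\<integral>z. f x z \<partial>\<pi>) = (\<integral>z. f y z \<partial>\<pi>))"

definition canonical_mean :: "'a measure \<Rightarrow> ('a \<Rightarrow> 'a \<Rightarrow> real) \<Rightarrow> real" where
  "canonical_mean \<pi> f =
     (THE c. \<forall>x\<in>space \<pi>. (\<integral>z. f z x \<partial>\<pi>) = c \<and> (\<integral>z. f x z \<partial>\<pi>) = c)"

definition centered ::
  "'a measure \<Rightarrow> (nat \<Rightarrow> nat \<Rightarrow> 'a \<Rightarrow> 'a \<Rightarrow> real) \<Rightarrow> nat \<Rightarrow> nat \<Rightarrow> 'a \<Rightarrow> 'a \<Rightarrow> real" where
  "centered \<pi> h i j x y = h i j x y - canonical_mean \<pi> (h i j)"

definition U_stat ::
  "'w measure \<Rightarrow> (nat \<Rightarrow> 'w \<Rightarrow> 'a) \<Rightarrow> (nat \<Rightarrow> nat \<Rightarrow> 'a \<Rightarrow> 'a \<Rightarrow> real) \<Rightarrow> nat \<Rightarrow> 'w \<Rightarrow> real" where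
  "U_stat \<Omega> X h n \<omega> =
     (\<Sum>(i, j)\<in>{(i, j). 1 \<le> i \<and> i < j \<and> j \<le> n}.
        h i j (X i \<omega>) (X j \<omega>) - (\<integral>\<omega>'. h i j (X i \<omega>') (X j \<omega>') \<partial>\<Omega>))"

definition A_const :: "'a measure \<Rightarrow> (nat \<Rightarrow> nat \<Rightarrow> 'a \<Rightarrow> 'a \<Rightarrow> real) \<Rightarrow> nat \<Rightarrow> real" where
  "A_const M h n =
     2 * (MAX i\<in>{1..n}. MAX j\<in>{1..n}. SUP (x, y)\<in>space M \<times> space M. \<bar>h i j x y\<bar>)"

definition C_const ::
  "'w measure \<Rightarrow> (nat \<Rightarrow> 'w \<Rightarrow> 'a) \<Rightarrow> 'a measure \<Rightarrow> 'a measure \<Rightarrow>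
    (nat \<Rightarrow> nat \<Rightarrow> 'a \<Rightarrow> 'a \<Rightarrow> real) \<Rightarrow> nat \<Rightarrow> real" where
  "C_const \<Omega> X \<pi> \<nu> h n =
     sqrt (\<Sum>j=2..n. \<Sum>i=1..j-1. \<integral>\<omega>. (\<integral>x'. (centered \<pi> h i j (X i \<omega>) x')\<^sup>2 \<partial>\<nu>) \<partial>\<Omega>)"

definition t_index :: "real \<Rightarrow> nat \<Rightarrow> nat" where
  "t_index r n = nat \<lfloor>r * ln (real n)\<rfloor>"

definition B_const ::
  "'a measure \<Rightarrow> ('a \<Rightarrow> 'a measure) \<Rightarrow> 'a measure \<Rightarrow> 'a measure \<Rightarrow> real \<Rightarrow>
    (nat \<Rightarrow> nat \<Rightarrow> 'a \<Rightarrow> 'a \<Rightarrow> real) \<Rightarrow> nat \<Rightarrow> real" where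
  "B_const M P \<pi> \<nu> r h n =
     sqrt (max
       (MAX k\<in>{0..t_index r n}. MAX i\<in>{1..n}. SUP x\<in>space M.
          \<Sum>j=i+1..n. \<integral>x'. (\<integral>z. centered \<pi> h i j x z \<partial>kernel_pow M P k x')\<^sup>2 \<partial>\<nu>)
       (MAX k\<in>{0..t_index r n}. MAX j\<in>{1..n}. SUP y\<in>space M.
          \<Sum>i=1..j-1. \<integral>x'. (\<integral>z. centered \<pi> h i j x' z \<partial>kernel_pow M P k y)\<^sup>2 \<partial>\<pi>))"

end

theory Submission
  imports Defs
begin

text \<open>
  Write \<open>p\<close> for the centred kernels, \<open>P\<^sup>k p (x, y)\<close> for the average of \<open>p (x, \<cdot>)\<close> over
  \<open>P\<^sup>k (y, \<cdot>)\<close>, and \<open>t = \<lfloor>r ln n\<rfloor>\<close>. Each term of the statistic telescopes along the last steps of its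
  second argument,
  \<open>p (X\<^sub>i, X\<^sub>j) = (\<Sum>k < min t (j - i). P\<^sup>k p (X\<^sub>i, X\<^bsub>j-k\<^esub>) - P\<^bsup>k+1\<^esup> p (X\<^sub>i, X\<^bsub>j-k-1\<^esub>)) + remainder\<close>
  (\<open>decomposition\<close>). For a fixed lag \<open>k\<close> the differences with the same \<open>j\<close> add up to the
  increment of a martingale in \<open>j\<close>: the bracket is \<open>P\<^sup>k p (X\<^sub>i, \<cdot>)\<close> at the next state minus its conditional
  expectation given the past. So the statistic is a sum of about \<open>r ln n\<close> martingales and a remainder,
  which is where the factor \<open>ln n\<close> in the bound and in the probability comes from.

  One such martingale is treated with a Freedman inequality (\<open>Freedman_tail\<close>). Its increment at \<open>j\<close> is
  governed by the random function \<open>S\<^sub>j (y) = \<Sum>i \<le> j. q\<^sub>i (X\<^sub>i, y)\<close>, which is itself an additive functional of the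
  chain, centred under \<open>\<pi>\<close> because the kernels are canonical. Two tail bounds for it are needed.
  The size of an increment is an evaluation of \<open>S\<^sub>j\<close> at the next state; since the next state has a law below
  \<open>\<delta>\<^sub>M \<nu>\<close>, it may be replaced by an independent point, and for a fixed point \<open>S\<^sub>j (y)\<close> is of order
  \<open>A \<surd>(n (u + ln n))\<close> (\<open>max_tail\<close>). The predictable variance is at most \<open>\<delta>\<^sub>M \<Sum>j. \<integral> S\<^sub>j\<^sup>2 d\<nu>\<close>, the
  squared norm of one additive functional with values in the Hilbert space \<open>L\<^sup>2\<close> of the measure
  \<open>counting measure \<otimes> \<nu>\<close>; its summands have norm at most \<open>B\<^sub>n\<close>, so it is of order
  \<open>B\<^sub>n\<^sup>2 n u\<close> (\<open>variance_tail\<close>). Freedman's inequality combines them into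
  \<open>A \<surd>n u\<^bsup>3/2\<^esup> + B\<^sub>n \<surd>n u + A n\<close>, up to constants (\<open>degenerate_martingale_tail\<close>, \<open>max_term_le\<close>).

  Both tail bounds are instances of \<open>Hilbert_tail\<close>, an Azuma inequality in \<open>L\<^sup>2 (Q)\<close> for \<open>\<Sum>i. \<xi>\<^sub>i (X\<^sub>i)\<close>.
  Under the minorization, \<open>P\<^sup>k f\<close> decays geometrically and uniformly for \<open>\<pi>\<close>-centred \<open>f\<close> (\<open>pint_decay\<close>), so
  the conditional expectations of the sum form a martingale whose increments have norm at most
  \<open>2 K0 \<beta>\<close>, where \<open>\<beta>\<close> bounds the norm of the summands. The norm of such a martingale is reduced to a scalar,
  exponentially integrable quantity by Hoeffding's lemma (\<open>smooth_norm_exponential_step\<close>).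

  In the remainder (\<open>remainder_tail\<close>), pairs at distance at most \<open>t\<close> contribute at most \<open>A\<close> each, hence
  \<open>A n t\<close> in total. For the other pairs \<open>P\<^sup>t p\<close> is close to \<open>\<integral> p d\<pi> = 0\<close> by uniform ergodicity, with an error
  of order \<open>\<rho>\<^sup>t \<le> n\<^bsup>-2\<^esup> / \<rho>\<close>, provided that \<open>X\<^bsub>j-t\<^esub>\<close> avoids the exceptional null set. Since the initial law may
  charge that set, this can fail at the beginning, but with high probability only during a burn-in
  of order \<open>u + ln n\<close> steps, which costs the term \<open>A u\<^sup>2\<close>. Finally the expectations subtracted in the
  statistic sum to at most a constant times \<open>A n\<close> (\<open>mean_bound\<close>).
\<close>

section \<open>Integration of bounded functions\<close>

lemma integrable_bounded:
  fixes f :: "'a \<Rightarrow> real"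
  assumes "finite_measure K" "f \<in> borel_measurable K" "\<And>x. x \<in> space K \<Longrightarrow> \<bar>f x\<bar> \<le> c"
  shows "integrable K f"
  using assms by (intro finite_measure.integrable_const_bound[where B = c]) auto

lemma abs_integral_le_bound:
  fixes f :: "'a \<Rightarrow> real"
  assumes "prob_space K" "f \<in> borel_measurable K" "\<And>x. x \<in> space K \<Longrightarrow> \<bar>f x\<bar> \<le> c"
  shows "\<bar>\<integral>x. f x \<partial>K\<bar> \<le> c"
proof -
  interpret prob_space K by fact
  have i: "integrable K f" by (rule integrable_bounded[OF finite_measure_axioms assms(2,3)])
  have "\<bar>\<integral>x. f x \<partial>K\<bar> \<le> (\<integral>x. \<bar>f x\<bar> \<partial>K)" by (rule integral_abs_bound)
  also have "\<dots> \<le> (\<integral>x. c \<partial>K)" using i assms(3) by (intro integral_mono) auto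
  finally show ?thesis by (simp add: prob_space)
qed

lemma integrable_square:
  fixes f :: "'a \<Rightarrow> real"
  assumes "finite_measure K" "f \<in> borel_measurable K" "\<And>x. x \<in> space K \<Longrightarrow> \<bar>f x\<bar> \<le> c"
  shows "integrable K (\<lambda>x. (f x)\<^sup>2)"
  by (rule integrable_bounded[OF assms(1), of _ "c\<^sup>2"])
     (use assms(2) in \<open>auto simp: abs_le_square_iff[symmetric] intro: order_trans[OF assms(3) abs_ge_self]\<close>)

lemma Fubini_bounded:
  fixes f :: "'a \<Rightarrow> 'b \<Rightarrow> real"
  assumes K: "finite_measure K" and Q: "finite_measure Q"
    and f: "case_prod f \<in> borel_measurable (K \<Otimes>\<^sub>M Q)"
    and b: "\<And>x y. x \<in> space K \<Longrightarrow> y \<in> space Q \<Longrightarrow> \<bar>f x y\<bar> \<le> c"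
  shows "(\<integral>x. (\<integral>y. f x y \<partial>Q) \<partial>K) = (\<integral>y. (\<integral>x. f x y \<partial>K) \<partial>Q)"
proof -
  interpret K: finite_measure K by fact
  interpret Q: finite_measure Q by fact
  interpret pair_sigma_finite K Q ..
  interpret KQ: finite_measure "K \<Otimes>\<^sub>M Q" by (intro finite_measure_pair_measure K Q)
  have "integrable (K \<Otimes>\<^sub>M Q) (case_prod f)"
    by (rule integrable_bounded[OF _ f, where c = c]) (auto simp: space_pair_measure b KQ.finite_measure_axioms)
  from Fubini_integral[OF this] show ?thesis by simp
qed

lemma nn_integral_le_scaled:
  assumes s: "sets N = sets K" and le: "\<And>D. D \<in> sets K \<Longrightarrow> emeasure K D \<le> ennreal c * emeasure N D"
    and f: "f \<in> borel_measurable K"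
  shows "(\<integral>\<^sup>+x. f x \<partial>K) \<le> ennreal c * (\<integral>\<^sup>+x. f x \<partial>N)"
proof -
  have "(\<integral>\<^sup>+x. f x \<partial>K) \<le> (\<integral>\<^sup>+x. f x \<partial>scale_measure (ennreal c) N)"
    by (rule nn_integral_mono_measure) (auto simp: s le_measure sets_eq_imp_space_eq[OF s] le)
  also have "\<dots> = ennreal c * (\<integral>\<^sup>+x. f x \<partial>N)"
    using f by (intro nn_integral_scale_measure) (simp add: measurable_cong_sets[OF s refl])
  finally show ?thesis .
qed

lemma borel_measurable_kernel_integral:
  fixes f :: "'a \<Rightarrow> 'b \<Rightarrow> real"
  assumes f[measurable]: "case_prod f \<in> borel_measurable (L \<Otimes>\<^sub>M M)"
    and K[measurable]: "K \<in> L \<rightarrow>\<^sub>M subprob_algebra M"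
  shows "(\<lambda>x. \<integral>y. f x y \<partial>K x) \<in> borel_measurable L"
proof -
  note measurable_distr2[measurable]
  have "(\<lambda>x. integral\<^sup>L (distr (K x) (L \<Otimes>\<^sub>M M) (\<lambda>y. (x, y))) (\<lambda>(x, y). f x y)) \<in> borel_measurable L"
    by measurable
  then show ?thesis
    by (rule measurable_cong[THEN iffD1, rotated])
       (auto simp: integral_distr)
qed

lemma Cauchy_Schwarz_integral:
  fixes f g :: "'a \<Rightarrow> real"
  assumes Q: "finite_measure Q" and f[measurable]: "f \<in> borel_measurable Q" and g[measurable]: "g \<in> borel_measurable Q"
    and bf: "\<And>x. x \<in> space Q \<Longrightarrow> \<bar>f x\<bar> \<le> c" and bg: "\<And>x. x \<in> space Q \<Longrightarrow> \<bar>g x\<bar> \<le> d"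
  shows "\<bar>\<integral>x. f x * g x \<partial>Q\<bar> \<le> sqrt (\<integral>x. (f x)\<^sup>2 \<partial>Q) * sqrt (\<integral>x. (g x)\<^sup>2 \<partial>Q)"
proof -
  define a b p where "a = (\<integral>x. (f x)\<^sup>2 \<partial>Q)" and "b = (\<integral>x. (g x)\<^sup>2 \<partial>Q)" and "p = (\<integral>x. f x * g x \<partial>Q)"
  have i1: "integrable Q (\<lambda>x. (f x)\<^sup>2)"
    by (rule integrable_square[OF Q f bf])
  have i2: "integrable Q (\<lambda>x. (g x)\<^sup>2)"
    by (rule integrable_square[OF Q g bg])
  have i3: "integrable Q (\<lambda>x. f x * g x)"
    by (rule integrable_bounded[OF Q, where c = "c * d"])
       (auto simp: abs_mult intro!: mult_mono bf bg order_trans[OF abs_ge_zero bf])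
  have ge: "0 \<le> t\<^sup>2 * a + 2 * t * p * s + s\<^sup>2 * b" for t s :: real
  proof -
    have "0 \<le> (\<integral>x. (t * f x + s * g x)\<^sup>2 \<partial>Q)" by simp
    also have "\<dots> = (\<integral>x. t\<^sup>2 * (f x)\<^sup>2 + 2 * t * s * (f x * g x) + s\<^sup>2 * (g x)\<^sup>2 \<partial>Q)"
      by (simp add: power2_eq_square algebra_simps)
    also have "\<dots> = t\<^sup>2 * a + 2 * t * s * p + s\<^sup>2 * b"
      using i1 i2 i3 by (simp add: a_def b_def p_def)
    finally show ?thesis by (simp add: algebra_simps)
  qed
  have a0: "a \<ge> 0" "b \<ge> 0" by (auto simp: a_def b_def)
  have "p\<^sup>2 \<le> a * b"
  proof (cases "a = 0")
    case True
    have "p = 0"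
    proof (rule ccontr)
      assume "p \<noteq> 0"
      from ge[of "- (b + 1) / (2 * p)" 1] True \<open>p \<noteq> 0\<close> show False by (simp add: field_simps)
    qed
    then show ?thesis using True by simp
  next
    case False
    then have "a > 0" using a0 by simp
    have "0 \<le> p\<^sup>2 * a + 2 * p * p * (-a) + a\<^sup>2 * b" using ge[of p "-a"] by simp
    then have "a * p\<^sup>2 \<le> a * (a * b)" by (simp add: power2_eq_square algebra_simps)
    then show ?thesis using \<open>a > 0\<close> by simp
  qed
  then have "sqrt (p\<^sup>2) \<le> sqrt (a * b)" by (rule real_sqrt_le_mono)
  then show ?thesis by (simp add: real_sqrt_mult a_def b_def p_def)
qed

section \<open>The one-step Markov property\<close>

locale markov_process =
  fixes \<Omega> :: "'w measure" and M :: "'a measure" and P :: "'a \<Rightarrow> 'a measure"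
    and chi :: "'a measure" and X :: "nat \<Rightarrow> 'w \<Rightarrow> 'a"
  assumes chain: "markov_chain \<Omega> M P chi X"
begin

sublocale prob_space \<Omega> using chain by (simp add: markov_chain_def)

lemma P_kernel[measurable]: "P \<in> M \<rightarrow>\<^sub>M prob_algebra M"
  using chain by (simp add: markov_chain_def)

lemma P_subkernel[measurable]: "P \<in> M \<rightarrow>\<^sub>M subprob_algebra M"
  by (rule measurable_prob_algebraD[OF P_kernel])

lemma P_sets[simp]: "x \<in> space M \<Longrightarrow> sets (P x) = sets M"
  and P_prob: "x \<in> space M \<Longrightarrow> prob_space (P x)"
  using measurable_space[OF P_kernel] by (auto simp: space_prob_algebra)

lemma P_space[simp]: "x \<in> space M \<Longrightarrow> space (P x) = space M"
  by (intro sets_eq_imp_space_eq P_sets)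

lemma borel_P: "x \<in> space M \<Longrightarrow> borel_measurable (P x) = borel_measurable M"
  by (rule measurable_cong_sets[OF P_sets refl])

abbreviation past :: "nat \<Rightarrow> 'w measure" where "past n \<equiv> gen_sigma \<Omega> M X n"

lemma X_measurable[measurable]: "1 \<le> i \<Longrightarrow> X i \<in> \<Omega> \<rightarrow>\<^sub>M M"
  using chain by (simp add: markov_chain_def)

lemma past_generator:
  "{X i -` D \<inter> space \<Omega> | i D. i \<in> {1..n} \<and> D \<in> sets M} \<subseteq> Pow (space \<Omega>)"
  by auto

lemma space_past[simp]: "space (past n) = space \<Omega>"
  unfolding gen_sigma_def by (rule space_measure_of[OF past_generator])

lemma sets_past: "sets (past n) = sigma_sets (space \<Omega>) {X i -` D \<inter> space \<Omega> | i D. i \<in> {1..n} \<and> D \<in> sets M}"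
  unfolding gen_sigma_def by (rule sets_measure_of[OF past_generator])

lemma subalgebra_past: "subalgebra \<Omega> (past n)"
  unfolding subalgebra_def sets_past
proof
  show "sigma_sets (space \<Omega>) {X i -` D \<inter> space \<Omega> | i D. i \<in> {1..n} \<and> D \<in> sets M} \<subseteq> sets \<Omega>"
    by (rule sets.sigma_sets_subset) (auto intro: measurable_sets)
qed simp

lemma X_past[measurable]:
  assumes "1 \<le> i" "i \<le> n"
  shows "X i \<in> past n \<rightarrow>\<^sub>M M"
proof (rule measurableI)
  show "X i x \<in> space M" if "x \<in> space (past n)" for x
    using that measurable_space[OF X_measurable[OF assms(1)]] by simp
  show "X i -` A \<inter> space (past n) \<in> sets (past n)" if "A \<in> sets M" for A
    unfolding space_past sets_past using assms that by (intro sigma_sets.Basic) auto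
qed

lemma X_space: "1 \<le> i \<Longrightarrow> \<omega> \<in> space \<Omega> \<Longrightarrow> X i \<omega> \<in> space M"
  using measurable_space[OF X_measurable] by blast

lemma past_measurable: "f \<in> past n \<rightarrow>\<^sub>M N \<Longrightarrow> f \<in> \<Omega> \<rightarrow>\<^sub>M N"
  by (rule measurable_from_subalg[OF subalgebra_past])

lemma joint_measurable: "1 \<le> n \<Longrightarrow> (\<lambda>\<omega>. (\<omega>, X (Suc n) \<omega>)) \<in> \<Omega> \<rightarrow>\<^sub>M past n \<Otimes>\<^sub>M M"
  using measurable_from_subalg[OF subalgebra_past, of "\<lambda>\<omega>. \<omega>" n "past n"]
  by (intro measurable_Pair) auto

text \<open>
  The conditional probability that defines the chain, integrated over an event of the past.
\<close>

lemma markov_rectangle: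
  assumes n: "1 \<le> n" and A: "A \<in> sets (past n)" and D: "D \<in> sets M"
  shows "emeasure \<Omega> (A \<inter> X (Suc n) -` D \<inter> space \<Omega>) = (\<integral>\<^sup>+\<omega>. indicator A \<omega> * emeasure (P (X n \<omega>)) D \<partial>\<Omega>)"
proof -
  interpret R: finite_measure_subalgebra \<Omega> "past n"
    by unfold_locales (rule subalgebra_past)
  let ?B = "X (Suc n) -` D \<inter> space \<Omega>"
  note [measurable] = D
  have A'[measurable]: "A \<in> sets \<Omega>" using A subalgebra_past[of n] by (auto simp: subalgebra_def)
  have B[measurable]: "?B \<in> sets \<Omega>" using X_measurable[of "Suc n"] n D by (auto intro: measurable_sets)
  have Xn[measurable]: "X n \<in> \<Omega> \<rightarrow>\<^sub>M M" using n by simp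
  have iB: "integrable \<Omega> (indicator ?B :: _ \<Rightarrow> real)"
    by (rule integrable_bounded[OF finite_measure_axioms, of _ 1]) (use B in \<open>auto split: split_indicator\<close>)
  have ce: "AE \<omega> in \<Omega>. real_cond_exp \<Omega> (past n) (indicator ?B) \<omega> = measure (P (X n \<omega>)) D"
    using chain n D by (auto simp: markov_chain_def)
  have m: "(\<lambda>\<omega>. measure (P (X n \<omega>)) D) \<in> borel_measurable \<Omega>" by measurable
  have "measure \<Omega> (A \<inter> ?B) = (\<integral>\<omega>\<in>A. indicator ?B \<omega> \<partial>\<Omega>)"
    by (simp add: set_lebesgue_integral_def indicator_inter_arith[symmetric] Int_assoc)
  also have "\<dots> = (\<integral>\<omega>\<in>A. real_cond_exp \<Omega> (past n) (indicator ?B) \<omega> \<partial>\<Omega>)"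
    by (rule R.real_cond_exp_intA[OF iB A])
  also have "\<dots> = (\<integral>\<omega>. indicator A \<omega> * measure (P (X n \<omega>)) D \<partial>\<Omega>)"
    unfolding set_lebesgue_integral_def using ce m by (intro integral_cong_AE) auto
  finally have e: "measure \<Omega> (A \<inter> ?B) = (\<integral>\<omega>. indicator A \<omega> * measure (P (X n \<omega>)) D \<partial>\<Omega>)" .
  have P1: "\<omega> \<in> space \<Omega> \<Longrightarrow> prob_space (P (X n \<omega>))" for \<omega> using n by (intro P_prob X_space)
  have i: "integrable \<Omega> (\<lambda>\<omega>. indicator A \<omega> * measure (P (X n \<omega>)) D)"
    by (rule integrable_bounded[where c = 1])
       (use m P1 in \<open>auto simp: finite_measure_axioms prob_space.prob_le_1 split: split_indicator\<close>)
  have "emeasure \<Omega> (A \<inter> ?B) = ennreal (\<integral>\<omega>. indicator A \<omega> * measure (P (X n \<omega>)) D \<partial>\<Omega>)"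
    by (simp add: emeasure_eq_measure e)
  also have "\<dots> = (\<integral>\<^sup>+\<omega>. ennreal (indicator A \<omega> * measure (P (X n \<omega>)) D) \<partial>\<Omega>)"
    by (rule nn_integral_eq_integral[symmetric]) (use i in auto)
  also have "\<dots> = (\<integral>\<^sup>+\<omega>. indicator A \<omega> * emeasure (P (X n \<omega>)) D \<partial>\<Omega>)"
  proof (rule nn_integral_cong)
    fix \<omega> assume "\<omega> \<in> space \<Omega>"
    then interpret Px: prob_space "P (X n \<omega>)" by (rule P1)
    show "ennreal (indicator A \<omega> * measure (P (X n \<omega>)) D) = indicator A \<omega> * emeasure (P (X n \<omega>)) D"
      by (simp add: Px.emeasure_eq_measure split: split_indicator)
  qed
  finally show ?thesis by (simp only: Int_assoc)
qed

text \<open>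
  The pair of the past and the next state has the law of a two-stage experiment, since both laws agree on
  the rectangles, an intersection-stable generator. The first stage is \<open>\<Omega>\<close> restricted to the
  \<open>\<sigma>\<close>-algebra of the past, for which the kernel \<open>P (X n \<omega>)\<close> is measurable.
\<close>

lemma joint_law:
  assumes n: "1 \<le> n"
  shows "distr \<Omega> (past n \<Otimes>\<^sub>M M) (\<lambda>\<omega>. (\<omega>, X (Suc n) \<omega>)) =
    restr_to_subalg \<Omega> (past n) \<bind> (\<lambda>\<omega>. distr (P (X n \<omega>)) (past n \<Otimes>\<^sub>M M) (Pair \<omega>))" (is "?L = ?R")
proof -
  let ?E = "{a \<times> b |a b. a \<in> sets (past n) \<and> b \<in> sets M}"
  let ?S = "restr_to_subalg \<Omega> (past n)"
  have Xn[measurable]: "X n \<in> past n \<rightarrow>\<^sub>M M" using n by simp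
  have [measurable_cong]: "sets ?S = sets (past n)" by (rule sets_restr_to_subalg[OF subalgebra_past])
  note measurable_distr2[measurable]
  have K[measurable]: "(\<lambda>\<omega>. distr (P (X n \<omega>)) (past n \<Otimes>\<^sub>M M) (Pair \<omega>)) \<in> ?S \<rightarrow>\<^sub>M subprob_algebra (past n \<Otimes>\<^sub>M M)"
    by measurable
  have ne: "space ?S \<noteq> {}" by (simp add: space_restr_to_subalg not_empty)
  have setsR: "sets ?R = sets (past n \<Otimes>\<^sub>M M)" by (rule sets_bind[OF _ ne]) simp
  show ?thesis
  proof (rule measure_eqI_generator_eq[where E = ?E and \<Omega> = "space \<Omega> \<times> space M" and A = "\<lambda>_. space \<Omega> \<times> space M"])
    show "Int_stable ?E" by (rule Int_stable_pair_measure_generator)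
    show "?E \<subseteq> Pow (space \<Omega> \<times> space M)" using pair_measure_closed[of "past n" M] by simp
    show "sets ?L = sigma_sets (space \<Omega> \<times> space M) ?E" by (simp add: sets_pair_measure)
    show "sets ?R = sigma_sets (space \<Omega> \<times> space M) ?E" unfolding setsR by (simp add: sets_pair_measure)
    show "range (\<lambda>_. space \<Omega> \<times> space M) \<subseteq> ?E" using sets.top[of "past n"] by auto
    interpret L: prob_space ?L by (rule prob_space_distr[OF joint_measurable[OF n]])
    show "emeasure ?L (space \<Omega> \<times> space M) \<noteq> \<infinity>" by simp
  next
    fix C assume "C \<in> ?E"
    then obtain A D where C: "C = A \<times> D" and A[measurable]: "A \<in> sets (past n)" and D[measurable]: "D \<in> sets M" by blast
    have "emeasure ?L C = emeasure \<Omega> (A \<inter> X (Suc n) -` D \<inter> space \<Omega>)"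
      unfolding C using joint_measurable[OF n] by (subst emeasure_distr) (auto intro!: arg_cong[where f = "emeasure \<Omega>"])
    also have "\<dots> = (\<integral>\<^sup>+\<omega>. indicator A \<omega> * emeasure (P (X n \<omega>)) D \<partial>\<Omega>)"
      by (rule markov_rectangle[OF n A D])
    also have "\<dots> = (\<integral>\<^sup>+\<omega>. indicator A \<omega> * emeasure (P (X n \<omega>)) D \<partial>?S)"
      by (rule nn_integral_subalgebra2[OF subalgebra_past, symmetric]) measurable
    also have "\<dots> = (\<integral>\<^sup>+\<omega>. emeasure (distr (P (X n \<omega>)) (past n \<Otimes>\<^sub>M M) (Pair \<omega>)) C \<partial>?S)"
    proof (rule nn_integral_cong)
      fix \<omega> assume "\<omega> \<in> space ?S"
      then have w: "\<omega> \<in> space \<Omega>" by (simp add: space_restr_to_subalg)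
      then have x: "X n \<omega> \<in> space M" using n by (simp add: X_space)
      have "Pair \<omega> \<in> P (X n \<omega>) \<rightarrow>\<^sub>M past n \<Otimes>\<^sub>M M"
        using measurable_Pair1'[of \<omega> "past n" M] w x by (simp cong: measurable_cong_sets)
      then have "emeasure (distr (P (X n \<omega>)) (past n \<Otimes>\<^sub>M M) (Pair \<omega>)) C = emeasure (P (X n \<omega>)) (Pair \<omega> -` C \<inter> space M)"
        using A D unfolding C by (subst emeasure_distr) (auto simp: x)
      also have "Pair \<omega> -` C \<inter> space M = (if \<omega> \<in> A then D else {})"
        using sets.sets_into_space[OF D] by (auto simp: C)
      finally show "indicator A \<omega> * emeasure (P (X n \<omega>)) D = emeasure (distr (P (X n \<omega>)) (past n \<Otimes>\<^sub>M M) (Pair \<omega>)) C"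
        by (simp split: split_indicator)
    qed
    also have "\<dots> = emeasure ?R C"
      unfolding C by (rule emeasure_bind[OF ne K, symmetric]) simp
    finally show "emeasure ?L C = emeasure ?R C" .
  qed (use not_empty in auto)
qed

text \<open>
  The one-step Markov property in the form used everywhere below: in a function of the past and of the next state,
  the next state may be integrated out against \<open>P (X n \<omega>)\<close>.
\<close>

lemma nn_integral_step:
  assumes n: "1 \<le> n" and H[measurable]: "case_prod H \<in> borel_measurable (past n \<Otimes>\<^sub>M M)"
  shows "(\<integral>\<^sup>+\<omega>. H \<omega> (X (Suc n) \<omega>) \<partial>\<Omega>) = (\<integral>\<^sup>+\<omega>. (\<integral>\<^sup>+y. H \<omega> y \<partial>P (X n \<omega>)) \<partial>\<Omega>)"
proof -
  let ?S = "restr_to_subalg \<Omega> (past n)"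
  have Xn[measurable]: "X n \<in> past n \<rightarrow>\<^sub>M M" using n by simp
  have [measurable_cong]: "sets ?S = sets (past n)" by (rule sets_restr_to_subalg[OF subalgebra_past])
  note measurable_distr2[measurable]
  have K[measurable]: "(\<lambda>\<omega>. distr (P (X n \<omega>)) (past n \<Otimes>\<^sub>M M) (Pair \<omega>)) \<in> ?S \<rightarrow>\<^sub>M subprob_algebra (past n \<Otimes>\<^sub>M M)"
    by measurable
  have "(\<integral>\<^sup>+\<omega>. H \<omega> (X (Suc n) \<omega>) \<partial>\<Omega>) = (\<integral>\<^sup>+z. case_prod H z \<partial>distr \<Omega> (past n \<Otimes>\<^sub>M M) (\<lambda>\<omega>. (\<omega>, X (Suc n) \<omega>)))"
    by (subst nn_integral_distr[OF joint_measurable[OF n]]) auto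
  also have "\<dots> = (\<integral>\<^sup>+\<omega>. (\<integral>\<^sup>+z. case_prod H z \<partial>distr (P (X n \<omega>)) (past n \<Otimes>\<^sub>M M) (Pair \<omega>)) \<partial>?S)"
    unfolding joint_law[OF n] by (rule nn_integral_bind[OF H K])
  also have "\<dots> = (\<integral>\<^sup>+\<omega>. (\<integral>\<^sup>+y. H \<omega> y \<partial>P (X n \<omega>)) \<partial>?S)"
  proof (rule nn_integral_cong)
    fix \<omega> assume "\<omega> \<in> space ?S"
    then have w: "\<omega> \<in> space \<Omega>" by (simp add: space_restr_to_subalg)
    then have x: "X n \<omega> \<in> space M" using n by (simp add: X_space)
    have "Pair \<omega> \<in> P (X n \<omega>) \<rightarrow>\<^sub>M past n \<Otimes>\<^sub>M M"
      using measurable_Pair1'[of \<omega> "past n" M] w x by (simp cong: measurable_cong_sets)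
    from nn_integral_distr[OF this, of "case_prod H"] H show "(\<integral>\<^sup>+z. case_prod H z \<partial>distr (P (X n \<omega>)) (past n \<Otimes>\<^sub>M M) (Pair \<omega>)) = (\<integral>\<^sup>+y. H \<omega> y \<partial>P (X n \<omega>))"
      by (simp only: prod.case measurable_distr_eq1)
  qed
  also have "\<dots> = (\<integral>\<^sup>+\<omega>. (\<integral>\<^sup>+y. H \<omega> y \<partial>P (X n \<omega>)) \<partial>\<Omega>)"
    by (rule nn_integral_subalgebra2[OF subalgebra_past])
       (rule nn_integral_measurable_subprob_algebra2[OF H measurable_compose[OF Xn P_subkernel]])
  finally show ?thesis .
qed

lemma integral_step:
  fixes H :: "'w \<Rightarrow> 'a \<Rightarrow> real"
  assumes n: "1 \<le> n" and H[measurable]: "case_prod H \<in> borel_measurable (past n \<Otimes>\<^sub>M M)"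
    and b: "\<And>\<omega> y. \<omega> \<in> space \<Omega> \<Longrightarrow> y \<in> space M \<Longrightarrow> \<bar>H \<omega> y\<bar> \<le> c"
  shows "(\<integral>\<omega>. H \<omega> (X (Suc n) \<omega>) \<partial>\<Omega>) = (\<integral>\<omega>. (\<integral>y. H \<omega> y \<partial>P (X n \<omega>)) \<partial>\<Omega>)"
proof -
  have Xn[measurable]: "X n \<in> past n \<rightarrow>\<^sub>M M" using n by simp
  have lo: "0 \<le> H \<omega> y + c" if "\<omega> \<in> space \<Omega>" "y \<in> space M" for \<omega> y
    using b[OF that] by linarith
  have fm: "finite_measure \<Omega>" by (rule finite_measure_axioms)
  have m1[measurable]: "(\<lambda>\<omega>. H \<omega> (X (Suc n) \<omega>)) \<in> borel_measurable \<Omega>"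
    using measurable_compose[OF joint_measurable[OF n] H] by simp
  have m2[measurable]: "(\<lambda>\<omega>. \<integral>y. H \<omega> y \<partial>P (X n \<omega>)) \<in> borel_measurable \<Omega>"
    by (rule past_measurable[of _ n], rule borel_measurable_kernel_integral[where M = M]) measurable
  have Hs: "H \<omega> \<in> borel_measurable M" if "\<omega> \<in> space \<Omega>" for \<omega>
    using measurable_compose_Pair1[of \<omega> "past n" "case_prod H" M borel] H that by simp
  have b2: "\<bar>\<integral>y. H \<omega> y \<partial>P (X n \<omega>)\<bar> \<le> c" if "\<omega> \<in> space \<Omega>" for \<omega>
    using that n X_space[OF n that] Hs[OF that]
    by (intro abs_integral_le_bound P_prob) (auto intro!: b cong: measurable_cong_sets)
  have lo2: "0 \<le> (\<integral>y. H \<omega> y \<partial>P (X n \<omega>)) + c" if "\<omega> \<in> space \<Omega>" for \<omega>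
    using b2[OF that] by linarith
  have i1: "integrable \<Omega> (\<lambda>\<omega>. H \<omega> (X (Suc n) \<omega>))"
    by (rule integrable_bounded[OF fm m1, of c]) (auto intro!: b X_space)
  have i2: "integrable \<Omega> (\<lambda>\<omega>. \<integral>y. H \<omega> y \<partial>P (X n \<omega>))"
    by (rule integrable_bounded[OF fm m2 b2])
  \<comment> \<open>Shifting by the bound makes the function nonnegative and reduces to the previous lemma.\<close>
  have "ennreal (\<integral>\<omega>. H \<omega> (X (Suc n) \<omega>) + c \<partial>\<Omega>) = (\<integral>\<^sup>+\<omega>. ennreal (H \<omega> (X (Suc n) \<omega>) + c) \<partial>\<Omega>)"
    using i1 lo X_space[of "Suc n"] by (intro nn_integral_eq_integral[symmetric]) auto 
  also have "\<dots> = (\<integral>\<^sup>+\<omega>. (\<integral>\<^sup>+y. ennreal (H \<omega> y + c) \<partial>P (X n \<omega>)) \<partial>\<Omega>)"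
    by (rule nn_integral_step[OF n, of "\<lambda>\<omega> y. ennreal (H \<omega> y + c)"]) measurable
  also have "\<dots> = (\<integral>\<^sup>+\<omega>. ennreal ((\<integral>y. H \<omega> y \<partial>P (X n \<omega>)) + c) \<partial>\<Omega>)"
  proof (rule nn_integral_cong)
    fix \<omega> assume w: "\<omega> \<in> space \<Omega>"
    then have x: "X n \<omega> \<in> space M" using n by (simp add: X_space)
    interpret Px: prob_space "P (X n \<omega>)" by (rule P_prob[OF x])
    have i: "integrable (P (X n \<omega>)) (H \<omega>)"
      by (rule integrable_bounded[where c = c]) (use Hs[OF w] w x b in \<open>auto simp: Px.finite_measure_axioms cong: measurable_cong_sets\<close>)
    have "(\<integral>\<^sup>+y. ennreal (H \<omega> y + c) \<partial>P (X n \<omega>)) = ennreal (\<integral>y. H \<omega> y + c \<partial>P (X n \<omega>))"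
      using i lo[OF w] x by (intro nn_integral_eq_integral) auto
    then show "(\<integral>\<^sup>+y. ennreal (H \<omega> y + c) \<partial>P (X n \<omega>)) = ennreal ((\<integral>y. H \<omega> y \<partial>P (X n \<omega>)) + c)"
      using i by (simp add: Px.prob_space)
  qed
  also have "\<dots> = ennreal (\<integral>\<omega>. (\<integral>y. H \<omega> y \<partial>P (X n \<omega>)) + c \<partial>\<Omega>)"
    using i2 lo2 by (intro nn_integral_eq_integral) auto
  finally have e: "ennreal (\<integral>\<omega>. H \<omega> (X (Suc n) \<omega>) + c \<partial>\<Omega>) = ennreal (\<integral>\<omega>. (\<integral>y. H \<omega> y \<partial>P (X n \<omega>)) + c \<partial>\<Omega>)" .
  have "(\<integral>\<omega>. H \<omega> (X (Suc n) \<omega>) + c \<partial>\<Omega>) = (\<integral>\<omega>. (\<integral>y. H \<omega> y \<partial>P (X n \<omega>)) + c \<partial>\<Omega>)"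
    using e lo lo2 X_space[of "Suc n"]
    by (subst (asm) ennreal_inj) (auto intro!: Bochner_Integration.integral_nonneg)
  then show ?thesis using i1 i2 by (simp add: prob_space)
qed

end

section \<open>Iterated kernels\<close>

context markov_process
begin

lemma pow_kernel[measurable]: "kernel_pow M P k \<in> M \<rightarrow>\<^sub>M prob_algebra M"
proof (induction k)
  case 0
  have "kernel_pow M P 0 = return M" by (rule ext) simp
  then show ?case by simp
next
  case (Suc k)
  have "kernel_pow M P (Suc k) = (\<lambda>x. kernel_pow M P k x \<bind> P)" by (rule ext) simp
  then show ?case using measurable_bind_prob_space[OF Suc P_kernel] by simp
qed

lemma pow_subkernel[measurable]: "kernel_pow M P k \<in> M \<rightarrow>\<^sub>M subprob_algebra M"
  by (rule measurable_prob_algebraD[OF pow_kernel])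

lemma pow_sets: "x \<in> space M \<Longrightarrow> sets (kernel_pow M P k x) = sets M"
  and pow_prob: "x \<in> space M \<Longrightarrow> prob_space (kernel_pow M P k x)"
  using measurable_space[OF pow_kernel] by (auto simp: space_prob_algebra)

lemma pow_space: "x \<in> space M \<Longrightarrow> space (kernel_pow M P k x) = space M"
  by (intro sets_eq_imp_space_eq pow_sets)

lemma borel_pow: "x \<in> space M \<Longrightarrow> borel_measurable (kernel_pow M P k x) = borel_measurable M"
  by (rule measurable_cong_sets[OF pow_sets refl])

lemma pow_finite: "x \<in> space M \<Longrightarrow> finite_measure (kernel_pow M P k x)"
  using pow_prob prob_space.finite_measure by blast

text \<open>
  Iterates are defined by adding a step at the end; conditioning on the present
  splits off the first step instead.
\<close>

lemma pow_Suc_left: "x \<in> space M \<Longrightarrow> kernel_pow M P (Suc k) x = P x \<bind> kernel_pow M P k"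
proof (induction k)
  case 0
  have e: "kernel_pow M P 0 = return M" by (rule ext) simp
  show ?case using 0 unfolding e by (simp add: bind_return[OF P_subkernel] bind_return'')
next
  case (Suc k)
  have "kernel_pow M P (Suc (Suc k)) x = (P x \<bind> kernel_pow M P k) \<bind> P"
    using Suc by simp
  also have "\<dots> = P x \<bind> (\<lambda>y. kernel_pow M P k y \<bind> P)"
    by (rule bind_assoc[where N = M and R = M]) (use Suc in \<open>simp_all add: measurable_cong_sets[OF P_sets refl]\<close>)
  also have "(\<lambda>y. kernel_pow M P k y \<bind> P) = kernel_pow M P (Suc k)" by (rule ext) simp
  finally show ?case .
qed

text \<open>
  The function \<open>P\<^sup>k f\<close>.
\<close>

definition pint :: "nat \<Rightarrow> ('a \<Rightarrow> real) \<Rightarrow> 'a \<Rightarrow> real" where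
  "pint k f x = (\<integral>y. f y \<partial>kernel_pow M P k x)"

lemma pint_0: "x \<in> space M \<Longrightarrow> f \<in> borel_measurable M \<Longrightarrow> pint 0 f x = f x"
  by (simp add: pint_def integral_return)

lemma pint_measurable[measurable]:
  assumes [measurable]: "f \<in> borel_measurable M"
  shows "pint k f \<in> borel_measurable M"
proof -
  have "(\<lambda>x. \<integral>y. f y \<partial>kernel_pow M P k x) \<in> borel_measurable M"
    by (rule borel_measurable_kernel_integral[where M = M]) (auto simp: pow_subkernel)
  then show ?thesis by (simp add: pint_def[abs_def])
qed

lemma pint_measurable2:
  assumes "case_prod f \<in> borel_measurable (M \<Otimes>\<^sub>M Q)"
  shows "(\<lambda>(x, b). pint k (\<lambda>y. f y b) x) \<in> borel_measurable (M \<Otimes>\<^sub>M Q)"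
proof -
  note [measurable] = assms
  show ?thesis unfolding pint_def case_prod_beta
    by (rule borel_measurable_kernel_integral[where M = M]) measurable
qed

lemma pint_bounded:
  assumes "x \<in> space M" "f \<in> borel_measurable M" "\<And>x. x \<in> space M \<Longrightarrow> \<bar>f x\<bar> \<le> c"
  shows "\<bar>pint k f x\<bar> \<le> c"
  unfolding pint_def using assms
  by (intro abs_integral_le_bound pow_prob) (auto simp: pow_space borel_pow)

lemma P_integral_bounded:
  fixes f :: "'a \<Rightarrow> real"
  assumes "x \<in> space M" "f \<in> borel_measurable M" "\<And>x. x \<in> space M \<Longrightarrow> \<bar>f x\<bar> \<le> c"
  shows "\<bar>\<integral>y. f y \<partial>P x\<bar> \<le> c"
  by (rule abs_integral_le_bound[OF P_prob[OF assms(1)]])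
    (use assms in \<open>auto simp: borel_P\<close>)

lemma P_finite: "x \<in> space M \<Longrightarrow> finite_measure (P x)"
  using P_prob prob_space.finite_measure by blast

lemma pint_Suc:
  assumes x: "x \<in> space M" and f: "f \<in> borel_measurable M" and b: "\<And>x. x \<in> space M \<Longrightarrow> \<bar>f x\<bar> \<le> c"
  shows "pint (Suc k) f x = (\<integral>y. pint k f y \<partial>P x)"
  unfolding pint_def pow_Suc_left[OF x]
proof (rule integral_bind[where K = M and B = c and B' = 1])
  show "kernel_pow M P k \<in> P x \<rightarrow>\<^sub>M subprob_algebra M"
    using x by (simp add: measurable_cong_sets[OF P_sets refl])
  show "AE y in P x. emeasure (kernel_pow M P k y) (space (kernel_pow M P k y)) \<le> ennreal 1"
    using x pow_prob[THEN prob_space.emeasure_space_1] by (intro AE_I2) simp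
qed (use f b P_finite[OF x] in auto)

lemma pint_add:
  assumes x: "x \<in> space M" and f: "f \<in> borel_measurable M" and b: "\<And>x. x \<in> space M \<Longrightarrow> \<bar>f x\<bar> \<le> c"
  shows "pint (k + l) f x = pint k (pint l f) x"
  using x
proof (induction k arbitrary: x)
  case 0
  then show ?case using f by (simp add: pint_0 pint_measurable)
next
  case (Suc k)
  have "pint (Suc k + l) f x = (\<integral>y. pint (k + l) f y \<partial>P x)"
    using pint_Suc[OF Suc.prems f b, of "k + l"] by simp
  also have "\<dots> = (\<integral>y. pint k (pint l f) y \<partial>P x)"
    using Suc by (intro Bochner_Integration.integral_cong) auto
  also have "\<dots> = pint (Suc k) (pint l f) x"
    using pint_Suc[OF Suc.prems pint_measurable[OF f], of l c] pint_bounded[OF _ f b] by simp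
  finally show ?case .
qed

end

section \<open>Geometric forgetting under a minorization condition\<close>

locale minorized_chain = markov_process \<Omega> M P chi X
  for \<Omega> :: "'w measure" and M :: "'a measure" and P chi X +
  fixes \<mu> \<pi> :: "'a measure" and m :: nat and \<delta> :: real
  assumes m: "m \<ge> 1" and \<delta>: "\<delta> > 0" and mu: "\<mu> \<in> space (prob_algebra M)"
    and minorized: "\<And>x D. x \<in> space M \<Longrightarrow> D \<in> sets M \<Longrightarrow> \<delta> * measure \<mu> D \<le> measure (kernel_pow M P m x) D"
    and inv: "invariant_distribution M P \<pi>"
begin

lemma pi_prob: "prob_space \<pi>" and pi_sets[simp, measurable_cong]: "sets \<pi> = sets M" and pi_P: "\<pi> \<bind> P = \<pi>"
  using inv by (auto simp: invariant_distribution_def space_prob_algebra)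

lemma mu_prob: "prob_space \<mu>" and mu_sets[simp, measurable_cong]: "sets \<mu> = sets M"
  using mu by (auto simp: space_prob_algebra)

lemma pi_space[simp]: "space \<pi> = space M" and mu_space[simp]: "space \<mu> = space M"
  by (intro sets_eq_imp_space_eq; simp)+

lemma space_nonempty: "\<exists>x. x \<in> space M"
  using prob_space.not_empty[OF pi_prob] by auto

lemma delta_le_1: "\<delta> \<le> 1"
proof -
  obtain x where x: "x \<in> space M" using space_nonempty by blast
  interpret mu: prob_space \<mu> by (rule mu_prob)
  interpret P: prob_space "kernel_pow M P m x" by (rule pow_prob[OF x])
  from minorized[OF x sets.top] show ?thesis
    using mu.prob_space P.prob_space by (simp add: pow_space[OF x])
qed

lemma invariant_integral:
  assumes f: "f \<in> borel_measurable M" and b: "\<And>x. x \<in> space M \<Longrightarrow> \<bar>f x\<bar> \<le> c"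
  shows "(\<integral>x. pint k f x \<partial>\<pi>) = (\<integral>x. f x \<partial>\<pi>)"
proof (induction k)
  case 0
  show ?case using f by (intro Bochner_Integration.integral_cong) (auto simp: pint_0)
next
  case (Suc k)
  have "(\<integral>x. pint k f x \<partial>\<pi>) = (\<integral>x. pint k f x \<partial>(\<pi> \<bind> P))" by (simp add: pi_P)
  also have "\<dots> = (\<integral>x. (\<integral>y. pint k f y \<partial>P x) \<partial>\<pi>)"
  proof (rule integral_bind[where K = M and B = c and B' = 1])
    show "AE y in \<pi>. emeasure (P y) (space (P y)) \<le> ennreal 1"
      using P_prob[THEN prob_space.emeasure_space_1] by (intro AE_I2) simp
    show "finite_measure \<pi>" using pi_prob prob_space.finite_measure by blast
  qed (use pint_measurable[OF f] pint_bounded[OF _ f b] in auto)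
  also have "\<dots> = (\<integral>x. pint (Suc k) f x \<partial>\<pi>)"
    using pint_Suc[OF _ f b] by (intro Bochner_Integration.integral_cong) auto
  finally show ?case using Suc by simp
qed

text \<open>
  The part \<open>\<delta> \<mu>\<close> of \<open>P\<^sup>m (x, \<cdot>)\<close> does not depend on \<open>x\<close>, and the rest has mass \<open>1 - \<delta>\<close>.
\<close>

lemma minorized_integral_lower:
  assumes x: "x \<in> space M" and f[measurable]: "f \<in> borel_measurable M"
    and b: "\<And>x. x \<in> space M \<Longrightarrow> a \<le> f x" "\<And>x. x \<in> space M \<Longrightarrow> f x \<le> b"
  shows "\<delta> * (\<integral>y. f y \<partial>\<mu>) + (1 - \<delta>) * a \<le> pint m f x"
proof -
  let ?P = "kernel_pow M P m x"
  interpret mu: prob_space \<mu> by (rule mu_prob)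
  interpret P: prob_space ?P by (rule pow_prob[OF x])
  have f'[measurable]: "f \<in> borel_measurable ?P" using x by (simp add: borel_pow)
  have b': "\<bar>f x\<bar> \<le> max \<bar>a\<bar> \<bar>b\<bar>" if "x \<in> space M" for x using b[OF that] by linarith
  have i1: "integrable ?P f" by (rule integrable_bounded[OF P.finite_measure_axioms f']) (use b' pow_space[OF x] in auto)
  have i2: "integrable \<mu> f" by (rule integrable_bounded[OF mu.finite_measure_axioms]) (use b' in auto)
  have "(\<integral>\<^sup>+y. ennreal (f y - a) \<partial>scale_measure (ennreal \<delta>) \<mu>) \<le> (\<integral>\<^sup>+y. ennreal (f y - a) \<partial>?P)"
  proof (rule nn_integral_mono_measure)
    show "sets (scale_measure (ennreal \<delta>) \<mu>) = sets ?P" using x by (simp add: pow_sets)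
    show "scale_measure (ennreal \<delta>) \<mu> \<le> ?P"
    proof (subst le_measure)
      show "sets (scale_measure (ennreal \<delta>) \<mu>) = sets ?P" using x by (simp add: pow_sets)
      show "\<forall>A\<in>sets (scale_measure (ennreal \<delta>) \<mu>). emeasure (scale_measure (ennreal \<delta>) \<mu>) A \<le> emeasure ?P A"
        using minorized[OF x] \<delta>
        by (auto simp: mu.emeasure_eq_measure P.emeasure_eq_measure ennreal_mult[symmetric] intro!: ennreal_leI)
    qed
  qed
  then have "ennreal \<delta> * (\<integral>\<^sup>+y. ennreal (f y - a) \<partial>\<mu>) \<le> (\<integral>\<^sup>+y. ennreal (f y - a) \<partial>?P)"
    by (subst (asm) nn_integral_scale_measure) auto
  also have "(\<integral>\<^sup>+y. ennreal (f y - a) \<partial>\<mu>) = ennreal ((\<integral>y. f y \<partial>\<mu>) - a)"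
    using i2 b by (subst nn_integral_eq_integral) (auto simp: mu.prob_space[simplified])
  also have "(\<integral>\<^sup>+y. ennreal (f y - a) \<partial>?P) = ennreal (pint m f x - a)"
    using i1 b x P.prob_space by (subst nn_integral_eq_integral) (auto simp: pow_space pint_def)
  finally have "ennreal (\<delta> * ((\<integral>y. f y \<partial>\<mu>) - a)) \<le> ennreal (pint m f x - a)"
    using \<delta> by (simp add: ennreal_mult')
  moreover have "a \<le> pint m f x"
  proof -
    have "(\<integral>y. a \<partial>?P) \<le> pint m f x" unfolding pint_def
      using i1 b x by (intro integral_mono) (auto simp: pow_space)
    then show ?thesis using P.prob_space by simp
  qed
  ultimately have "\<delta> * ((\<integral>y. f y \<partial>\<mu>) - a) \<le> pint m f x - a"
    by (subst (asm) ennreal_le_iff) auto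
  then show ?thesis by (simp add: algebra_simps)
qed

lemma minorized_integral_upper:
  assumes x: "x \<in> space M" and f[measurable]: "f \<in> borel_measurable M"
    and b: "\<And>x. x \<in> space M \<Longrightarrow> a \<le> f x" "\<And>x. x \<in> space M \<Longrightarrow> f x \<le> b"
  shows "pint m f x \<le> \<delta> * (\<integral>y. f y \<partial>\<mu>) + (1 - \<delta>) * b"
proof -
  have "\<delta> * (\<integral>y. - f y \<partial>\<mu>) + (1 - \<delta>) * (- b) \<le> pint m (\<lambda>y. - f y) x"
    by (rule minorized_integral_lower[where b = "-a"]) (use x b in auto)
  then show ?thesis by (simp add: pint_def)
qed

text \<open>
  Doeblin's argument: the upper and lower bounds for a block of \<open>m\<close> steps share the term
  \<open>\<delta> \<integral>f d\<mu>\<close>, so their difference shrinks by the factor \<open>1 - \<delta>\<close>.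
\<close>

lemma oscillation_contracts:
  assumes f[measurable]: "f \<in> borel_measurable M" and b: "\<And>x. x \<in> space M \<Longrightarrow> \<bar>f x\<bar> \<le> c"
  shows "\<exists>a. \<forall>x\<in>space M. a \<le> pint (m * l) f x \<and> pint (m * l) f x \<le> a + 2 * c * (1 - \<delta>) ^ l"
proof (induction l)
  case 0
  have "- c \<le> pint (m * 0) f x \<and> pint (m * 0) f x \<le> - c + 2 * c * (1 - \<delta>) ^ 0" if "x \<in> space M" for x
    using b[OF that] by (simp add: pint_0[OF that f] abs_le_iff)
  then show ?case by blast
next
  case (Suc l)
  then obtain a where a: "\<And>x. x \<in> space M \<Longrightarrow> a \<le> pint (m * l) f x"
      "\<And>x. x \<in> space M \<Longrightarrow> pint (m * l) f x \<le> a + 2 * c * (1 - \<delta>) ^ l" by blast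
  let ?a = "\<delta> * (\<integral>y. pint (m * l) f y \<partial>\<mu>) + (1 - \<delta>) * a"
  have "?a \<le> pint (m * Suc l) f x \<and> pint (m * Suc l) f x \<le> ?a + 2 * c * (1 - \<delta>) ^ Suc l" if x: "x \<in> space M" for x
  proof -
    have e: "pint (m * Suc l) f x = pint m (pint (m * l) f) x"
      using pint_add[OF x f b, of m "m * l"] by simp
    have "?a \<le> pint m (pint (m * l) f) x"
      by (rule minorized_integral_lower[OF x _ a]) auto
    moreover have "pint m (pint (m * l) f) x \<le> \<delta> * (\<integral>y. pint (m * l) f y \<partial>\<mu>) + (1 - \<delta>) * (a + 2 * c * (1 - \<delta>) ^ l)"
      by (rule minorized_integral_upper[OF x _ a]) auto
    ultimately show ?thesis unfolding e by (simp add: algebra_simps)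
  qed
  then show ?case by blast
qed

definition decay :: "nat \<Rightarrow> real" where "decay k = 2 * (1 - \<delta>) ^ (k div m)"

lemma decay_nonneg: "0 \<le> decay k"
  using delta_le_1 by (simp add: decay_def)

text \<open>
  Invariance keeps the \<open>\<pi>\<close>-mean at zero, so the interval that contains all values of
  \<open>P\<^sup>k f\<close> contains \<open>0\<close>, and its length bounds the supremum. The \<open>k mod m\<close> steps that do not fill a
  block cannot increase the supremum.
\<close>

lemma pint_decay:
  assumes x: "x \<in> space M" and f[measurable]: "f \<in> borel_measurable M" and b: "\<And>x. x \<in> space M \<Longrightarrow> \<bar>f x\<bar> \<le> c"
    and z: "(\<integral>x. f x \<partial>\<pi>) = 0"
  shows "\<bar>pint k f x\<bar> \<le> c * decay k"
proof -
  interpret pi: prob_space \<pi> by (rule pi_prob)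
  let ?l = "k div m" let ?g = "pint (m * ?l) f" let ?w = "2 * c * (1 - \<delta>) ^ ?l"
  obtain a where a: "\<And>x. x \<in> space M \<Longrightarrow> a \<le> ?g x"
      "\<And>x. x \<in> space M \<Longrightarrow> ?g x \<le> a + ?w" using oscillation_contracts[OF f b] by blast
  have z': "(\<integral>x. ?g x \<partial>\<pi>) = 0" using invariant_integral[OF f b] z by simp
  have ig: "integrable \<pi> ?g"
    by (rule integrable_bounded[OF pi.finite_measure_axioms, of _ c]) (use pint_bounded[OF _ f b] in auto)
  have "(\<integral>x. a \<partial>\<pi>) \<le> (\<integral>x. ?g x \<partial>\<pi>)" using a ig by (intro integral_mono) auto
  then have "a \<le> 0" using z' pi.prob_space by simp
  moreover have "(\<integral>x. ?g x \<partial>\<pi>) \<le> (\<integral>x. a + ?w \<partial>\<pi>)" using a ig by (intro integral_mono) auto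
  then have "0 \<le> a + ?w" using z' pi.prob_space by simp
  ultimately have g: "\<bar>?g y\<bar> \<le> ?w" if "y \<in> space M" for y using a[OF that] by linarith
  have "pint k f x = pint (k mod m) ?g x"
    using pint_add[OF x f b, of "k mod m" "m * ?l"] by simp
  also have "\<bar>\<dots>\<bar> \<le> ?w" by (rule pint_bounded[OF x _ g]) simp
  finally show ?thesis by (simp add: decay_def mult_ac)
qed

text \<open>
  A bound for \<open>\<Sum>k. decay k\<close>, that is, for the norm of the solution operator of the Poisson equation.
\<close>

definition K0 :: real where "K0 = 2 * real m / \<delta>"

lemma K0_pos: "K0 > 0" using m \<delta> by (simp add: K0_def)

lemma sum_decay_le: "(\<Sum>k<n. decay k) \<le> K0"
proof -
  have "(\<Sum>k<n. decay k) \<le> (\<Sum>k<n * m. decay k)"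
    using m by (intro sum_mono2) (auto simp: decay_nonneg intro: order_less_le_trans)
  also have "\<dots> = (\<Sum>q<n. sum decay {q * m..<q * m + m})" by (rule sum.nat_group[symmetric])
  also have "\<dots> = (\<Sum>q<n. real m * (2 * (1 - \<delta>) ^ q))"
  proof (rule sum.cong[OF refl])
    fix q
    have "decay k = 2 * (1 - \<delta>) ^ q" if "k \<in> {q * m..<q * m + m}" for k
    proof -
      have "k div m = q" using that m by (intro div_nat_eqI) (auto simp: mult.commute)
      then show ?thesis by (simp add: decay_def)
    qed
    then have "sum decay {q * m..<q * m + m} = (\<Sum>k\<in>{q * m..<q * m + m}. 2 * (1 - \<delta>) ^ q)" by (intro sum.cong) auto
    then show "sum decay {q * m..<q * m + m} = real m * (2 * (1 - \<delta>) ^ q)" by simp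
  qed
  also have "\<dots> = 2 * real m * (\<Sum>q<n. (1 - \<delta>) ^ q)" by (simp add: sum_distrib_left mult_ac)
  also have "(\<Sum>q<n. (1 - \<delta>) ^ q) = (1 - (1 - \<delta>) ^ n) / \<delta>"
    using \<delta> by (simp add: sum_gp_strict)
  also have "2 * real m * \<dots> \<le> K0"
    using delta_le_1 \<delta> by (auto simp: K0_def field_simps)
  finally show ?thesis .
qed

lemma decay_sum_le: "(\<Sum>i\<in>{s..N}. decay (i - s)) \<le> K0"
proof -
  have "(\<Sum>i\<in>{s..N}. decay (i - s)) = (\<Sum>k<Suc N - s. decay k)"
    by (rule sum.reindex_bij_witness[of _ "\<lambda>k. k + s" "\<lambda>i. i - s"]) auto
  then show ?thesis using sum_decay_le by simp
qed

end

section \<open>Concentration of Hilbert-space valued additive functionals\<close>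

lemma sqrt_add_le:
  fixes s t :: real
  assumes "0 < s" "0 \<le> s\<^sup>2 + t"
  shows "sqrt (s\<^sup>2 + t) \<le> s + t / (2 * s)"
proof (rule real_le_lsqrt)
  have "0 \<le> s\<^sup>2 + (s\<^sup>2 + t)" using assms(2) zero_le_power2[of s] by linarith
  then have "0 \<le> (s\<^sup>2 + (s\<^sup>2 + t)) / (2 * s)" using assms(1) by simp
  then show "0 \<le> s + t / (2 * s)" using assms(1) by (simp add: field_simps power2_eq_square)
  have "(s + t / (2 * s))\<^sup>2 = s\<^sup>2 + t + (t / (2 * s))\<^sup>2"
    using assms by (simp add: power2_sum field_simps power2_eq_square)
  then show "s\<^sup>2 + t \<le> (s + t / (2 * s))\<^sup>2" by simp
qed

lemma square_diff_le: "(p - q)\<^sup>2 \<le> 2 * p\<^sup>2 + 2 * (q::real)\<^sup>2"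
  using zero_le_power2[of "p + q"] by (simp add: power2_sum power2_diff)

text \<open>
  A substitute for the norm of \<open>L\<^sup>2 (Q)\<close> that stays away from the point \<open>0\<close>, where the norm has no
  derivative; the price is the parameter \<open>a\<close>, optimised in \<open>Hilbert_tail\<close>.
\<close>

definition smooth_norm :: "'b measure \<Rightarrow> real \<Rightarrow> ('b \<Rightarrow> real) \<Rightarrow> real" where
  "smooth_norm Q a z = sqrt (a\<^sup>2 + (\<integral>b. (z b)\<^sup>2 \<partial>Q))"

text \<open>
  One step of an Azuma argument for the norm of a Hilbert-space valued martingale. With
  \<open>s = smooth_norm Q a z\<close>, concavity of the square root gives
  \<open>smooth_norm Q a (z + D) \<le> s + (2 \<langle>D, z\<rangle> + \<parallel>D\<parallel>\<^sup>2) / (2 s)\<close>. The linear part \<open>\<langle>D, z\<rangle> / s\<close> is a centred scalar, bounded by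
  \<open>c\<close> because \<open>\<parallel>z\<parallel> \<le> s\<close>, so Hoeffding's lemma applies to it; the quadratic part is at most
  \<open>c\<^sup>2 / (2 a)\<close> because \<open>s \<ge> a\<close>.
\<close>

lemma smooth_norm_exponential_step:
  fixes z :: "'b \<Rightarrow> real" and D :: "'a \<Rightarrow> 'b \<Rightarrow> real"
  assumes \<kappa>: "prob_space \<kappa>" and Q: "finite_measure Q"
    and z[measurable]: "z \<in> borel_measurable Q" and bz: "\<And>b. b \<in> space Q \<Longrightarrow> \<bar>z b\<bar> \<le> c1"
    and D[measurable]: "case_prod D \<in> borel_measurable (\<kappa> \<Otimes>\<^sub>M Q)"
    and bD: "\<And>y b. y \<in> space \<kappa> \<Longrightarrow> b \<in> space Q \<Longrightarrow> \<bar>D y b\<bar> \<le> c2"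
    and D0: "\<And>b. b \<in> space Q \<Longrightarrow> (\<integral>y. D y b \<partial>\<kappa>) = 0"
    and nD: "\<And>y. y \<in> space \<kappa> \<Longrightarrow> (\<integral>b. (D y b)\<^sup>2 \<partial>Q) \<le> c\<^sup>2"
    and c: "0 \<le> c" and a: "0 < a" and l: "0 < l"
  shows "(\<integral>\<^sup>+y. ennreal (exp (l * smooth_norm Q a (\<lambda>b. z b + D y b))) \<partial>\<kappa>)
    \<le> ennreal (exp (l * smooth_norm Q a z + (l * c\<^sup>2 / (2 * a) + l\<^sup>2 * c\<^sup>2 / 2)))"
proof -
  interpret \<kappa>: prob_space \<kappa> by fact
  interpret Q: finite_measure Q by fact
  define s where "s = smooth_norm Q a z"
  define d where "d y = (\<integral>b. D y b * z b \<partial>Q) / s" for y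
  have nz: "0 \<le> (\<integral>b. (z b)\<^sup>2 \<partial>Q)" by simp
  have s2: "s\<^sup>2 = a\<^sup>2 + (\<integral>b. (z b)\<^sup>2 \<partial>Q)" using nz by (simp add: s_def smooth_norm_def)
  have sa: "a \<le> s" using a nz unfolding s_def smooth_norm_def by (intro real_le_rsqrt) simp
  have s0: "0 < s" using a sa by linarith
  have zs: "sqrt (\<integral>b. (z b)\<^sup>2 \<partial>Q) \<le> s" unfolding s_def smooth_norm_def by simp
  have Dy: "D y \<in> borel_measurable Q" if "y \<in> space \<kappa>" for y
    using measurable_compose_Pair1[OF that D] by simp
  have iz: "integrable Q (\<lambda>b. (z b)\<^sup>2)"
    by (rule integrable_square[OF Q z bz])
  have iD: "integrable Q (\<lambda>b. (D y b)\<^sup>2)" if "y \<in> space \<kappa>" for y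
    by (rule integrable_square[OF Q Dy[OF that] bD[OF that]])
  have bDz: "\<bar>D y b * z b\<bar> \<le> c2 * c1" if "y \<in> space \<kappa>" "b \<in> space Q" for y b
    unfolding abs_mult using bD[OF that] bz[OF that(2)] by (intro mult_mono) auto
  have iDz: "integrable Q (\<lambda>b. D y b * z b)" if "y \<in> space \<kappa>" for y
    using Dy[OF that] by (intro integrable_bounded[OF Q _ bDz[OF that]]) auto
  have dm[measurable]: "d \<in> borel_measurable \<kappa>" unfolding d_def by measurable
  have db: "\<bar>d y\<bar> \<le> c" if y: "y \<in> space \<kappa>" for y
  proof -
    have "\<bar>\<integral>b. D y b * z b \<partial>Q\<bar> \<le> sqrt (\<integral>b. (D y b)\<^sup>2 \<partial>Q) * sqrt (\<integral>b. (z b)\<^sup>2 \<partial>Q)"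
      by (rule Cauchy_Schwarz_integral[OF Q Dy[OF y] z bD[OF y] bz])
    also have "\<dots> \<le> c * s"
    proof (rule mult_mono)
      show "sqrt (\<integral>b. (D y b)\<^sup>2 \<partial>Q) \<le> c" using nD[OF y] c by (intro real_le_lsqrt) auto
      show "0 \<le> sqrt (\<integral>b. (z b)\<^sup>2 \<partial>Q)" by simp
    qed (rule zs, rule c)
    finally have "\<bar>\<integral>b. D y b * z b \<partial>Q\<bar> / s \<le> c" by (simp only: pos_divide_le_eq[OF s0])
    then show ?thesis unfolding d_def abs_divide abs_of_pos[OF s0] .
  qed
  have d0: "\<kappa>.expectation d = 0"
  proof -
    have "(\<integral>y. (\<integral>b. D y b * z b \<partial>Q) \<partial>\<kappa>) = (\<integral>b. (\<integral>y. D y b * z b \<partial>\<kappa>) \<partial>Q)"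
      by (rule Fubini_bounded[OF \<kappa>.finite_measure_axioms Q _ bDz]) measurable
    also have "\<dots> = 0" using D0 by (simp cong: Bochner_Integration.integral_cong)
    finally have "(\<integral>y. (\<integral>b. D y b * z b \<partial>Q) \<partial>\<kappa>) = 0" .
    then show ?thesis unfolding d_def by simp
  qed
  interpret I: interval_bounded_random_variable \<kappa> d "-c" c
  proof
    show "AE y in \<kappa>. d y \<in> {-c..c}"
      by (rule AE_I2) (use db in \<open>simp add: abs_le_iff minus_le_iff\<close>)
  qed (rule dm)
  have pt: "smooth_norm Q a (\<lambda>b. z b + D y b) \<le> s + c\<^sup>2 / (2 * a) + d y" if y: "y \<in> space \<kappa>" for y
  proof -
    let ?t = "2 * (\<integral>b. D y b * z b \<partial>Q) + (\<integral>b. (D y b)\<^sup>2 \<partial>Q)"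
    have "(\<integral>b. (z b + D y b)\<^sup>2 \<partial>Q) = (\<integral>b. (z b)\<^sup>2 + (2 * (D y b * z b) + (D y b)\<^sup>2) \<partial>Q)"
      by (intro Bochner_Integration.integral_cong) (auto simp: power2_sum)
    also have "\<dots> = (\<integral>b. (z b)\<^sup>2 \<partial>Q) + ?t"
      using iz iD[OF y] iDz[OF y] by simp
    finally have e: "a\<^sup>2 + (\<integral>b. (z b + D y b)\<^sup>2 \<partial>Q) = s\<^sup>2 + ?t" by (simp add: s2)
    have "0 \<le> (\<integral>b. (z b + D y b)\<^sup>2 \<partial>Q)" by simp
    then have "0 \<le> s\<^sup>2 + ?t" unfolding e[symmetric] by simp
    then have "sqrt (s\<^sup>2 + ?t) \<le> s + ?t / (2 * s)" by (rule sqrt_add_le[OF s0])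
    also have "?t / (2 * s) = d y + (\<integral>b. (D y b)\<^sup>2 \<partial>Q) / (2 * s)"
      using s0 by (simp add: d_def field_simps)
    also have "(\<integral>b. (D y b)\<^sup>2 \<partial>Q) / (2 * s) \<le> c\<^sup>2 / (2 * a)"
      using nD[OF y] sa a by (intro frac_le) auto
    finally show ?thesis unfolding smooth_norm_def e by simp
  qed
  have "(\<integral>\<^sup>+y. ennreal (exp (l * smooth_norm Q a (\<lambda>b. z b + D y b))) \<partial>\<kappa>)
    \<le> (\<integral>\<^sup>+y. ennreal (exp (l * (s + c\<^sup>2 / (2 * a)))) * ennreal (exp (l * d y)) \<partial>\<kappa>)"
  proof (rule nn_integral_mono)
    fix y assume "y \<in> space \<kappa>"
    from mult_left_mono[OF pt[OF this], of l] l
    have "exp (l * smooth_norm Q a (\<lambda>b. z b + D y b)) \<le> exp (l * (s + c\<^sup>2 / (2 * a)) + l * d y)"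
      by (simp add: distrib_left)
    then show "ennreal (exp (l * smooth_norm Q a (\<lambda>b. z b + D y b))) \<le> ennreal (exp (l * (s + c\<^sup>2 / (2 * a)))) * ennreal (exp (l * d y))"
      by (simp only: ennreal_mult[symmetric] exp_ge_zero exp_add[symmetric] ennreal_leI)
  qed
  also have "\<dots> = ennreal (exp (l * (s + c\<^sup>2 / (2 * a)))) * (\<integral>\<^sup>+y. ennreal (exp (l * d y)) \<partial>\<kappa>)"
    by (rule nn_integral_cmult) measurable
  also have "\<dots> \<le> ennreal (exp (l * (s + c\<^sup>2 / (2 * a)))) * ennreal (exp (l\<^sup>2 * (c - - c)\<^sup>2 / 8))"
    by (rule mult_left_mono[OF I.Hoeffdings_lemma_nn_integral_0[OF l d0]]) simp
  also have "\<dots> = ennreal (exp (l * s + (l * c\<^sup>2 / (2 * a) + l\<^sup>2 * c\<^sup>2 / 2)))"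
  proof -
    have "l * (s + c\<^sup>2 / (2 * a)) + l\<^sup>2 * (c - - c)\<^sup>2 / 8 = l * s + (l * c\<^sup>2 / (2 * a) + l\<^sup>2 * c\<^sup>2 / 2)"
      by (simp add: algebra_simps power2_eq_square)
    then show ?thesis by (simp only: ennreal_mult[symmetric] exp_ge_zero exp_add[symmetric])
  qed
  finally show ?thesis unfolding s_def .
qed

context minorized_chain
begin

text \<open>
  The expectation of \<open>\<Sum>i=r..N. \<xi>\<^sub>i (X\<^sub>i)\<close> for a chain that is at \<open>x\<close> at time \<open>s\<close>. Only \<open>r = s\<close> (the present term
  included) and \<open>r = Suc s\<close> (a prediction one step ahead) occur.
\<close>

definition corrector :: "(nat \<Rightarrow> 'a \<Rightarrow> 'b \<Rightarrow> real) \<Rightarrow> nat \<Rightarrow> nat \<Rightarrow> nat \<Rightarrow> 'a \<Rightarrow> 'b \<Rightarrow> real" where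
  "corrector \<xi> N r s x b = (\<Sum>i=r..N. pint (i - s) (\<lambda>y. \<xi> i y b) x)"

text \<open>
  The conditional expectation of the complete sum \<open>\<Sum>i=1..N. \<xi>\<^sub>i (X\<^sub>i)\<close> given the chain up to time \<open>s\<close>.
\<close>

definition Doob :: "(nat \<Rightarrow> 'a \<Rightarrow> 'b \<Rightarrow> real) \<Rightarrow> nat \<Rightarrow> nat \<Rightarrow> 'w \<Rightarrow> 'b \<Rightarrow> real" where
  "Doob \<xi> N s \<omega> b = (\<Sum>i=1..<s. \<xi> i (X i \<omega>) b) + corrector \<xi> N s s (X s \<omega>) b"

context
  fixes Q :: "'b measure" and \<xi> :: "nat \<Rightarrow> 'a \<Rightarrow> 'b \<Rightarrow> real" and c0 \<beta> :: real and N :: nat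
  assumes Q: "finite_measure Q"
    and xi[measurable]: "\<And>i. case_prod (\<xi> i) \<in> borel_measurable (M \<Otimes>\<^sub>M Q)"
    and bxi: "\<And>i x b. x \<in> space M \<Longrightarrow> b \<in> space Q \<Longrightarrow> \<bar>\<xi> i x b\<bar> \<le> c0"
    and xi0: "\<And>i b. b \<in> space Q \<Longrightarrow> (\<integral>x. \<xi> i x b \<partial>\<pi>) = 0"
    and nxi: "\<And>i x. x \<in> space M \<Longrightarrow> (\<integral>b. (\<xi> i x b)\<^sup>2 \<partial>Q) \<le> \<beta>\<^sup>2"
    and \<beta>: "0 \<le> \<beta>"
begin

lemma xi_measurable1: "b \<in> space Q \<Longrightarrow> (\<lambda>y. \<xi> i y b) \<in> borel_measurable M"
  using measurable_Pair1[OF xi[of i], of b] by simp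

lemma xi_measurable2: "x \<in> space M \<Longrightarrow> \<xi> i x \<in> borel_measurable Q"
  using measurable_compose_Pair1[of x M "case_prod (\<xi> i)" Q borel] xi by simp

lemma corrector_measurable[measurable]: "case_prod (corrector \<xi> N r s) \<in> borel_measurable (M \<Otimes>\<^sub>M Q)"
  unfolding corrector_def case_prod_beta
  using pint_measurable2[OF xi] by (intro borel_measurable_sum) (simp add: case_prod_beta)

lemma corrector_measurable1: "b \<in> space Q \<Longrightarrow> (\<lambda>y. corrector \<xi> N r s y b) \<in> borel_measurable M"
  using measurable_Pair1[OF corrector_measurable] by simp

lemma corrector_measurable2: "y \<in> space M \<Longrightarrow> corrector \<xi> N r s y \<in> borel_measurable Q"
  using measurable_Pair2[OF corrector_measurable] by simp

lemma c0_nonneg: "b \<in> space Q \<Longrightarrow> 0 \<le> c0"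
  using bxi space_nonempty by (meson abs_ge_zero order_trans)

lemma corrector_bounded:
  assumes "x \<in> space M" "b \<in> space Q"
  shows "\<bar>corrector \<xi> N r s x b\<bar> \<le> real (Suc N) * c0"
proof -
  have "\<bar>corrector \<xi> N r s x b\<bar> \<le> (\<Sum>i=r..N. \<bar>pint (i - s) (\<lambda>y. \<xi> i y b) x\<bar>)"
    unfolding corrector_def by (rule sum_abs)
  also have "\<dots> \<le> (\<Sum>i=r..N. c0)"
    using assms by (intro sum_mono pint_bounded xi_measurable1 bxi) auto
  also have "\<dots> \<le> real (Suc N) * c0"
    using c0_nonneg[OF assms(2)] by (simp add: mult_right_mono)
  finally show ?thesis .
qed

text \<open>
  The norm of \<open>w = corrector \<xi> N r s x\<close> is found by testing \<open>w\<close> against itself: \<open>\<langle>w, w\<rangle>\<close> is the sum of the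
  \<open>P\<^bsup>i-s\<^esup> f\<^sub>i (x)\<close> for the scalar functions \<open>f\<^sub>i (y) = \<langle>\<xi>\<^sub>i (y), w\<rangle>\<close>, which are \<open>\<pi>\<close>-centred and bounded by
  \<open>\<beta> \<parallel>w\<parallel>\<close>. Scalar geometric decay then yields \<open>\<parallel>w\<parallel>\<^sup>2 \<le> K0 \<beta> \<parallel>w\<parallel>\<close>.
\<close>

lemma corrector_norm:
  assumes x: "x \<in> space M" and s: "s \<le> r"
  shows "(\<integral>b. (corrector \<xi> N r s x b)\<^sup>2 \<partial>Q) \<le> (K0 * \<beta>)\<^sup>2"
proof -
  interpret Q: finite_measure Q by (rule Q)
  define w where "w = corrector \<xi> N r s x"
  let ?n = "\<integral>b. (w b)\<^sup>2 \<partial>Q"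
  let ?C = "real (Suc N) * c0"
  have w[measurable]: "w \<in> borel_measurable Q"
    unfolding w_def by (rule corrector_measurable2[OF x])
  have bw: "\<bar>w b\<bar> \<le> ?C" if "b \<in> space Q" for b unfolding w_def by (rule corrector_bounded[OF x that])
  have bxw: "\<bar>\<xi> i y b * w b\<bar> \<le> c0 * ?C" if "y \<in> space M" "b \<in> space Q" for i y b
    unfolding abs_mult using bxi[OF that] bw[OF that(2)] by (intro mult_mono) (auto intro: order_trans[OF abs_ge_zero])
  define f where "f i y = (\<integral>b. \<xi> i y b * w b \<partial>Q)" for i y
  have fm[measurable]: "f i \<in> borel_measurable M" for i unfolding f_def by measurable
  have fb: "\<bar>f i y\<bar> \<le> \<beta> * sqrt ?n" if "y \<in> space M" for i y
  proof -
    have "\<bar>f i y\<bar> \<le> sqrt (\<integral>b. (\<xi> i y b)\<^sup>2 \<partial>Q) * sqrt ?n"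
      unfolding f_def by (rule Cauchy_Schwarz_integral[OF Q xi_measurable2[OF that] w bxi[OF that] bw])
    also have "\<dots> \<le> \<beta> * sqrt ?n"
      using nxi[OF that] \<beta> by (intro mult_right_mono real_le_lsqrt) auto
    finally show ?thesis .
  qed
  have f0: "(\<integral>y. f i y \<partial>\<pi>) = 0" for i
  proof -
    have "(\<integral>y. f i y \<partial>\<pi>) = (\<integral>b. (\<integral>y. \<xi> i y b * w b \<partial>\<pi>) \<partial>Q)"
      unfolding f_def
      by (rule Fubini_bounded[OF prob_space.finite_measure[OF pi_prob] Q, where c = "c0 * ?C"])
         (use bxw in simp_all)
    also have "\<dots> = 0" using xi0 by (simp cong: Bochner_Integration.integral_cong)
    finally show ?thesis .
  qed
  have swap: "(\<integral>b. pint k (\<lambda>y. \<xi> i y b) x * w b \<partial>Q) = pint k (f i) x" for i k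
  proof -
    have "pint k (f i) x = (\<integral>b. (\<integral>y. \<xi> i y b * w b \<partial>kernel_pow M P k x) \<partial>Q)"
      unfolding f_def pint_def
      by (rule Fubini_bounded[OF pow_finite[OF x] Q, where c = "c0 * ?C"])
         (use bxw in \<open>simp_all add: pow_space[OF x] measurable_cong_sets[OF sets_pair_measure_cong[OF pow_sets[OF x] refl] refl]\<close>)
    then show ?thesis by (simp add: pint_def)
  qed
  have ip: "integrable Q (\<lambda>b. pint k (\<lambda>y. \<xi> i y b) x * w b)" for i k
  proof (rule integrable_bounded[OF Q])
    have "(\<lambda>b. pint k (\<lambda>y. \<xi> i y b) x) \<in> borel_measurable Q"
      using measurable_compose_Pair1[OF x pint_measurable2[OF xi]] by simp
    then show "(\<lambda>b. pint k (\<lambda>y. \<xi> i y b) x * w b) \<in> borel_measurable Q" by simp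
    show "\<bar>pint k (\<lambda>y. \<xi> i y b) x * w b\<bar> \<le> c0 * ?C" if "b \<in> space Q" for b
      unfolding abs_mult using pint_bounded[OF x xi_measurable1[OF that] bxi[OF _ that]] bw[OF that]
      by (intro mult_mono) (auto intro: order_trans[OF abs_ge_zero])
  qed
  have "?n = (\<integral>b. (\<Sum>i=r..N. pint (i - s) (\<lambda>y. \<xi> i y b) x * w b) \<partial>Q)"
    by (simp add: w_def[symmetric] power2_eq_square sum_distrib_right[symmetric] corrector_def[symmetric])
  also have "\<dots> = (\<Sum>i=r..N. pint (i - s) (f i) x)"
    by (subst Bochner_Integration.integral_sum) (auto simp: ip swap)
  also have "\<dots> \<le> (\<Sum>i=r..N. \<beta> * sqrt ?n * decay (i - s))"
    by (intro sum_mono) (use pint_decay[OF x fm fb f0] in \<open>auto simp: abs_le_iff\<close>)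
  also have "\<dots> = \<beta> * sqrt ?n * (\<Sum>i=r..N. decay (i - s))" by (simp add: sum_distrib_left)
  also have "\<dots> \<le> \<beta> * sqrt ?n * K0"
  proof (rule mult_left_mono)
    have "(\<Sum>i=r..N. decay (i - s)) \<le> (\<Sum>i=s..N. decay (i - s))"
      using s by (intro sum_mono2) (auto simp: decay_nonneg)
    also have "\<dots> \<le> K0" by (rule decay_sum_le)
    finally show "(\<Sum>i=r..N. decay (i - s)) \<le> K0" .
  qed (use \<beta> in simp)
  finally have le: "?n \<le> (K0 * \<beta>) * sqrt ?n" by (simp add: mult_ac)
  have n0: "0 \<le> ?n" by simp
  have "sqrt ?n \<le> K0 * \<beta>"
  proof (cases "?n = 0")
    case False
    then have "0 < ?n" using n0 by linarith
    then have "0 < sqrt ?n" by simp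
    moreover have "sqrt ?n * sqrt ?n \<le> (K0 * \<beta>) * sqrt ?n" using le n0 by simp
    ultimately show ?thesis by (meson mult_right_le_imp_le)
  qed (use \<beta> K0_pos in simp)
  then have "(sqrt ?n)\<^sup>2 \<le> (K0 * \<beta>)\<^sup>2" by (intro power_mono) auto
  then show ?thesis using n0 by (simp add: w_def)
qed

lemma corrector_first:
  assumes x: "x \<in> space M" and b: "b \<in> space Q" and s: "s \<le> N"
  shows "corrector \<xi> N s s x b = \<xi> s x b + corrector \<xi> N (Suc s) s x b"
  unfolding corrector_def using s x xi_measurable1[OF b]
  by (simp add: sum.atLeast_Suc_atMost pint_0)

text \<open>
  The equation of Poisson type that makes \<open>Doob\<close> a martingale.
\<close>

lemma corrector_step:
  assumes x: "x \<in> space M" and b: "b \<in> space Q"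
  shows "corrector \<xi> N (Suc s) s x b = (\<integral>y. corrector \<xi> N (Suc s) (Suc s) y b \<partial>P x)"
proof -
  have ip: "integrable (P x) (pint k (\<lambda>y. \<xi> i y b))" for k i
    by (rule integrable_bounded[OF P_finite[OF x], of _ c0])
       (use pint_bounded[OF _ xi_measurable1[OF b] bxi[OF _ b]] pint_measurable[OF xi_measurable1[OF b]] x
        in \<open>auto simp: borel_P\<close>)
  have "corrector \<xi> N (Suc s) s x b = (\<Sum>i=Suc s..N. \<integral>y. pint (i - Suc s) (\<lambda>y. \<xi> i y b) y \<partial>P x)"
    unfolding corrector_def
  proof (rule sum.cong[OF refl])
    fix i assume "i \<in> {Suc s..N}"
    then have "i - s = Suc (i - Suc s)" by auto
    then show "pint (i - s) (\<lambda>y. \<xi> i y b) x = (\<integral>y. pint (i - Suc s) (\<lambda>y. \<xi> i y b) y \<partial>P x)"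
      using pint_Suc[OF x xi_measurable1[OF b] bxi[OF _ b], of "i - Suc s"] by simp
  qed
  also have "\<dots> = (\<integral>y. corrector \<xi> N (Suc s) (Suc s) y b \<partial>P x)"
    unfolding corrector_def by (rule Bochner_Integration.integral_sum[symmetric]) (rule ip)
  finally show ?thesis .
qed

lemma xi_X_measurable:
  assumes "1 \<le> i" "i \<le> s"
  shows "(\<lambda>(\<omega>, b). \<xi> i (X i \<omega>) b) \<in> borel_measurable (past s \<Otimes>\<^sub>M Q)"
proof -
  note [measurable] = X_past[OF assms]
  show ?thesis unfolding case_prod_beta by measurable
qed

text \<open>
  The increment of \<open>Doob\<close> from \<open>s\<close> to \<open>Suc s\<close> is \<open>F (X (Suc s)) - \<integral>F dP (X s)\<close> for a corrector \<open>F\<close>; both terms have norm at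
  most \<open>K0 \<beta>\<close>, the increment therefore at most \<open>2 K0 \<beta>\<close>.
\<close>

lemma Doob_exponential_step:
  assumes s: "1 \<le> s" "s < N" and a: "0 < a" and l: "0 < l"
  shows "(\<integral>\<^sup>+\<omega>. ennreal (exp (l * smooth_norm Q a (Doob \<xi> N (Suc s) \<omega>))) \<partial>\<Omega>)
    \<le> ennreal (exp (l * (2 * K0 * \<beta>)\<^sup>2 / (2 * a) + l\<^sup>2 * (2 * K0 * \<beta>)\<^sup>2 / 2)) *
       (\<integral>\<^sup>+\<omega>. ennreal (exp (l * smooth_norm Q a (Doob \<xi> N s \<omega>))) \<partial>\<Omega>)"
proof -
  interpret Q: finite_measure Q by (rule Q)
  let ?c = "2 * K0 * \<beta>" and ?C = "real (Suc N) * c0"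
  let ?d = "l * ?c\<^sup>2 / (2 * a) + l\<^sup>2 * ?c\<^sup>2 / 2"
  let ?F = "corrector \<xi> N (Suc s) (Suc s)" and ?G = "corrector \<xi> N (Suc s) s"
  \<comment> \<open>The part of the sum that is known at time \<open>s\<close>.\<close>
  define base where "base \<omega> b = (\<Sum>i=1..s. \<xi> i (X i \<omega>) b)" for \<omega> b
  have base[measurable]: "case_prod base \<in> borel_measurable (past s \<Otimes>\<^sub>M Q)"
    unfolding base_def case_prod_beta using xi_X_measurable[of _ s]
    by (intro borel_measurable_sum) (auto simp: case_prod_beta)
  have Xs[measurable]: "X s \<in> past s \<rightarrow>\<^sub>M M" using s by simp
  define H where "H \<omega> y = ennreal (exp (l * smooth_norm Q a (\<lambda>b. base \<omega> b + ?F y b)))" for \<omega> y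
  have H: "case_prod H \<in> borel_measurable (past s \<Otimes>\<^sub>M M)" unfolding H_def smooth_norm_def by measurable
  have "(\<integral>\<^sup>+\<omega>. ennreal (exp (l * smooth_norm Q a (Doob \<xi> N (Suc s) \<omega>))) \<partial>\<Omega>) = (\<integral>\<^sup>+\<omega>. H \<omega> (X (Suc s) \<omega>) \<partial>\<Omega>)"
    by (simp add: H_def Doob_def[abs_def] base_def atLeastLessThanSuc_atLeastAtMost)
  also have "\<dots> = (\<integral>\<^sup>+\<omega>. (\<integral>\<^sup>+y. H \<omega> y \<partial>P (X s \<omega>)) \<partial>\<Omega>)" by (rule nn_integral_step[OF s(1) H])
  also have "\<dots> \<le> (\<integral>\<^sup>+\<omega>. ennreal (exp ?d) * ennreal (exp (l * smooth_norm Q a (Doob \<xi> N s \<omega>))) \<partial>\<Omega>)"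
  proof (rule nn_integral_mono)
    fix \<omega> assume w: "\<omega> \<in> space \<Omega>"
    define x where "x = X s \<omega>"
    have x: "x \<in> space M" using X_space[OF s(1) w] by (simp add: x_def)
    define D where "D y b = ?F y b - ?G x b" for y b
    have cong: "borel_measurable (P x \<Otimes>\<^sub>M Q) = borel_measurable (M \<Otimes>\<^sub>M Q)"
      by (rule measurable_cong_sets[OF sets_pair_measure_cong[OF P_sets[OF x] refl] refl])
    interpret Px: prob_space "P x" by (rule P_prob[OF x])
    have Gm[measurable]: "?G x \<in> borel_measurable Q" by (rule corrector_measurable2[OF x])
    have e: "base \<omega> b + ?F y b = Doob \<xi> N s \<omega> b + D y b" if "b \<in> space Q" for y b
    proof -
      have "corrector \<xi> N s s x b = \<xi> s x b + ?G x b" using corrector_first[OF x that] s by simp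
      moreover have "base \<omega> b = (\<Sum>i=1..<s. \<xi> i (X i \<omega>) b) + \<xi> s x b"
        unfolding base_def x_def using s by (simp add: sum.last_plus atLeastLessThanSuc_atLeastAtMost[symmetric])
      ultimately show ?thesis by (simp add: Doob_def D_def x_def)
    qed
    have "(\<integral>\<^sup>+y. H \<omega> y \<partial>P x) = (\<integral>\<^sup>+y. ennreal (exp (l * smooth_norm Q a (\<lambda>b. Doob \<xi> N s \<omega> b + D y b))) \<partial>P x)"
      unfolding H_def smooth_norm_def using e by (simp cong: Bochner_Integration.integral_cong)
    also have "\<dots> \<le> ennreal (exp (l * smooth_norm Q a (Doob \<xi> N s \<omega>) + ?d))"
    proof (rule smooth_norm_exponential_step[OF P_prob[OF x] Q])
      show "Doob \<xi> N s \<omega> \<in> borel_measurable Q"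
        unfolding Doob_def[abs_def] using s w
        by (intro borel_measurable_add borel_measurable_sum xi_measurable2 corrector_measurable2 X_space) auto
      show "\<bar>Doob \<xi> N s \<omega> b\<bar> \<le> real s * c0 + ?C" if b: "b \<in> space Q" for b
      proof -
        have "\<bar>\<Sum>i=1..<s. \<xi> i (X i \<omega>) b\<bar> \<le> (\<Sum>i=1..<s. c0)"
          by (rule order_trans[OF sum_abs], rule sum_mono) (auto intro!: bxi X_space w b)
        also have "\<dots> \<le> real s * c0" using c0_nonneg[OF b] by (simp add: mult_right_mono)
        finally show ?thesis unfolding Doob_def using corrector_bounded[OF X_space[OF s(1) w] b, of s s] by linarith
      qed
      show "case_prod D \<in> borel_measurable (P x \<Otimes>\<^sub>M Q)" unfolding cong D_def case_prod_beta by measurable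
      show "\<bar>D y b\<bar> \<le> 2 * ?C" if "y \<in> space (P x)" "b \<in> space Q" for y b
        using corrector_bounded[of y b "Suc s" "Suc s"] corrector_bounded[OF x that(2), of "Suc s" s] that x
        unfolding D_def by simp
      show "(\<integral>y. D y b \<partial>P x) = 0" if b: "b \<in> space Q" for b
      proof -
        have "integrable (P x) (\<lambda>y. ?F y b)"
          by (rule integrable_bounded[OF P_finite[OF x], of _ ?C])
             (use corrector_measurable1[OF b] corrector_bounded[OF _ b] x in \<open>simp_all add: borel_P\<close>)
        then show ?thesis unfolding D_def by (simp add: Px.prob_space corrector_step[OF x b])
      qed
      show "(\<integral>b. (D y b)\<^sup>2 \<partial>Q) \<le> ?c\<^sup>2" if "y \<in> space (P x)" for y
      proof -
        have y: "y \<in> space M" using that x by simp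
        have i1: "integrable Q (\<lambda>b. (?F y b)\<^sup>2)"
          by (rule integrable_square[OF Q corrector_measurable2[OF y] corrector_bounded[OF y]])
        have i2: "integrable Q (\<lambda>b. (?G x b)\<^sup>2)" by (rule integrable_square[OF Q Gm corrector_bounded[OF x]])
        have i3: "integrable Q (\<lambda>b. (D y b)\<^sup>2)"
        proof (rule integrable_square[OF Q])
          show "D y \<in> borel_measurable Q"
            unfolding D_def using corrector_measurable2[OF y, of "Suc s" "Suc s"] by simp
          show "\<bar>D y b\<bar> \<le> 2 * ?C" if "b \<in> space Q" for b
            using corrector_bounded[OF y that, of "Suc s" "Suc s"] corrector_bounded[OF x that, of "Suc s" s]
            unfolding D_def by linarith
        qed
        have "(\<integral>b. (D y b)\<^sup>2 \<partial>Q) \<le> (\<integral>b. 2 * (?F y b)\<^sup>2 + 2 * (?G x b)\<^sup>2 \<partial>Q)"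
        proof (rule integral_mono[OF i3])
          show "integrable Q (\<lambda>b. 2 * (?F y b)\<^sup>2 + 2 * (?G x b)\<^sup>2)" using i1 i2 by simp
          show "(D y b)\<^sup>2 \<le> 2 * (?F y b)\<^sup>2 + 2 * (?G x b)\<^sup>2" for b
            unfolding D_def by (rule square_diff_le)
        qed
        also have "\<dots> \<le> 2 * (K0 * \<beta>)\<^sup>2 + 2 * (K0 * \<beta>)\<^sup>2"
          using i1 i2 corrector_norm[OF y, of "Suc s" "Suc s"] corrector_norm[OF x, of s "Suc s"] by simp
        finally show ?thesis by (simp add: power_mult_distrib mult_ac)
      qed
      show "0 \<le> ?c" using K0_pos \<beta> by simp
    qed (use a l in auto)
    finally show "(\<integral>\<^sup>+y. H \<omega> y \<partial>P (X s \<omega>)) \<le> ennreal (exp ?d) * ennreal (exp (l * smooth_norm Q a (Doob \<xi> N s \<omega>)))"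
      by (simp only: x_def ennreal_mult[symmetric] exp_ge_zero exp_add[symmetric] add.commute)
  qed
  also have "\<dots> = ennreal (exp ?d) * (\<integral>\<^sup>+\<omega>. ennreal (exp (l * smooth_norm Q a (Doob \<xi> N s \<omega>))) \<partial>\<Omega>)"
  proof (rule nn_integral_cmult)
    have "case_prod (Doob \<xi> N s) \<in> borel_measurable (past s \<Otimes>\<^sub>M Q)"
    proof -
      have "(\<lambda>z. \<Sum>i=1..<s. \<xi> i (X i (fst z)) (snd z)) \<in> borel_measurable (past s \<Otimes>\<^sub>M Q)"
        using xi_X_measurable[of _ s, unfolded case_prod_beta] by (intro borel_measurable_sum) (metis atLeastLessThan_iff less_imp_le)
      then show ?thesis unfolding Doob_def case_prod_beta by measurable
    qed
    then have "(\<lambda>\<omega>. ennreal (exp (l * smooth_norm Q a (Doob \<xi> N s \<omega>)))) \<in> borel_measurable (past s)"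
      unfolding smooth_norm_def by measurable
    then show "(\<lambda>\<omega>. ennreal (exp (l * smooth_norm Q a (Doob \<xi> N s \<omega>)))) \<in> borel_measurable \<Omega>"
      by (rule past_measurable)
  qed
  finally show ?thesis .
qed

lemma Doob_exponential_bound:
  assumes s: "1 \<le> s" "s \<le> N" and a: "0 < a" and l: "0 < l"
  shows "(\<integral>\<^sup>+\<omega>. ennreal (exp (l * smooth_norm Q a (Doob \<xi> N s \<omega>))) \<partial>\<Omega>)
    \<le> ennreal (exp (l * (a + 2 * K0 * \<beta>) + real s * (l * (2 * K0 * \<beta>)\<^sup>2 / (2 * a) + l\<^sup>2 * (2 * K0 * \<beta>)\<^sup>2 / 2)))"
  using s
proof (induction s rule: nat_induct_at_least)
  case base
  let ?c = "2 * K0 * \<beta>"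
  have c: "0 \<le> ?c" using K0_pos \<beta> by simp
  have "(\<integral>\<^sup>+\<omega>. ennreal (exp (l * smooth_norm Q a (Doob \<xi> N 1 \<omega>))) \<partial>\<Omega>)
     \<le> (\<integral>\<^sup>+\<omega>. ennreal (exp (l * (a + ?c))) \<partial>\<Omega>)"
  proof (rule nn_integral_mono)
    fix \<omega> assume w: "\<omega> \<in> space \<Omega>"
    have Z1: "Doob \<xi> N 1 \<omega> b = corrector \<xi> N 1 1 (X 1 \<omega>) b" for b by (simp only: Doob_def atLeastLessThan_empty sum.empty add_0 order_refl)
    have "(\<integral>b. (Doob \<xi> N 1 \<omega> b)\<^sup>2 \<partial>Q) \<le> (K0 * \<beta>)\<^sup>2"
      unfolding Z1 by (rule corrector_norm[OF X_space[OF order_refl w] order_refl])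
    also have "\<dots> \<le> ?c\<^sup>2"
    proof (rule power_mono)
      show "0 \<le> K0 * \<beta>" using K0_pos \<beta> by simp
      then show "K0 * \<beta> \<le> ?c" by linarith
    qed
    finally have "(\<integral>b. (Doob \<xi> N 1 \<omega> b)\<^sup>2 \<partial>Q) \<le> ?c\<^sup>2" .
    moreover have "a\<^sup>2 + q\<^sup>2 \<le> (a + q)\<^sup>2" if "0 \<le> q" for q
      using a that by (simp add: power2_sum)
    ultimately have "a\<^sup>2 + (\<integral>b. (Doob \<xi> N 1 \<omega> b)\<^sup>2 \<partial>Q) \<le> (a + ?c)\<^sup>2"
      using c by (meson add_left_mono order_trans)
    then have "smooth_norm Q a (Doob \<xi> N 1 \<omega>) \<le> a + ?c" unfolding smooth_norm_def using a c by (intro real_le_lsqrt) auto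
    then show "ennreal (exp (l * smooth_norm Q a (Doob \<xi> N 1 \<omega>))) \<le> ennreal (exp (l * (a + ?c)))"
      using l by (intro ennreal_leI) simp
  qed
  also have "\<dots> = ennreal (exp (l * (a + ?c)))" by (simp add: emeasure_space_1)
  also have "\<dots> \<le> ennreal (exp (l * (a + ?c) + real 1 * (l * ?c\<^sup>2 / (2 * a) + l\<^sup>2 * ?c\<^sup>2 / 2)))"
    using a l by (intro ennreal_leI) simp
  finally show ?case .
next
  case (Suc s)
  let ?c = "2 * K0 * \<beta>"
  let ?d = "l * ?c\<^sup>2 / (2 * a) + l\<^sup>2 * ?c\<^sup>2 / 2"
  have ar: "d + (e + real s * d) = e + real (Suc s) * d" for d e by (simp add: algebra_simps)
  have "(\<integral>\<^sup>+\<omega>. ennreal (exp (l * smooth_norm Q a (Doob \<xi> N (Suc s) \<omega>))) \<partial>\<Omega>)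
     \<le> ennreal (exp ?d) * (\<integral>\<^sup>+\<omega>. ennreal (exp (l * smooth_norm Q a (Doob \<xi> N s \<omega>))) \<partial>\<Omega>)"
    using Suc by (intro Doob_exponential_step a l) auto
  also have "\<dots> \<le> ennreal (exp ?d) * ennreal (exp (l * (a + ?c) + real s * ?d))"
    using Suc by (intro mult_left_mono) auto
  also have "\<dots> = ennreal (exp (l * (a + ?c) + real (Suc s) * ?d))"
    by (simp only: ennreal_mult[symmetric] exp_ge_zero exp_add[symmetric] ar)
  finally show ?case .
qed

end

end

lemma (in prob_space) exponential_Markov:
  fixes f :: "'a \<Rightarrow> real"
  assumes f[measurable]: "f \<in> borel_measurable M"
    and E: "(\<integral>\<^sup>+\<omega>. ennreal (exp (f \<omega>)) \<partial>M) \<le> ennreal (exp b)"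
  shows "prob {\<omega> \<in> space M. t \<le> f \<omega>} \<le> exp (b - t)"
proof -
  let ?A = "{\<omega> \<in> space M. t \<le> f \<omega>}"
  have "ennreal (exp t) * emeasure M ?A = (\<integral>\<^sup>+\<omega>. ennreal (exp t) * indicator ?A \<omega> \<partial>M)"
    by (rule nn_integral_cmult_indicator[symmetric]) simp
  also have "\<dots> \<le> (\<integral>\<^sup>+\<omega>. ennreal (exp (f \<omega>)) \<partial>M)"
    by (intro nn_integral_mono) (auto split: split_indicator intro: ennreal_leI)
  also have "\<dots> \<le> ennreal (exp b)" by (rule E)
  finally have "ennreal (exp t * prob ?A) \<le> ennreal (exp b)"
    by (simp add: emeasure_eq_measure ennreal_mult)
  then have "exp t * prob ?A \<le> exp b" by (subst (asm) ennreal_le_iff) auto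
  then show ?thesis by (simp add: exp_diff field_simps)
qed

context minorized_chain
begin

text \<open>
  The Chernoff bound for \<open>Doob_exponential_bound\<close> at time \<open>N\<close>, where the corrector reduces to the last summand and
  the martingale is the sum itself.
\<close>

theorem Hilbert_tail:
  fixes Q :: "'b measure" and \<xi> :: "nat \<Rightarrow> 'a \<Rightarrow> 'b \<Rightarrow> real"
  assumes Q: "finite_measure Q"
    and xi: "\<And>i. case_prod (\<xi> i) \<in> borel_measurable (M \<Otimes>\<^sub>M Q)"
    and bxi: "\<And>i x b. x \<in> space M \<Longrightarrow> b \<in> space Q \<Longrightarrow> \<bar>\<xi> i x b\<bar> \<le> c0"
    and xi0: "\<And>i b. b \<in> space Q \<Longrightarrow> (\<integral>x. \<xi> i x b \<partial>\<pi>) = 0"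
    and nxi: "\<And>i x. x \<in> space M \<Longrightarrow> (\<integral>b. (\<xi> i x b)\<^sup>2 \<partial>Q) \<le> \<beta>\<^sup>2"
    and \<beta>: "0 < \<beta>" and N: "1 \<le> N" and u: "1 \<le> u"
  shows "prob {\<omega> \<in> space \<Omega>. (8 * K0 * \<beta>)\<^sup>2 * (real N * u) < (\<integral>b. (\<Sum>i=1..N. \<xi> i (X i \<omega>) b)\<^sup>2 \<partial>Q)} \<le> exp (- u)"
proof -
  interpret Q: finite_measure Q by (rule Q)
  define c where "c = 2 * K0 * \<beta>"
  define R where "R = sqrt (real N)"
  define y where "y = sqrt (2 * u)"
  \<comment> \<open>With \<open>a = c \<surd>N\<close> the total drift \<open>N c\<^sup>2 / (2 a)\<close> is of the order \<open>c \<surd>N\<close> of the deviation sought,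
    and \<open>l\<close> is the value for which the Gaussian term \<open>N l\<^sup>2 c\<^sup>2 / 2\<close> equals \<open>u\<close>.\<close>
  define a where "a = c * R"
  define l where "l = y / (c * R)"
  define S where "S \<omega> = (\<integral>b. (\<Sum>i=1..N. \<xi> i (X i \<omega>) b)\<^sup>2 \<partial>Q)" for \<omega>
  have c: "0 < c" using K0_pos \<beta> by (simp add: c_def)
  have R: "1 \<le> R" using N by (simp add: R_def)
  have y: "0 < y" using u by (simp add: y_def)
  have a: "0 < a" and l: "0 < l" using c R y by (auto simp: a_def l_def)
  have R2: "real N = R\<^sup>2" by (simp add: R_def)
  have Sm: "S \<in> borel_measurable \<Omega>"
  proof -
    have "(\<lambda>z. \<Sum>i=1..N. \<xi> i (X i (fst z)) (snd z)) \<in> borel_measurable (past N \<Otimes>\<^sub>M Q)"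
      using xi_X_measurable[OF Q xi bxi xi0 nxi less_imp_le[OF \<beta>], of _ N, unfolded case_prod_beta]
      by (intro borel_measurable_sum) auto
    then have "S \<in> borel_measurable (past N)" unfolding S_def by measurable
    then show ?thesis by (rule past_measurable)
  qed
  have ZN: "(\<integral>b. (Doob \<xi> N N \<omega> b)\<^sup>2 \<partial>Q) = S \<omega>" if "\<omega> \<in> space \<Omega>" for \<omega>
    unfolding S_def
  proof (rule Bochner_Integration.integral_cong[OF refl])
    fix b assume b: "b \<in> space Q"
    have "corrector \<xi> N N N (X N \<omega>) b = \<xi> N (X N \<omega>) b"
      unfolding corrector_def
      using pint_0[OF X_space[OF N that] measurable_Pair1[OF xi b, of N]] by simp
    then show "(Doob \<xi> N N \<omega> b)\<^sup>2 = (\<Sum>i=1..N. \<xi> i (X i \<omega>) b)\<^sup>2"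
      unfolding Doob_def
      using N by (simp add: sum.last_plus atLeastLessThanSuc_atLeastAtMost[symmetric])
  qed
  have "(\<integral>\<^sup>+\<omega>. ennreal (exp (l * sqrt (a\<^sup>2 + S \<omega>))) \<partial>\<Omega>) = (\<integral>\<^sup>+\<omega>. ennreal (exp (l * smooth_norm Q a (Doob \<xi> N N \<omega>))) \<partial>\<Omega>)"
    by (intro nn_integral_cong) (simp only: smooth_norm_def ZN)
  also have "\<dots> \<le> ennreal (exp (l * (a + c) + real N * (l * c\<^sup>2 / (2 * a) + l\<^sup>2 * c\<^sup>2 / 2)))"
    unfolding c_def by (rule Doob_exponential_bound[OF Q xi bxi xi0 nxi less_imp_le[OF \<beta>] N order_refl a l])
  finally have E: "(\<integral>\<^sup>+\<omega>. ennreal (exp (l * sqrt (a\<^sup>2 + S \<omega>))) \<partial>\<Omega>) \<le> ennreal (exp (l * (a + c) + real N * (l * c\<^sup>2 / (2 * a) + l\<^sup>2 * c\<^sup>2 / 2)))" .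
  define \<tau> where "\<tau> = 4 * c * R * sqrt u"
  have ar: "l * (a + c) + real N * (l * c\<^sup>2 / (2 * a) + l\<^sup>2 * c\<^sup>2 / 2) - l * \<tau> \<le> - u"
  proof -
    have e1: "l * (a + c) = y + y / R" using c R by (simp add: a_def l_def field_simps)
    have e2: "real N * (l * c\<^sup>2 / (2 * a)) = y / 2" using c R by (simp add: R2 a_def l_def field_simps power2_eq_square)
    have e3: "real N * (l\<^sup>2 * c\<^sup>2 / 2) = u" using c R u by (simp add: R2 l_def field_simps power2_eq_square y_def)
    have yu: "y = sqrt 2 * sqrt u" by (simp add: y_def real_sqrt_mult)
    have e4: "l * \<tau> = 4 * sqrt 2 * u" using c R u by (simp add: l_def \<tau>_def yu)
    have "sqrt u \<le> u" using u by (intro real_le_lsqrt) (auto simp: power2_eq_square)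
    then have yle: "y \<le> sqrt 2 * u" unfolding yu by (intro mult_left_mono) auto
    have yR: "y / R \<le> y" using y R by (simp add: field_simps)
    have "1.4 \<le> sqrt (2::real)" by (rule real_le_rsqrt) (simp add: power2_eq_square)
    then have su: "1.4 * u \<le> sqrt 2 * u" using u by (intro mult_right_mono) auto
    have e4': "l * \<tau> = 4 * (sqrt 2 * u)" using e4 by simp
    show ?thesis unfolding distrib_left[of "real N"] e1 e2 e3 e4' using yle yR su u by linarith
  qed
  have "prob {\<omega> \<in> space \<Omega>. (8 * K0 * \<beta>)\<^sup>2 * (real N * u) < S \<omega>} \<le> prob {\<omega> \<in> space \<Omega>. l * \<tau> \<le> l * sqrt (a\<^sup>2 + S \<omega>)}"
  proof (rule finite_measure_mono)
    show "{\<omega> \<in> space \<Omega>. l * \<tau> \<le> l * sqrt (a\<^sup>2 + S \<omega>)} \<in> sets \<Omega>" using Sm by measurable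
    have "l * \<tau> \<le> l * sqrt (a\<^sup>2 + S \<omega>)" if "(8 * K0 * \<beta>)\<^sup>2 * (real N * u) < S \<omega>" for \<omega>
    proof -
      have "\<tau>\<^sup>2 = (8 * K0 * \<beta>)\<^sup>2 * (real N * u)" using u by (simp add: \<tau>_def c_def R2 power_mult_distrib)
      then have "\<tau>\<^sup>2 \<le> a\<^sup>2 + S \<omega>" using that zero_le_power2[of a] by linarith
      then have "\<tau> \<le> sqrt (a\<^sup>2 + S \<omega>)" by (rule real_le_rsqrt)
      then show ?thesis using l by simp
    qed
    then show "{\<omega> \<in> space \<Omega>. (8 * K0 * \<beta>)\<^sup>2 * (real N * u) < S \<omega>} \<subseteq> {\<omega> \<in> space \<Omega>. l * \<tau> \<le> l * sqrt (a\<^sup>2 + S \<omega>)}"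
      by blast
  qed
  also have "\<dots> \<le> exp (l * (a + c) + real N * (l * c\<^sup>2 / (2 * a) + l\<^sup>2 * c\<^sup>2 / 2) - l * \<tau>)"
    by (rule exponential_Markov[OF _ E]) (use Sm in measurable)
  also have "\<dots> \<le> exp (- u)" using ar by simp
  finally show ?thesis by (simp add: S_def)
qed

end

section \<open>A Freedman inequality with one-sided truncation\<close>

lemma exp_le_quadratic: "x \<le> 1 \<Longrightarrow> exp x \<le> 1 + x + x\<^sup>2" for x :: real
proof (cases "0 \<le> x")
  case True
  then show "x \<le> 1 \<Longrightarrow> exp x \<le> 1 + x + x\<^sup>2" by (rule exp_bound)
next
  case False
  define t where "t = - x"
  have t: "0 < t" using False by (simp add: t_def)
  have "exp x = 1 / exp t" by (simp add: t_def exp_minus field_simps)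
  also have "\<dots> \<le> 1 / (1 + t)" using t exp_ge_add_one_self[of t] by (intro divide_left_mono) auto
  also have "\<dots> \<le> 1 - t + t\<^sup>2"
  proof -
    have "(1 - t + t\<^sup>2) * (1 + t) = 1 + t ^ 3" by (simp add: power2_eq_square power3_eq_cube algebra_simps)
    then show ?thesis using t by (simp add: pos_divide_le_eq)
  qed
  finally show "exp x \<le> 1 + x + x\<^sup>2" by (simp add: t_def)
qed

text \<open>
  Truncating \<open>f\<close> from above only, to \<open>0\<close> where \<open>l f > 1\<close>, preserves \<open>exp (l f) \<le> 1 + l f + l\<^sup>2 f\<^sup>2\<close> with the
  untruncated \<open>f\<close> on the right: where the truncation acts, the left side becomes \<open>1\<close> and the right side is larger.
  Hence centring by the mean of \<open>f\<close> itself is enough, and the truncation leaves no error term.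
\<close>

lemma truncated_exponential_le:
  fixes f :: "'a \<Rightarrow> real"
  assumes K: "prob_space K" and f[measurable]: "f \<in> borel_measurable K"
    and b: "\<And>x. x \<in> space K \<Longrightarrow> \<bar>f x\<bar> \<le> c" and l: "0 < l"
  shows "(\<integral>\<^sup>+x. ennreal (exp (l * (if l * f x \<le> 1 then f x else 0) - l * (\<integral>x. f x \<partial>K) - l\<^sup>2 * (\<integral>x. (f x)\<^sup>2 \<partial>K))) \<partial>K) \<le> 1"
proof -
  interpret prob_space K by fact
  let ?m = "\<integral>x. f x \<partial>K" let ?v = "\<integral>x. (f x)\<^sup>2 \<partial>K"
  have i1: "integrable K f" by (rule integrable_bounded[OF finite_measure_axioms f b])
  have i2: "integrable K (\<lambda>x. (f x)\<^sup>2)"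
    by (rule integrable_square[OF finite_measure_axioms f b])
  have pt: "exp (l * (if l * f x \<le> 1 then f x else 0)) \<le> 1 + l * f x + l\<^sup>2 * (f x)\<^sup>2" for x
  proof (cases "l * f x \<le> 1")
    case True
    then show ?thesis using exp_le_quadratic[OF True] by (simp add: power_mult_distrib)
  next
    case False
    then show ?thesis using zero_le_power2[of "l * f x"] by (simp add: power_mult_distrib)
  qed
  have nn: "0 \<le> 1 + l * f x + l\<^sup>2 * (f x)\<^sup>2" for x using pt[of x] exp_ge_zero order_trans by blast
  have "(\<integral>\<^sup>+x. ennreal (exp (l * (if l * f x \<le> 1 then f x else 0) - l * ?m - l\<^sup>2 * ?v)) \<partial>K)
    \<le> (\<integral>\<^sup>+x. ennreal (exp (- l * ?m - l\<^sup>2 * ?v)) * ennreal (1 + l * f x + l\<^sup>2 * (f x)\<^sup>2) \<partial>K)"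
  proof (rule nn_integral_mono)
    fix x
    have "exp (l * (if l * f x \<le> 1 then f x else 0) - l * ?m - l\<^sup>2 * ?v)
        = exp (- l * ?m - l\<^sup>2 * ?v) * exp (l * (if l * f x \<le> 1 then f x else 0))"
      unfolding exp_add[symmetric] by (rule arg_cong[where f = exp]) (simp only: algebra_simps)
    also have "\<dots> \<le> exp (- l * ?m - l\<^sup>2 * ?v) * (1 + l * f x + l\<^sup>2 * (f x)\<^sup>2)"
      by (intro mult_left_mono pt) simp
    finally show "ennreal (exp (l * (if l * f x \<le> 1 then f x else 0) - l * ?m - l\<^sup>2 * ?v))
        \<le> ennreal (exp (- l * ?m - l\<^sup>2 * ?v)) * ennreal (1 + l * f x + l\<^sup>2 * (f x)\<^sup>2)"
      using nn[of x] by (simp only: ennreal_mult[symmetric] exp_ge_zero ennreal_leI)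
  qed
  also have "\<dots> = ennreal (exp (- l * ?m - l\<^sup>2 * ?v)) * (\<integral>\<^sup>+x. ennreal (1 + l * f x + l\<^sup>2 * (f x)\<^sup>2) \<partial>K)"
    by (rule nn_integral_cmult) measurable
  also have "(\<integral>\<^sup>+x. ennreal (1 + l * f x + l\<^sup>2 * (f x)\<^sup>2) \<partial>K) = ennreal (\<integral>x. 1 + l * f x + l\<^sup>2 * (f x)\<^sup>2 \<partial>K)"
    by (rule nn_integral_eq_integral) (use i1 i2 nn in auto)
  also have "(\<integral>x. 1 + l * f x + l\<^sup>2 * (f x)\<^sup>2 \<partial>K) = 1 + l * ?m + l\<^sup>2 * ?v"
    using i1 i2 by (simp add: prob_space)
  also have "ennreal (exp (- l * ?m - l\<^sup>2 * ?v)) * ennreal (1 + l * ?m + l\<^sup>2 * ?v)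
      \<le> ennreal (exp (- l * ?m - l\<^sup>2 * ?v)) * ennreal (exp (l * ?m + l\<^sup>2 * ?v))"
  proof (intro mult_left_mono ennreal_leI)
    show "1 + l * ?m + l\<^sup>2 * ?v \<le> exp (l * ?m + l\<^sup>2 * ?v)"
      using exp_ge_add_one_self[of "l * ?m + l\<^sup>2 * ?v"] by (simp only: add.assoc)
  qed simp
  also have "\<dots> = 1"
  proof -
    have "- l * ?m - l\<^sup>2 * ?v + (l * ?m + l\<^sup>2 * ?v) = 0" by simp
    then show ?thesis by (simp only: ennreal_mult[symmetric] exp_ge_zero exp_add[symmetric] exp_zero ennreal_1)
  qed
  finally show ?thesis .
qed

context markov_process
begin

definition cond_mean :: "(nat \<Rightarrow> 'w \<Rightarrow> 'a \<Rightarrow> real) \<Rightarrow> nat \<Rightarrow> 'w \<Rightarrow> real" where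
  "cond_mean S j \<omega> = (\<integral>y. S j \<omega> y \<partial>P (X j \<omega>))"

definition cond_square :: "(nat \<Rightarrow> 'w \<Rightarrow> 'a \<Rightarrow> real) \<Rightarrow> nat \<Rightarrow> 'w \<Rightarrow> real" where
  "cond_square S j \<omega> = (\<integral>y. (S j \<omega> y)\<^sup>2 \<partial>P (X j \<omega>))"

definition log_term :: "(nat \<Rightarrow> 'w \<Rightarrow> 'a \<Rightarrow> real) \<Rightarrow> real \<Rightarrow> nat \<Rightarrow> 'w \<Rightarrow> 'a \<Rightarrow> real" where
  "log_term S l j \<omega> y = l * (if l * S j \<omega> y \<le> 1 then S j \<omega> y else 0) - l * cond_mean S j \<omega> - l\<^sup>2 * cond_square S j \<omega>"

text \<open>
  The logarithm of Freedman's exponential supermartingale for the truncated increments.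
\<close>

definition log_process :: "(nat \<Rightarrow> 'w \<Rightarrow> 'a \<Rightarrow> real) \<Rightarrow> real \<Rightarrow> nat \<Rightarrow> 'w \<Rightarrow> real" where
  "log_process S l k \<omega> = (\<Sum>j=1..<k. log_term S l j \<omega> (X (Suc j) \<omega>))"

context
  fixes S :: "nat \<Rightarrow> 'w \<Rightarrow> 'a \<Rightarrow> real" and c l :: real
  assumes S[measurable]: "\<And>j. 1 \<le> j \<Longrightarrow> case_prod (S j) \<in> borel_measurable (past j \<Otimes>\<^sub>M M)"
    and bS: "\<And>j \<omega> y. \<omega> \<in> space \<Omega> \<Longrightarrow> y \<in> space M \<Longrightarrow> \<bar>S j \<omega> y\<bar> \<le> c"
    and l: "0 < l"
begin

lemma S_past:
  assumes "1 \<le> j" "j \<le> k"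
  shows "case_prod (S j) \<in> borel_measurable (past k \<Otimes>\<^sub>M M)"
proof -
  have "sets (past j) \<subseteq> sets (past k)"
    unfolding sets_past using assms by (intro sigma_sets_mono sigma_sets.Basic subsetI) (auto, metis le_trans)
  then have "(\<lambda>\<omega>. \<omega>) \<in> past k \<rightarrow>\<^sub>M past j"
    by (auto simp: measurable_def)
  then have "(\<lambda>z. (fst z, snd z)) \<in> past k \<Otimes>\<^sub>M M \<rightarrow>\<^sub>M past j \<Otimes>\<^sub>M M"
    by (intro measurable_Pair measurable_compose[OF measurable_fst]) auto
  from measurable_compose[OF this S[OF assms(1)]] show ?thesis by simp
qed

lemma cond_measurable:
  assumes j: "1 \<le> j" "j \<le> k"
  shows "cond_mean S j \<in> borel_measurable (past k)" "cond_square S j \<in> borel_measurable (past k)"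
proof -
  have Xj[measurable]: "X j \<in> past k \<rightarrow>\<^sub>M M" using j by simp
  have s: "case_prod (S j) \<in> borel_measurable (past k \<Otimes>\<^sub>M M)" by (rule S_past[OF j])
  then have s2: "(\<lambda>(\<omega>, y). (S j \<omega> y)\<^sup>2) \<in> borel_measurable (past k \<Otimes>\<^sub>M M)"
    by (simp add: case_prod_beta)
  show "cond_mean S j \<in> borel_measurable (past k)"
    unfolding cond_mean_def[abs_def]
    by (rule borel_measurable_kernel_integral[OF s measurable_compose[OF Xj P_subkernel]])
  show "cond_square S j \<in> borel_measurable (past k)"
    unfolding cond_square_def[abs_def]
    by (rule borel_measurable_kernel_integral[OF s2 measurable_compose[OF Xj P_subkernel]])
qed

lemma log_term_measurable:
  assumes j: "1 \<le> j" "j \<le> k"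
  shows "case_prod (log_term S l j) \<in> borel_measurable (past k \<Otimes>\<^sub>M M)"
proof -
  note [measurable] = S_past[OF j] cond_measurable[OF j]
  show ?thesis unfolding log_term_def[abs_def] case_prod_beta by measurable
qed

lemma log_process_measurable: "log_process S l k \<in> borel_measurable (past k)"
  unfolding log_process_def[abs_def]
proof (rule borel_measurable_sum)
  fix j assume j: "j \<in> {1..<k}"
  have Xj: "X (Suc j) \<in> past k \<rightarrow>\<^sub>M M" using j by (intro X_past) auto
  have "(\<lambda>\<omega>. (\<omega>, X (Suc j) \<omega>)) \<in> past k \<rightarrow>\<^sub>M past k \<Otimes>\<^sub>M M" using Xj by measurable
  from measurable_compose[OF this log_term_measurable[of j k]] j
  show "(\<lambda>\<omega>. log_term S l j \<omega> (X (Suc j) \<omega>)) \<in> borel_measurable (past k)" by simp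
qed

lemma log_process_bound: "1 \<le> k \<Longrightarrow> (\<integral>\<^sup>+\<omega>. ennreal (exp (log_process S l k \<omega>)) \<partial>\<Omega>) \<le> 1"
proof (induction k rule: nat_induct_at_least)
  case base
  show ?case by (simp add: log_process_def emeasure_space_1)
next
  case (Suc k)
  define H where "H \<omega> y = ennreal (exp (log_process S l k \<omega>)) * ennreal (exp (log_term S l k \<omega> y))" for \<omega> y
  note [measurable] = log_process_measurable[of k] log_term_measurable[OF Suc(1) order_refl]
  have H: "case_prod H \<in> borel_measurable (past k \<Otimes>\<^sub>M M)"
    unfolding H_def[abs_def] case_prod_beta by measurable
  have "(\<integral>\<^sup>+\<omega>. ennreal (exp (log_process S l (Suc k) \<omega>)) \<partial>\<Omega>) = (\<integral>\<^sup>+\<omega>. H \<omega> (X (Suc k) \<omega>) \<partial>\<Omega>)"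
  proof (rule nn_integral_cong)
    fix \<omega>
    have "log_process S l (Suc k) \<omega> = log_process S l k \<omega> + log_term S l k \<omega> (X (Suc k) \<omega>)"
      using Suc(1) by (simp add: log_process_def)
    then show "ennreal (exp (log_process S l (Suc k) \<omega>)) = H \<omega> (X (Suc k) \<omega>)"
      by (simp only: H_def exp_add ennreal_mult exp_ge_zero)
  qed
  also have "\<dots> = (\<integral>\<^sup>+\<omega>. (\<integral>\<^sup>+y. H \<omega> y \<partial>P (X k \<omega>)) \<partial>\<Omega>)" by (rule nn_integral_step[OF Suc(1) H])
  also have "\<dots> \<le> (\<integral>\<^sup>+\<omega>. ennreal (exp (log_process S l k \<omega>)) \<partial>\<Omega>)"
  proof (rule nn_integral_mono)
    fix \<omega> assume w: "\<omega> \<in> space \<Omega>"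
    have x: "X k \<omega> \<in> space M" by (rule X_space[OF Suc(1) w])
    have w': "\<omega> \<in> space (past k)" using w by simp
    have Sm: "S k \<omega> \<in> borel_measurable (P (X k \<omega>))"
      using measurable_Pair2[OF S[OF Suc(1)] w'] by (simp add: borel_P[OF x])
    have lm: "log_term S l k \<omega> \<in> borel_measurable (P (X k \<omega>))"
      using measurable_Pair2[OF log_term_measurable[OF Suc(1) order_refl] w'] by (simp add: borel_P[OF x])
    have "(\<integral>\<^sup>+y. H \<omega> y \<partial>P (X k \<omega>)) = ennreal (exp (log_process S l k \<omega>)) * (\<integral>\<^sup>+y. ennreal (exp (log_term S l k \<omega> y)) \<partial>P (X k \<omega>))"
      unfolding H_def by (rule nn_integral_cmult) (use lm in measurable)
    also have "(\<integral>\<^sup>+y. ennreal (exp (log_term S l k \<omega> y)) \<partial>P (X k \<omega>)) \<le> 1"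
      unfolding log_term_def cond_mean_def cond_square_def
      by (rule truncated_exponential_le[OF P_prob[OF x] Sm _ l]) (use bS[OF w] x in simp)
    finally show "(\<integral>\<^sup>+y. H \<omega> y \<partial>P (X k \<omega>)) \<le> ennreal (exp (log_process S l k \<omega>))"
      by (simp add: mult_left_mono)
  qed
  also have "\<dots> \<le> 1" by (rule Suc)
  finally show ?case .
qed

end

text \<open>
  Freedman's inequality before optimisation in \<open>l\<close>, for increments that are bounded by \<open>1 / l\<close> only with high
  probability: on the paths where they are, the truncation in \<open>log_process\<close> is invisible. The crude bound
  \<open>c\<close> is there for integrability.
\<close>

theorem Freedman_tail:
  fixes S :: "nat \<Rightarrow> 'w \<Rightarrow> 'a \<Rightarrow> real"
  assumes S: "\<And>j. 1 \<le> j \<Longrightarrow> case_prod (S j) \<in> borel_measurable (past j \<Otimes>\<^sub>M M)"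
    and bS: "\<And>j \<omega> y. \<omega> \<in> space \<Omega> \<Longrightarrow> y \<in> space M \<Longrightarrow> \<bar>S j \<omega> y\<bar> \<le> c"
    and l: "0 < l" and k: "1 \<le> k"
  shows "\<exists>E\<in>sets \<Omega>. prob E \<le> exp (- u) \<and> (\<forall>\<omega>\<in>space \<Omega> - E.
     (\<forall>j\<in>{1..<k}. l * S j \<omega> (X (Suc j) \<omega>) \<le> 1) \<longrightarrow>
     (\<Sum>j=1..<k. \<integral>y. (S j \<omega> y)\<^sup>2 \<partial>P (X j \<omega>)) \<le> v \<longrightarrow>
     (\<Sum>j=1..<k. S j \<omega> (X (Suc j) \<omega>) - (\<integral>y. S j \<omega> y \<partial>P (X j \<omega>))) \<le> l * v + u / l)"
proof (intro bexI conjI ballI impI)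
  let ?f = "log_process S l k"
  let ?E = "{\<omega> \<in> space \<Omega>. u \<le> ?f \<omega>}"
  have fm[measurable]: "?f \<in> borel_measurable \<Omega>"
    by (rule past_measurable[OF log_process_measurable[OF S bS l]])
  show "?E \<in> sets \<Omega>" by measurable
  have "prob ?E \<le> exp (0 - u)"
    by (rule exponential_Markov[OF fm]) (use log_process_bound[OF S bS l k] in simp)
  then show "prob ?E \<le> exp (- u)" by simp
  fix \<omega> assume w: "\<omega> \<in> space \<Omega> - ?E"
    and tr: "\<forall>j\<in>{1..<k}. l * S j \<omega> (X (Suc j) \<omega>) \<le> 1"
    and v: "(\<Sum>j=1..<k. \<integral>y. (S j \<omega> y)\<^sup>2 \<partial>P (X j \<omega>)) \<le> v"
  let ?M = "\<Sum>j=1..<k. S j \<omega> (X (Suc j) \<omega>) - (\<integral>y. S j \<omega> y \<partial>P (X j \<omega>))"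
  let ?V = "\<Sum>j=1..<k. \<integral>y. (S j \<omega> y)\<^sup>2 \<partial>P (X j \<omega>)"
  have "?f \<omega> = (\<Sum>j=1..<k. l * (S j \<omega> (X (Suc j) \<omega>) - (\<integral>y. S j \<omega> y \<partial>P (X j \<omega>))) - l\<^sup>2 * (\<integral>y. (S j \<omega> y)\<^sup>2 \<partial>P (X j \<omega>)))"
    unfolding log_process_def log_term_def cond_mean_def cond_square_def
    using tr by (intro sum.cong) (auto simp: right_diff_distrib)
  also have "\<dots> = l * ?M - l\<^sup>2 * ?V" by (simp only: sum_subtractf sum_distrib_left right_diff_distrib)
  finally have "l * ?M - l\<^sup>2 * ?V < u" using w by auto
  moreover have "l\<^sup>2 * ?V \<le> l\<^sup>2 * v" using v by (intro mult_left_mono) auto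
  ultimately have "l * ?M \<le> l\<^sup>2 * v + u" by linarith
  also have "\<dots> = l * (l * v + u / l)" using l by (simp add: field_simps power2_eq_square)
  finally show "?M \<le> l * v + u / l" using l by simp
qed

end

section \<open>One martingale of the decomposition\<close>

locale dominated_chain = minorized_chain \<Omega> M P chi X \<mu> \<pi> m \<delta>
  for \<Omega> :: "'w measure" and M :: "'a measure" and P chi X \<mu> \<pi> m \<delta> +
  fixes \<nu> :: "'a measure" and \<delta>\<^sub>M :: real
  assumes \<delta>\<^sub>M: "\<delta>\<^sub>M > 0" and nu: "\<nu> \<in> space (prob_algebra M)"
    and dominated: "\<And>x D. x \<in> space M \<Longrightarrow> D \<in> sets M \<Longrightarrow> measure (P x) D \<le> \<delta>\<^sub>M * measure \<nu> D"
begin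

lemma nu_prob: "prob_space \<nu>" and nu_sets[simp, measurable_cong]: "sets \<nu> = sets M"
  using nu by (auto simp: space_prob_algebra)

lemma nu_space[simp]: "space \<nu> = space M"
  by (intro sets_eq_imp_space_eq) simp

lemma nu_finite: "finite_measure \<nu>"
  using nu_prob prob_space.finite_measure by blast

lemma nn_integral_dominated:
  assumes x: "x \<in> space M" and f: "f \<in> borel_measurable M"
  shows "(\<integral>\<^sup>+y. f y \<partial>P x) \<le> ennreal \<delta>\<^sub>M * (\<integral>\<^sup>+y. f y \<partial>\<nu>)"
proof (rule nn_integral_le_scaled)
  show "sets \<nu> = sets (P x)" using x by simp
  show "f \<in> borel_measurable (P x)" using x f by (simp add: borel_P)
  fix D assume "D \<in> sets (P x)"
  then have D: "D \<in> sets M" using x by simp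
  interpret P: prob_space "P x" by (rule P_prob[OF x])
  interpret nu: prob_space \<nu> by (rule nu_prob)
  show "emeasure (P x) D \<le> ennreal \<delta>\<^sub>M * emeasure \<nu> D"
    using dominated[OF x D] \<delta>\<^sub>M
    by (simp add: P.emeasure_eq_measure nu.emeasure_eq_measure ennreal_mult[symmetric] ennreal_leI)
qed

lemma integral_dominated:
  assumes x: "x \<in> space M" and f: "f \<in> borel_measurable M"
    and b: "\<And>y. y \<in> space M \<Longrightarrow> 0 \<le> f y" "\<And>y. y \<in> space M \<Longrightarrow> f y \<le> c"
  shows "(\<integral>y. f y \<partial>P x) \<le> \<delta>\<^sub>M * (\<integral>y. f y \<partial>\<nu>)"
proof -
  have b': "\<bar>f y\<bar> \<le> c" if "y \<in> space M" for y using b[OF that] by simp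
  have fP: "f \<in> borel_measurable (P x)" using x f by (simp add: borel_P)
  have i1: "integrable (P x) f" by (rule integrable_bounded[OF P_finite[OF x] fP]) (use b' x in auto)
  have i2: "integrable \<nu> f" by (rule integrable_bounded[OF nu_finite]) (use f b' in auto)
  have e1: "(\<integral>\<^sup>+y. ennreal (f y) \<partial>P x) = ennreal (\<integral>y. f y \<partial>P x)"
    by (rule nn_integral_eq_integral[OF i1]) (use b x in auto)
  have e2: "(\<integral>\<^sup>+y. ennreal (f y) \<partial>\<nu>) = ennreal (\<integral>y. f y \<partial>\<nu>)"
    by (rule nn_integral_eq_integral[OF i2]) (use b in auto)
  have n2: "0 \<le> (\<integral>y. f y \<partial>\<nu>)" by (rule integral_nonneg_AE) (use b in auto)
  have "ennreal (\<integral>y. f y \<partial>P x) \<le> ennreal \<delta>\<^sub>M * ennreal (\<integral>y. f y \<partial>\<nu>)"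
    unfolding e1[symmetric] e2[symmetric] by (rule nn_integral_dominated[OF x]) (use f in simp)
  then have "ennreal (\<integral>y. f y \<partial>P x) \<le> ennreal (\<delta>\<^sub>M * (\<integral>y. f y \<partial>\<nu>))"
    using \<delta>\<^sub>M n2 by (simp add: ennreal_mult)
  then show ?thesis using \<delta>\<^sub>M n2 by (subst (asm) ennreal_le_iff) auto
qed

text \<open>
  The first term comes from the largest increment of the martingale, the second from its variance.
\<close>

definition lag_bound :: "real \<Rightarrow> real \<Rightarrow> nat \<Rightarrow> real \<Rightarrow> real" where
  "lag_bound A \<beta> N u = 8 * K0 * A * sqrt (real N * (u + ln N)) * u + 16 * K0 * sqrt \<delta>\<^sub>M * \<beta> * sqrt N * u"

context
  fixes q :: "nat \<Rightarrow> nat \<Rightarrow> 'a \<Rightarrow> 'a \<Rightarrow> real" and A \<beta> u :: real and N :: nat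
  assumes qm: "\<And>i j. case_prod (q i j) \<in> borel_measurable (M \<Otimes>\<^sub>M M)"
    and qb: "\<And>i j x y. x \<in> space M \<Longrightarrow> y \<in> space M \<Longrightarrow> \<bar>q i j x y\<bar> \<le> A"
    and q0: "\<And>i j y. y \<in> space M \<Longrightarrow> (\<integral>x. q i j x y \<partial>\<pi>) = 0"
    and qn: "\<And>i x. x \<in> space M \<Longrightarrow> (\<Sum>j\<in>{i..<N}. \<integral>y. (q i (Suc j) x y)\<^sup>2 \<partial>\<nu>) \<le> \<beta>\<^sup>2"
    and A: "0 < A" and \<beta>: "0 < \<beta>" and u: "1 \<le> u" and N: "1 \<le> N"
begin

lemma q_measurable1: "y \<in> space M \<Longrightarrow> (\<lambda>x. q i j x y) \<in> borel_measurable M"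
  using measurable_Pair1[OF qm[of i j], of y] by simp

abbreviation S :: "nat \<Rightarrow> 'w \<Rightarrow> 'a \<Rightarrow> real" where
  "S j \<omega> y \<equiv> \<Sum>i=1..j. q i (Suc j) (X i \<omega>) y"

lemma q_measurable_past:
  assumes "1 \<le> i" "i \<le> k"
  shows "(\<lambda>(\<omega>, y). q i j (X i \<omega>) y) \<in> borel_measurable (past k \<Otimes>\<^sub>M M)"
proof -
  note [measurable] = X_past[OF assms] qm[of i j]
  show ?thesis unfolding case_prod_beta by measurable
qed

lemma S_measurable: "(\<lambda>(\<omega>, y). S j \<omega> y) \<in> borel_measurable (past j \<Otimes>\<^sub>M M)"
  unfolding case_prod_beta
  by (rule borel_measurable_sum) (use q_measurable_past[of _ j] in \<open>auto simp: case_prod_beta\<close>)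

lemma S_bounded:
  assumes "\<omega> \<in> space \<Omega>" "y \<in> space M"
  shows "\<bar>S j \<omega> y\<bar> \<le> real j * A"
proof -
  have "\<bar>S j \<omega> y\<bar> \<le> (\<Sum>i=1..j. A)"
    by (rule order_trans[OF sum_abs], rule sum_mono) (use assms in \<open>auto intro!: qb X_space\<close>)
  then show ?thesis by simp
qed

text \<open>
  A scalar functional is one with values in \<open>L\<^sup>2\<close> of a one-point space.
\<close>

lemma scalar_tail:
  assumes j: "1 \<le> j" "j \<le> N" and y: "y \<in> space M" and w: "1 \<le> w"
  shows "prob {\<omega> \<in> space \<Omega>. 8 * K0 * A * sqrt (real N * w) < S j \<omega> y} \<le> exp (- w)"
proof -
  let ?Q = "count_space {()}"
  let ?\<xi> = "\<lambda>i x (b::unit). q i (Suc j) x y"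
  let ?S = "\<lambda>\<omega>. S j \<omega> y"
  have Sm: "?S \<in> borel_measurable \<Omega>"
    by (intro borel_measurable_sum measurable_compose[OF X_measurable q_measurable1[OF y]]) auto
  have "prob {\<omega> \<in> space \<Omega>. 8 * K0 * A * sqrt (real N * w) < ?S \<omega>}
     \<le> prob {\<omega> \<in> space \<Omega>. (8 * K0 * A)\<^sup>2 * (real j * w) < (\<integral>b. (\<Sum>i=1..j. ?\<xi> i (X i \<omega>) b)\<^sup>2 \<partial>?Q)}"
  proof (rule finite_measure_mono)
    show "{\<omega> \<in> space \<Omega>. (8 * K0 * A)\<^sup>2 * (real j * w) < (\<integral>b. (\<Sum>i=1..j. ?\<xi> i (X i \<omega>) b)\<^sup>2 \<partial>?Q)} \<in> sets \<Omega>"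
      using Sm by (simp add: lebesgue_integral_count_space_finite)
    show "{\<omega> \<in> space \<Omega>. 8 * K0 * A * sqrt (real N * w) < ?S \<omega>} \<subseteq>
      {\<omega> \<in> space \<Omega>. (8 * K0 * A)\<^sup>2 * (real j * w) < (\<integral>b. (\<Sum>i=1..j. ?\<xi> i (X i \<omega>) b)\<^sup>2 \<partial>?Q)}"
    proof safe
      fix \<omega> assume lt: "8 * K0 * A * sqrt (real N * w) < ?S \<omega>"
      have nn: "0 \<le> 8 * K0 * A * sqrt (real N * w)" using K0_pos A w by simp
      have "(8 * K0 * A)\<^sup>2 * (real j * w) \<le> (8 * K0 * A)\<^sup>2 * (real N * w)"
        using j w by (intro mult_left_mono mult_right_mono) auto
      also have "\<dots> = (8 * K0 * A * sqrt (real N * w))\<^sup>2" using w by (simp add: power_mult_distrib)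
      also have "\<dots> < (?S \<omega>)\<^sup>2" using lt nn by (intro power_strict_mono) auto
      finally show "(8 * K0 * A)\<^sup>2 * (real j * w) < (\<integral>b. (\<Sum>i=1..j. ?\<xi> i (X i \<omega>) b)\<^sup>2 \<partial>?Q)"
        by (simp add: lebesgue_integral_count_space_finite)
    qed
  qed
  also have "\<dots> \<le> exp (- w)"
  proof (rule Hilbert_tail)
    show "\<bar>?\<xi> i x b\<bar> \<le> A" if "x \<in> space M" for i x and b :: unit using qb[OF that y] .
    show "finite_measure ?Q" by (rule finite_measure_count_space) simp
    show "case_prod (?\<xi> i) \<in> borel_measurable (M \<Otimes>\<^sub>M ?Q)" for i
      unfolding case_prod_beta by (rule measurable_compose[OF measurable_fst q_measurable1[OF y]])
    show "(\<integral>b. (?\<xi> i x b)\<^sup>2 \<partial>?Q) \<le> A\<^sup>2" if "x \<in> space M" for i x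
    proof -
      have "\<bar>q i (Suc j) x y\<bar>\<^sup>2 \<le> A\<^sup>2" using qb[OF that y] by (intro power_mono) auto
      then show ?thesis by (simp add: lebesgue_integral_count_space_finite)
    qed
  qed (use A j w y q0 qb in auto)
  finally show ?thesis .
qed

text \<open>
  Given the past, the law of the next state is at most \<open>\<delta>\<^sub>M \<nu>\<close>. The next state may therefore be replaced by a point
  independent of the past, and for a fixed point \<open>scalar_tail\<close> applies. The level \<open>u + ln N\<close> leaves
  the factor \<open>1 / N\<close> for a union bound over \<open>j\<close>.
\<close>

lemma max_tail_one:
  assumes j: "1 \<le> j" "j < N"
  shows "prob {\<omega> \<in> space \<Omega>. 8 * K0 * A * sqrt (real N * (u + ln N)) < S j \<omega> (X (Suc j) \<omega>)}
    \<le> \<delta>\<^sub>M * (exp (- u) / N)"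
proof -
  let ?b = "8 * K0 * A * sqrt (real N * (u + ln N))"
  let ?S = "S j"
  define I where "I \<omega> y = (indicator {r. ?b < r} (?S \<omega> y) :: ennreal)" for \<omega> y
  interpret nu: prob_space \<nu> by (rule nu_prob)
  interpret pair_sigma_finite \<Omega> \<nu> ..
  have Im: "case_prod I \<in> borel_measurable (past j \<Otimes>\<^sub>M M)"
  proof -
    have "(\<lambda>z. indicator {r. ?b < r} (case z of (\<omega>, y) \<Rightarrow> ?S \<omega> y) :: ennreal) \<in> borel_measurable (past j \<Otimes>\<^sub>M M)"
      by (rule measurable_compose[OF S_measurable]) simp
    then show ?thesis unfolding I_def[abs_def] case_prod_beta .
  qed
  have Im2: "case_prod I \<in> borel_measurable (\<Omega> \<Otimes>\<^sub>M \<nu>)"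
  proof -
    have "(\<lambda>z. (fst z, snd z)) \<in> \<Omega> \<Otimes>\<^sub>M M \<rightarrow>\<^sub>M past j \<Otimes>\<^sub>M M"
      using past_measurable[OF measurable_ident_sets[OF refl], of j]
      by (intro measurable_Pair measurable_compose[OF measurable_fst]) auto
    from measurable_compose[OF this Im] have "case_prod I \<in> borel_measurable (\<Omega> \<Otimes>\<^sub>M M)" by simp
    then show ?thesis by (simp cong: measurable_cong_sets)
  qed
  have SX: "(\<lambda>\<omega>. ?S \<omega> (X (Suc j) \<omega>)) \<in> borel_measurable \<Omega>"
    using measurable_compose[OF joint_measurable[OF j(1)] S_measurable] by simp
  have I1: "I \<omega> \<in> borel_measurable M" if "\<omega> \<in> space \<Omega>" for \<omega>
    using measurable_Pair2[OF Im, of \<omega>] that by simp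
  have u1: "1 \<le> u + ln (real N)"
    using u ln_ge_zero[of "real N"] N by linarith
  let ?A = "{\<omega> \<in> space \<Omega>. ?b < ?S \<omega> (X (Suc j) \<omega>)}"
  have "(\<integral>\<^sup>+y. (\<integral>\<^sup>+\<omega>. I \<omega> y \<partial>\<Omega>) \<partial>\<nu>) \<le> (\<integral>\<^sup>+y. ennreal (exp (- u) / N) \<partial>\<nu>)"
  proof (rule nn_integral_mono)
    fix y assume "y \<in> space \<nu>"
    then have y: "y \<in> space M" by simp
    have Sm: "(\<lambda>\<omega>. ?S \<omega> y) \<in> borel_measurable \<Omega>"
      by (intro borel_measurable_sum measurable_compose[OF X_measurable q_measurable1[OF y]]) auto
    have "(\<integral>\<^sup>+\<omega>. I \<omega> y \<partial>\<Omega>) = (\<integral>\<^sup>+\<omega>. indicator {\<omega> \<in> space \<Omega>. ?b < ?S \<omega> y} \<omega> \<partial>\<Omega>)"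
      by (intro nn_integral_cong) (auto simp: I_def split: split_indicator)
    also have "\<dots> = ennreal (prob {\<omega> \<in> space \<Omega>. ?b < ?S \<omega> y})"
      using Sm by (subst nn_integral_indicator) (auto simp: emeasure_eq_measure)
    also have "\<dots> \<le> ennreal (exp (- (u + ln N)))"
      by (rule ennreal_leI[OF scalar_tail[OF j(1) less_imp_le[OF j(2)] y u1]])
    also have "exp (- (u + ln N)) = exp (- u) / N"
    proof -
      have "exp (- (u + ln N)) = exp (- u - ln N)" by (rule arg_cong[where f = exp]) simp
      also have "\<dots> = exp (- u) / exp (ln N)" by (rule exp_diff)
      finally show ?thesis using N by simp
    qed
    finally show "(\<integral>\<^sup>+\<omega>. I \<omega> y \<partial>\<Omega>) \<le> ennreal (exp (- u) / N)" .
  qed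
  also have "\<dots> = ennreal (exp (- u) / N)" by (simp only: nn_integral_const nu.emeasure_space_1 mult_1_right)
  finally have Y: "(\<integral>\<^sup>+y. (\<integral>\<^sup>+\<omega>. I \<omega> y \<partial>\<Omega>) \<partial>\<nu>) \<le> ennreal (exp (- u) / N)" .
  have "emeasure \<Omega> ?A = (\<integral>\<^sup>+\<omega>. indicator ?A \<omega> \<partial>\<Omega>)"
    using SX by (intro nn_integral_indicator[symmetric]) simp
  also have "\<dots> = (\<integral>\<^sup>+\<omega>. I \<omega> (X (Suc j) \<omega>) \<partial>\<Omega>)"
    by (intro nn_integral_cong) (auto simp: I_def split: split_indicator)
  also have "\<dots> = (\<integral>\<^sup>+\<omega>. (\<integral>\<^sup>+y. I \<omega> y \<partial>P (X j \<omega>)) \<partial>\<Omega>)" by (rule nn_integral_step[OF j(1) Im])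
  also have "\<dots> \<le> (\<integral>\<^sup>+\<omega>. ennreal \<delta>\<^sub>M * (\<integral>\<^sup>+y. I \<omega> y \<partial>\<nu>) \<partial>\<Omega>)"
    by (intro nn_integral_mono nn_integral_dominated X_space[OF j(1)] I1)
  also have "\<dots> = ennreal \<delta>\<^sub>M * (\<integral>\<^sup>+\<omega>. (\<integral>\<^sup>+y. I \<omega> y \<partial>\<nu>) \<partial>\<Omega>)"
    using Im2 by (intro nn_integral_cmult nu.borel_measurable_nn_integral)
  also have "(\<integral>\<^sup>+\<omega>. (\<integral>\<^sup>+y. I \<omega> y \<partial>\<nu>) \<partial>\<Omega>) = (\<integral>\<^sup>+y. (\<integral>\<^sup>+\<omega>. I \<omega> y \<partial>\<Omega>) \<partial>\<nu>)"
    by (rule Fubini'[OF Im2, symmetric])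
  also have "ennreal \<delta>\<^sub>M * \<dots> \<le> ennreal \<delta>\<^sub>M * ennreal (exp (- u) / N)"
    by (rule mult_left_mono[OF Y]) simp
  finally have "emeasure \<Omega> ?A \<le> ennreal (\<delta>\<^sub>M * (exp (- u) / N))"
    using ennreal_mult[of \<delta>\<^sub>M "exp (- u) / N"] \<delta>\<^sub>M by simp
  then show ?thesis
    unfolding emeasure_eq_measure using \<delta>\<^sub>M by (subst (asm) ennreal_le_iff) auto
qed

lemma max_tail:
  "\<exists>E\<in>sets \<Omega>. prob E \<le> \<delta>\<^sub>M * exp (- u) \<and> (\<forall>\<omega>\<in>space \<Omega> - E. \<forall>j\<in>{1..<N}.
     S j \<omega> (X (Suc j) \<omega>) \<le> 8 * K0 * A * sqrt (real N * (u + ln N)))"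
proof (intro bexI conjI ballI)
  let ?b = "8 * K0 * A * sqrt (real N * (u + ln N))"
  let ?F = "\<lambda>j. {\<omega> \<in> space \<Omega>. ?b < S j \<omega> (X (Suc j) \<omega>)}"
  have F: "?F j \<in> sets \<Omega>" if "j \<in> {1..<N}" for j
  proof -
    have j: "1 \<le> j" using that by simp
    have "(\<lambda>\<omega>. S j \<omega> (X (Suc j) \<omega>)) \<in> borel_measurable \<Omega>"
      using measurable_compose[OF joint_measurable[OF j] S_measurable] by simp
    then show ?thesis by simp
  qed
  show E: "(\<Union>j\<in>{1..<N}. ?F j) \<in> sets \<Omega>" by (rule sets.finite_UN[OF finite_atLeastLessThan F])
  have "prob (\<Union>j\<in>{1..<N}. ?F j) \<le> (\<Sum>j\<in>{1..<N}. prob (?F j))"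
    by (rule finite_measure_subadditive_finite[OF finite_atLeastLessThan]) (use F in blast)
  also have "\<dots> \<le> (\<Sum>j\<in>{1..<N}. \<delta>\<^sub>M * (exp (- u) / N))"
    by (intro sum_mono max_tail_one) auto
  also have "\<dots> = real (N - 1) * (\<delta>\<^sub>M * (exp (- u) / N))" by simp
  also have "\<dots> \<le> real N * (\<delta>\<^sub>M * (exp (- u) / N))" using \<delta>\<^sub>M by (intro mult_right_mono) auto
  also have "\<dots> = \<delta>\<^sub>M * exp (- u)" using N by simp
  finally show "prob (\<Union>j\<in>{1..<N}. ?F j) \<le> \<delta>\<^sub>M * exp (- u)" .
  fix \<omega> j assume "\<omega> \<in> space \<Omega> - (\<Union>j\<in>{1..<N}. ?F j)" "j \<in> {1..<N}"
  then show "S j \<omega> (X (Suc j) \<omega>) \<le> ?b" by (auto simp: not_less)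
qed

text \<open>
  The functions \<open>S j\<close> for all \<open>j < N\<close> together are one sum over \<open>i\<close> of functions of \<open>X i\<close> with values in \<open>L\<^sup>2\<close> of the
  finite measure \<open>count_space {1..<N} \<Otimes>\<^sub>M \<nu>\<close>; the squared norm of that sum is \<open>\<Sum>j. \<integral>(S j)\<^sup>2 d\<nu>\<close>.
\<close>

lemma variance_tail:
  "\<exists>E\<in>sets \<Omega>. prob E \<le> exp (- u) \<and> (\<forall>\<omega>\<in>space \<Omega> - E.
     (\<Sum>j=1..<N. \<integral>y. (S j \<omega> y)\<^sup>2 \<partial>P (X j \<omega>)) \<le> \<delta>\<^sub>M * ((8 * K0 * \<beta>)\<^sup>2 * (real N * u)))"
proof -
  let ?J = "{1..<N}"
  let ?Q = "count_space ?J \<Otimes>\<^sub>M \<nu>"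
  \<comment> \<open>The coordinate \<open>(j, y)\<close> of the \<open>i\<close>-th summand, zero if \<open>i > j\<close>, since \<open>S j\<close> only involves \<open>i \<le> j\<close>.
    The sum over \<open>j\<close> has one nonzero term and makes measurability in \<open>(j, y)\<close> immediate.\<close>
  define \<xi> where "\<xi> i x b = (\<Sum>j\<in>?J. if fst b = j \<and> i \<le> j then q i (Suc j) x (snd b) else 0)" for i x and b :: "nat \<times> 'a"
  have xi: "\<xi> i x (j, y) = (if i \<le> j then q i (Suc j) x y else 0)" if "j \<in> ?J" for i x j y
  proof -
    have "\<xi> i x (j, y) = (\<Sum>j'\<in>?J. if j' = j then (if i \<le> j' then q i (Suc j') x y else 0) else 0)"
      unfolding \<xi>_def by (rule sum.cong) auto
    then show ?thesis using that by (simp add: sum.delta)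
  qed
  interpret nu: prob_space \<nu> by (rule nu_prob)
  interpret J: finite_measure "count_space ?J" by (rule finite_measure_count_space) simp
  interpret pair_sigma_finite "count_space ?J" \<nu> ..
  have Q: "finite_measure ?Q" by (intro finite_measure_pair_measure nu_finite J.finite_measure_axioms)
  have spQ: "space ?Q = ?J \<times> space M" by (simp add: space_pair_measure)
  have Qint: "(\<integral>b. g b \<partial>?Q) = (\<Sum>j\<in>?J. \<integral>y. g (j, y) \<partial>\<nu>)"
    if g: "g \<in> borel_measurable ?Q" and gb: "\<And>b. b \<in> space ?Q \<Longrightarrow> \<bar>g b\<bar> \<le> C" for g :: "_ \<Rightarrow> real" and C
  proof -
    have "integrable ?Q g" by (rule integrable_bounded[OF Q g gb])
    then have "(\<integral>b. g b \<partial>?Q) = (\<integral>j. (\<integral>y. g (j, y) \<partial>\<nu>) \<partial>count_space ?J)"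
      using integral_fst[of "\<lambda>j y. g (j, y)"] by simp
    also have "\<dots> = (\<Sum>j\<in>?J. \<integral>y. g (j, y) \<partial>\<nu>)" by (rule lebesgue_integral_count_space_finite) simp
    finally show ?thesis .
  qed
  have xim: "case_prod (\<xi> i) \<in> borel_measurable (M \<Otimes>\<^sub>M ?Q)" for i
    unfolding \<xi>_def case_prod_beta
  proof (rule borel_measurable_sum)
    fix j assume j: "j \<in> ?J"
    note [measurable] = qm[of i "Suc j"]
    have p: "Measurable.pred (M \<Otimes>\<^sub>M ?Q) (\<lambda>z. fst (snd z) = j \<and> i \<le> j)"
    proof -
      have "(\<lambda>z. fst (snd z)) \<in> M \<Otimes>\<^sub>M ?Q \<rightarrow>\<^sub>M count_space ?J" by measurable
      from measurable_compose[OF this, of "\<lambda>k. k = j \<and> i \<le> j" "count_space UNIV"] show ?thesis by simp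
    qed
    have "(\<lambda>z. (fst z, snd (snd z))) \<in> M \<Otimes>\<^sub>M ?Q \<rightarrow>\<^sub>M M \<Otimes>\<^sub>M M" by measurable
    from measurable_compose[OF this qm[of i "Suc j"]]
    have "(\<lambda>z. q i (Suc j) (fst z) (snd (snd z))) \<in> borel_measurable (M \<Otimes>\<^sub>M ?Q)" by simp
    then show "(\<lambda>z. if fst (snd z) = j \<and> i \<le> j then q i (Suc j) (fst z) (snd (snd z)) else 0) \<in> borel_measurable (M \<Otimes>\<^sub>M ?Q)"
      by (rule measurable_If[OF _ borel_measurable_const predE[OF p]])
  qed
  have xib: "\<bar>\<xi> i x b\<bar> \<le> A" if "x \<in> space M" "b \<in> space ?Q" for i x b
  proof (cases b)
    case (Pair j y)
    then have j: "j \<in> ?J" and y: "y \<in> space M" using that(2) unfolding spQ by auto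
    show ?thesis unfolding Pair xi[OF j] using qb[OF that(1) y, of i "Suc j"] A by simp
  qed
  have xi2: "\<xi> i x \<in> borel_measurable ?Q" if "x \<in> space M" for i x
    using measurable_Pair2[OF xim that] by simp
  define T where "T \<omega> = (\<integral>b. (\<Sum>i=1..N. \<xi> i (X i \<omega>) b)\<^sup>2 \<partial>?Q)" for \<omega>
  let ?E = "{\<omega> \<in> space \<Omega>. (8 * K0 * \<beta>)\<^sup>2 * (real N * u) < T \<omega>}"
  have Tm: "T \<in> borel_measurable \<Omega>"
  proof -
    have "(\<lambda>z. \<xi> i (X i (fst z)) (snd z)) \<in> borel_measurable (\<Omega> \<Otimes>\<^sub>M ?Q)" if "i \<in> {1..N}" for i
    proof -
      have "(\<lambda>z. (X i (fst z), snd z)) \<in> \<Omega> \<Otimes>\<^sub>M ?Q \<rightarrow>\<^sub>M M \<Otimes>\<^sub>M ?Q"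
        using that by (intro measurable_Pair measurable_compose[OF measurable_fst X_measurable]) auto
      from measurable_compose[OF this xim[of i]] show ?thesis by simp
    qed
    then have "(\<lambda>z. \<Sum>i=1..N. \<xi> i (X i (fst z)) (snd z)) \<in> borel_measurable (\<Omega> \<Otimes>\<^sub>M ?Q)"
      by (rule borel_measurable_sum)
    then have "(\<lambda>(\<omega>, b). (\<Sum>i=1..N. \<xi> i (X i \<omega>) b)\<^sup>2) \<in> borel_measurable (\<Omega> \<Otimes>\<^sub>M ?Q)"
      by (simp add: case_prod_beta)
    then show ?thesis unfolding T_def[abs_def]
      by (rule sigma_finite_measure.borel_measurable_lebesgue_integral[OF finite_measure.sigma_finite_measure[OF Q]])
  qed
  have "prob ?E \<le> exp (- u)"
    unfolding T_def
  proof (rule Hilbert_tail[OF Q xim xib])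
    show "(\<integral>x. \<xi> i x b \<partial>\<pi>) = 0" if "b \<in> space ?Q" for i b
    proof (cases b)
      case (Pair j y)
      then have j: "j \<in> ?J" and y: "y \<in> space M" using that unfolding spQ by auto
      show ?thesis unfolding Pair xi[OF j] by (cases "i \<le> j") (simp_all add: q0[OF y])
    qed
    show "(\<integral>b. (\<xi> i x b)\<^sup>2 \<partial>?Q) \<le> \<beta>\<^sup>2" if x: "x \<in> space M" for i x
    proof -
      have "(\<integral>b. (\<xi> i x b)\<^sup>2 \<partial>?Q) = (\<Sum>j\<in>?J. \<integral>y. (\<xi> i x (j, y))\<^sup>2 \<partial>\<nu>)"
      proof (rule Qint)
        show "\<bar>(\<xi> i x b)\<^sup>2\<bar> \<le> A\<^sup>2" if "b \<in> space ?Q" for b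
        proof -
          have "\<bar>\<xi> i x b\<bar>\<^sup>2 \<le> A\<^sup>2" using xib[OF x that] by (intro power_mono) auto
          then show ?thesis by simp
        qed
      qed (use xi2[OF x] in simp)
      also have "\<dots> = (\<Sum>j\<in>?J. if i \<le> j then \<integral>y. (q i (Suc j) x y)\<^sup>2 \<partial>\<nu> else 0)"
      proof (rule sum.cong[OF refl])
        fix j assume "j \<in> ?J"
        then show "(\<integral>y. (\<xi> i x (j, y))\<^sup>2 \<partial>\<nu>) = (if i \<le> j then \<integral>y. (q i (Suc j) x y)\<^sup>2 \<partial>\<nu> else 0)"
          by (cases "i \<le> j") (simp_all only: xi if_True if_False power_zero_numeral Bochner_Integration.integral_zero)
      qed
      also have "\<dots> = (\<Sum>j\<in>?J \<inter> {j. i \<le> j}. \<integral>y. (q i (Suc j) x y)\<^sup>2 \<partial>\<nu>)"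
        by (simp only: sum.inter_restrict[OF finite_atLeastLessThan] mem_Collect_eq)
      also have "\<dots> \<le> (\<Sum>j\<in>{i..<N}. \<integral>y. (q i (Suc j) x y)\<^sup>2 \<partial>\<nu>)"
        by (rule sum_mono2) auto
      also have "\<dots> \<le> \<beta>\<^sup>2" by (rule qn[OF x])
      finally show ?thesis .
    qed
  qed (use \<beta> N u in auto)
  moreover have "?E \<in> sets \<Omega>" using Tm by simp
  moreover have "(\<Sum>j=1..<N. \<integral>y. (S j \<omega> y)\<^sup>2 \<partial>P (X j \<omega>)) \<le> \<delta>\<^sub>M * ((8 * K0 * \<beta>)\<^sup>2 * (real N * u))"
    if w: "\<omega> \<in> space \<Omega> - ?E" for \<omega>
  proof -
    have w': "\<omega> \<in> space \<Omega>" using w by simp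
    have Sj: "S j \<omega> \<in> borel_measurable M" for j
      using measurable_Pair2[OF S_measurable[of j], of \<omega>] w' by simp
    have "(\<Sum>j=1..<N. \<integral>y. (S j \<omega> y)\<^sup>2 \<partial>P (X j \<omega>))
       \<le> (\<Sum>j=1..<N. \<delta>\<^sub>M * (\<integral>y. (S j \<omega> y)\<^sup>2 \<partial>\<nu>))"
    proof (rule sum_mono)
      fix j assume j: "j \<in> ?J"
      show "(\<integral>y. (S j \<omega> y)\<^sup>2 \<partial>P (X j \<omega>)) \<le> \<delta>\<^sub>M * (\<integral>y. (S j \<omega> y)\<^sup>2 \<partial>\<nu>)"
      proof (rule integral_dominated)
        show "X j \<omega> \<in> space M" using j w' by (intro X_space) auto
        show "(S j \<omega> y)\<^sup>2 \<le> (real j * A)\<^sup>2" if "y \<in> space M" for y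
        proof -
          have "\<bar>S j \<omega> y\<bar>\<^sup>2 \<le> (real j * A)\<^sup>2"
            by (intro power_mono S_bounded[OF w' that]) simp
          then show ?thesis by simp
        qed
      qed (use Sj in auto)
    qed
    also have "\<dots> = \<delta>\<^sub>M * (\<Sum>j=1..<N. (\<integral>y. (S j \<omega> y)\<^sup>2 \<partial>\<nu>))"
      by (rule sum_distrib_left[symmetric])
    also have "(\<Sum>j=1..<N. (\<integral>y. (S j \<omega> y)\<^sup>2 \<partial>\<nu>)) = T \<omega>"
    proof -
      have e: "(\<Sum>i=1..N. \<xi> i (X i \<omega>) (j, y)) = S j \<omega> y" if j: "j \<in> ?J" for j y
      proof -
        have "(\<Sum>i=1..N. \<xi> i (X i \<omega>) (j, y)) = (\<Sum>i\<in>{1..N}. if i \<in> {..j} then q i (Suc j) (X i \<omega>) y else 0)"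
          using xi[OF j] by (intro sum.cong) auto
        also have "\<dots> = (\<Sum>i\<in>{1..N} \<inter> {..j}. q i (Suc j) (X i \<omega>) y)"
          by (rule sum.inter_restrict[symmetric]) simp
        also have "{1..N} \<inter> {..j} = {1..j}" using j by auto
        finally show ?thesis .
      qed
      have "T \<omega> = (\<Sum>j\<in>?J. \<integral>y. (\<Sum>i=1..N. \<xi> i (X i \<omega>) (j, y))\<^sup>2 \<partial>\<nu>)"
        unfolding T_def
      proof (rule Qint)
        show "(\<lambda>b. (\<Sum>i=1..N. \<xi> i (X i \<omega>) b)\<^sup>2) \<in> borel_measurable ?Q"
          using w' by (intro borel_measurable_power borel_measurable_sum xi2 X_space) auto
        show "\<bar>(\<Sum>i=1..N. \<xi> i (X i \<omega>) b)\<^sup>2\<bar> \<le> (real N * A)\<^sup>2" if b: "b \<in> space ?Q" for b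
        proof -
          have "\<bar>\<Sum>i=1..N. \<xi> i (X i \<omega>) b\<bar> \<le> (\<Sum>i=1..N. A)"
            by (rule order_trans[OF sum_abs], rule sum_mono) (auto intro!: xib X_space w' b)
          then have "\<bar>\<Sum>i=1..N. \<xi> i (X i \<omega>) b\<bar>\<^sup>2 \<le> (real N * A)\<^sup>2" by (intro power_mono) auto
          then show ?thesis by simp
        qed
      qed
      also have "\<dots> = (\<Sum>j=1..<N. (\<integral>y. (S j \<omega> y)\<^sup>2 \<partial>\<nu>))"
        by (rule sum.cong[OF refl]) (simp only: e)
      finally show ?thesis by (rule sym)
    qed
    also have "\<delta>\<^sub>M * T \<omega> \<le> \<delta>\<^sub>M * ((8 * K0 * \<beta>)\<^sup>2 * (real N * u))"
      using w \<delta>\<^sub>M by (intro mult_left_mono) (auto simp: not_less)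
    finally show ?thesis .
  qed
  ultimately show ?thesis by blast
qed

text \<open>
  On the events of \<open>max_tail\<close> and \<open>variance_tail\<close> the increments are at most \<open>b\<close> and the variance is at most
  \<open>w\<^sup>2 u\<close>, and \<open>Freedman_tail\<close> gives a bound of the form \<open>l w\<^sup>2 u + u / l\<close>.
\<close>

theorem degenerate_martingale_tail:
  "\<exists>E\<in>sets \<Omega>. prob E \<le> (2 + \<delta>\<^sub>M) * exp (- u) \<and> (\<forall>\<omega>\<in>space \<Omega> - E.
     (\<Sum>j=1..<N. S j \<omega> (X (Suc j) \<omega>) - (\<integral>y. S j \<omega> y \<partial>P (X j \<omega>)))
       \<le> lag_bound A \<beta> N u)"
proof -
  define b where "b = 8 * K0 * A * sqrt (real N * (u + ln N))"
  define w where "w = sqrt \<delta>\<^sub>M * (8 * K0 * \<beta>) * sqrt N"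
  \<comment> \<open>This choice satisfies \<open>l b \<le> 1\<close>, as the truncation requires, and \<open>l w\<^sup>2 u + u / l \<le> b u + 2 w u\<close>.\<close>
  define l where "l = 1 / (b + w)"
  \<comment> \<open>Cutting the sum at \<open>N\<close> gives a bound that is uniform in \<open>j\<close> and changes nothing for \<open>j < N\<close>.\<close>
  let ?S = "\<lambda>j \<omega> y. \<Sum>i=1..min j N. q i (Suc j) (X i \<omega>) y"
  have lnN: "0 \<le> ln (real N)" using N by simp
  have b: "0 \<le> b" using K0_pos A u lnN by (simp add: b_def)
  have w: "0 < w" using K0_pos \<delta>\<^sub>M \<beta> N by (simp add: w_def)
  have l: "0 < l" using b w by (simp add: l_def)
  have w2: "\<delta>\<^sub>M * ((8 * K0 * \<beta>)\<^sup>2 * (real N * u)) = w\<^sup>2 * u"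
    using \<delta>\<^sub>M by (simp add: w_def power_mult_distrib)
  obtain E1 where E1: "E1 \<in> sets \<Omega>" "prob E1 \<le> \<delta>\<^sub>M * exp (- u)"
    "\<And>\<omega> j. \<omega> \<in> space \<Omega> - E1 \<Longrightarrow> j \<in> {1..<N} \<Longrightarrow> S j \<omega> (X (Suc j) \<omega>) \<le> b"
    using max_tail unfolding b_def by blast
  obtain E2 where E2: "E2 \<in> sets \<Omega>" "prob E2 \<le> exp (- u)"
    "\<And>\<omega>. \<omega> \<in> space \<Omega> - E2 \<Longrightarrow> (\<Sum>j=1..<N. \<integral>y. (S j \<omega> y)\<^sup>2 \<partial>P (X j \<omega>)) \<le> w\<^sup>2 * u"
    using variance_tail unfolding w2 by blast
  have Sm: "case_prod (?S j) \<in> borel_measurable (past j \<Otimes>\<^sub>M M)" if "1 \<le> j" for j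
    unfolding case_prod_beta
    by (rule borel_measurable_sum) (use q_measurable_past[of _ j] in \<open>auto simp: case_prod_beta\<close>)
  have Sb: "\<bar>?S j \<omega> y\<bar> \<le> real N * A" if "\<omega> \<in> space \<Omega>" "y \<in> space M" for j \<omega> y
  proof -
    have "\<bar>?S j \<omega> y\<bar> \<le> (\<Sum>i=1..min j N. A)"
      by (rule order_trans[OF sum_abs], rule sum_mono) (use that in \<open>auto intro!: qb X_space\<close>)
    also have "\<dots> = real (min j N) * A" by simp
    also have "\<dots> \<le> real N * A" using A by (intro mult_right_mono) auto
    finally show ?thesis .
  qed
  obtain E3 where E3: "E3 \<in> sets \<Omega>" "prob E3 \<le> exp (- u)"
    "\<And>\<omega>. \<omega> \<in> space \<Omega> - E3 \<Longrightarrow> (\<forall>j\<in>{1..<N}. l * ?S j \<omega> (X (Suc j) \<omega>) \<le> 1) \<Longrightarrow>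
     (\<Sum>j=1..<N. \<integral>y. (?S j \<omega> y)\<^sup>2 \<partial>P (X j \<omega>)) \<le> w\<^sup>2 * u \<Longrightarrow>
     (\<Sum>j=1..<N. ?S j \<omega> (X (Suc j) \<omega>) - (\<integral>y. ?S j \<omega> y \<partial>P (X j \<omega>))) \<le> l * (w\<^sup>2 * u) + u / l"
    using Freedman_tail[OF Sm Sb l N, of u "w\<^sup>2 * u"] by blast
  have m: "(\<Sum>j=1..<N. f j (min j N)) = (\<Sum>j=1..<N. f j j)" for f :: "nat \<Rightarrow> nat \<Rightarrow> real"
    by (rule sum.cong) auto
  show ?thesis
  proof (intro bexI conjI ballI)
    let ?E = "E1 \<union> (E2 \<union> E3)"
    show "?E \<in> sets \<Omega>" using E1 E2 E3 by auto
    have "prob ?E \<le> prob E1 + prob (E2 \<union> E3)" using E1 E2 E3 by (intro measure_Un_le) auto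
    also have "prob (E2 \<union> E3) \<le> prob E2 + prob E3" using E2 E3 by (intro measure_Un_le) auto
    finally show "prob ?E \<le> (2 + \<delta>\<^sub>M) * exp (- u)" using E1(2) E2(2) E3(2) by (simp add: distrib_right)
    fix \<omega> assume om: "\<omega> \<in> space \<Omega> - ?E"
    have tr: "l * ?S j \<omega> (X (Suc j) \<omega>) \<le> 1" if j: "j \<in> {1..<N}" for j
    proof -
      have "?S j \<omega> (X (Suc j) \<omega>) \<le> b" using E1(3)[of \<omega> j] om j by (simp add: min_absorb1)
      also have "\<dots> \<le> b + w" using w by simp
      finally show ?thesis using b w by (simp add: l_def field_simps)
    qed
    have v: "(\<Sum>j=1..<N. \<integral>y. (?S j \<omega> y)\<^sup>2 \<partial>P (X j \<omega>)) \<le> w\<^sup>2 * u"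
      using E2(3)[of \<omega>] om m[of "\<lambda>j k. \<integral>y. (\<Sum>i=1..k. q i (Suc j) (X i \<omega>) y)\<^sup>2 \<partial>P (X j \<omega>)"] by simp
    have "(\<Sum>j=1..<N. ?S j \<omega> (X (Suc j) \<omega>) - (\<integral>y. ?S j \<omega> y \<partial>P (X j \<omega>))) \<le> l * (w\<^sup>2 * u) + u / l"
      using E3(3)[of \<omega>] om tr v by simp
    also have "l * (w\<^sup>2 * u) \<le> w * u"
    proof -
      have "w\<^sup>2 * u \<le> (b + w) * (w * u)" using b w u by (simp add: power2_eq_square algebra_simps)
      then show ?thesis using b w by (simp add: l_def pos_divide_le_eq mult.commute)
    qed
    also have "u / l = (b + w) * u" by (simp add: l_def)
    finally have "(\<Sum>j=1..<N. ?S j \<omega> (X (Suc j) \<omega>) - (\<integral>y. ?S j \<omega> y \<partial>P (X j \<omega>))) \<le> b * u + 2 * w * u"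
      by (simp add: algebra_simps)
    also have "2 * w * u = 16 * K0 * sqrt \<delta>\<^sub>M * \<beta> * sqrt N * u" by (simp add: w_def)
    finally show "(\<Sum>j=1..<N. S j \<omega> (X (Suc j) \<omega>) - (\<integral>y. S j \<omega> y \<partial>P (X j \<omega>)))
       \<le> lag_bound A \<beta> N u"
      unfolding lag_bound_def b_def
      using m[of "\<lambda>j k. (\<Sum>i=1..k. q i (Suc j) (X i \<omega>) (X (Suc j) \<omega>)) - (\<integral>y. (\<Sum>i=1..k. q i (Suc j) (X i \<omega>) y) \<partial>P (X j \<omega>))"]
      by simp
  qed
qed

end

end

section \<open>Total variation and integrals\<close>

lemma integral_mono_measure_on:
  fixes h :: "'a \<Rightarrow> real"
  assumes K: "finite_measure K" and N: "finite_measure N" and s: "sets N = sets K" and Z: "Z \<in> sets K"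
    and le: "\<And>D. D \<in> sets K \<Longrightarrow> D \<subseteq> Z \<Longrightarrow> emeasure K D \<le> emeasure N D"
    and h: "h \<in> borel_measurable K" and b: "\<And>x. x \<in> space K \<Longrightarrow> 0 \<le> h x" "\<And>x. x \<in> space K \<Longrightarrow> h x \<le> c"
  shows "(\<integral>x. h x * indicator Z x \<partial>K) \<le> (\<integral>x. h x * indicator Z x \<partial>N)"
proof -
  have sp: "space N = space K" by (rule sets_eq_imp_space_eq[OF s])
  have hN: "h \<in> borel_measurable N" using h by (simp add: measurable_cong_sets[OF s refl])
  have ZN: "Z \<in> sets N" using Z s by simp
  let ?g = "\<lambda>x. h x * indicator Z x"
  have gb: "\<bar>?g x\<bar> \<le> c" if "x \<in> space K" for x
    using b[OF that] by (auto split: split_indicator)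
  have g0: "0 \<le> ?g x" if "x \<in> space K" for x using b(1)[OF that] by (auto split: split_indicator)
  have gK: "?g \<in> borel_measurable K" using h Z by simp
  have gN: "?g \<in> borel_measurable N" using hN ZN by simp
  have i1: "integrable K ?g" by (rule integrable_bounded[OF K gK gb])
  have i2: "integrable N ?g" by (rule integrable_bounded[OF N gN, of c]) (use gb sp in simp)
  have e1: "(\<integral>\<^sup>+x. ennreal (?g x) \<partial>K) = ennreal (\<integral>x. ?g x \<partial>K)"
    by (rule nn_integral_eq_integral[OF i1]) (use g0 in \<open>intro AE_I2\<close>)
  have e2: "(\<integral>\<^sup>+x. ennreal (?g x) \<partial>N) = ennreal (\<integral>x. ?g x \<partial>N)"
    by (rule nn_integral_eq_integral[OF i2]) (use g0 sp in \<open>intro AE_I2, simp\<close>)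
  have "(\<integral>\<^sup>+x. ennreal (h x) \<partial>density K (indicator Z)) \<le> ennreal 1 * (\<integral>\<^sup>+x. ennreal (h x) \<partial>density N (indicator Z))"
  proof (rule nn_integral_le_scaled)
    fix D assume "D \<in> sets (density K (indicator Z))"
    then have D: "D \<in> sets K" by simp
    have "emeasure K (Z \<inter> D) \<le> emeasure N (Z \<inter> D)" using D Z by (intro le) auto
    moreover have "emeasure (density K (indicator Z)) D = emeasure K (Z \<inter> D)"
      by (rule emeasure_restricted[OF Z D])
    moreover have "emeasure (density N (indicator Z)) D = emeasure N (Z \<inter> D)"
      using D s by (intro emeasure_restricted[OF ZN]) simp
    ultimately show "emeasure (density K (indicator Z)) D \<le> ennreal 1 * emeasure (density N (indicator Z)) D"
      by simp
  qed (use s h in simp_all)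
  also have "(\<integral>\<^sup>+x. ennreal (h x) \<partial>density K (indicator Z)) = (\<integral>\<^sup>+x. ennreal (?g x) \<partial>K)"
    using h Z by (subst nn_integral_density) (auto intro!: nn_integral_cong split: split_indicator)
  also have "(\<integral>\<^sup>+x. ennreal (h x) \<partial>density N (indicator Z)) = (\<integral>\<^sup>+x. ennreal (?g x) \<partial>N)"
    using hN ZN by (subst nn_integral_density) (auto intro!: nn_integral_cong split: split_indicator)
  finally have "ennreal (\<integral>x. ?g x \<partial>K) \<le> ennreal (\<integral>x. ?g x \<partial>N)" unfolding e1 e2 by simp
  moreover have "0 \<le> (\<integral>x. ?g x \<partial>N)" by (rule integral_nonneg_AE) (use g0 sp in \<open>intro AE_I2, simp\<close>)
  ultimately show ?thesis by (subst (asm) ennreal_le_iff) auto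
qed

text \<open>
  On a Hahn decomposition, \<open>K\<close> dominates \<open>N\<close> on \<open>Y\<close> and \<open>N\<close> dominates \<open>K\<close> on the complement \<open>Z\<close>.
  Comparing the nonnegative functions \<open>c - f\<close> on \<open>Y\<close> and \<open>f + c\<close> on \<open>Z\<close>
  leaves the masses of \<open>Y\<close> and \<open>Z\<close> with coefficient \<open>c\<close> each.
\<close>

lemma integral_diff_le_tv:
  fixes f :: "'a \<Rightarrow> real"
  assumes K: "prob_space K" and N: "prob_space N" and s: "sets N = sets K"
    and f: "f \<in> borel_measurable K" and b: "\<And>x. x \<in> space K \<Longrightarrow> \<bar>f x\<bar> \<le> c" and c: "0 \<le> c"
    and tv: "\<And>D. D \<in> sets K \<Longrightarrow> \<bar>measure K D - measure N D\<bar> \<le> e"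
  shows "(\<integral>x. f x \<partial>K) - (\<integral>x. f x \<partial>N) \<le> 2 * c * e"
proof -
  interpret K: prob_space K by fact
  interpret N: prob_space N by fact
  have sp: "space N = space K" by (rule sets_eq_imp_space_eq[OF s])
  obtain Y where Y: "Y \<in> sets K" and Y1: "\<And>D. D \<in> sets K \<Longrightarrow> D \<subseteq> Y \<Longrightarrow> emeasure N D \<le> emeasure K D"
    and Y2: "\<And>D. D \<in> sets K \<Longrightarrow> D \<inter> Y = {} \<Longrightarrow> emeasure K D \<le> emeasure N D"
    using finite_unsigned_Hahn_decomposition[OF K.finite_measure_axioms N.finite_measure_axioms s]
    by (elim bexE conjE) (rule that, auto)
  define Z where "Z = space K - Y"
  have Z: "Z \<in> sets K" using Y by (auto simp: Z_def)
  have fN: "f \<in> borel_measurable N" using f by (simp add: measurable_cong_sets[OF s refl])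
  have YN: "Y \<in> sets N" and ZN: "Z \<in> sets N" using Y Z s by auto
  have b2: "- c \<le> f x \<and> f x \<le> c" if "x \<in> space K" for x using b[OF that] by (simp add: abs_le_iff minus_le_iff)
  have le1: "(\<integral>x. (c - f x) * indicator Y x \<partial>N) \<le> (\<integral>x. (c - f x) * indicator Y x \<partial>K)"
  proof (rule integral_mono_measure_on[OF N.finite_measure_axioms K.finite_measure_axioms s[symmetric] YN])
    show "emeasure N D \<le> emeasure K D" if "D \<in> sets N" "D \<subseteq> Y" for D
      by (rule Y1) (use that s in auto)
    show "0 \<le> c - f x" "c - f x \<le> 2 * c" if "x \<in> space N" for x using b2[of x] that sp by auto
  qed (use fN in simp)
  have le2: "(\<integral>x. (f x + c) * indicator Z x \<partial>K) \<le> (\<integral>x. (f x + c) * indicator Z x \<partial>N)"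
  proof (rule integral_mono_measure_on[OF K.finite_measure_axioms N.finite_measure_axioms s Z])
    show "emeasure K D \<le> emeasure N D" if "D \<in> sets K" "D \<subseteq> Z" for D
      by (rule Y2) (use that in \<open>auto simp: Z_def\<close>)
    show "0 \<le> f x + c" "f x + c \<le> 2 * c" if "x \<in> space K" for x using b2[OF that] by auto
  qed (use f in simp)
  have iK: "integrable K (\<lambda>x. f x * indicator S x)" if "S \<in> sets K" for S
    by (rule integrable_bounded[OF K.finite_measure_axioms, of _ c])
       (use f that b c in \<open>auto split: split_indicator\<close>)
  have iN: "integrable N (\<lambda>x. f x * indicator S x)" if "S \<in> sets N" for S
    by (rule integrable_bounded[OF N.finite_measure_axioms, of _ c])
       (use fN that b c sp in \<open>auto split: split_indicator\<close>)
  have cK: "integrable K (\<lambda>x. c * indicator S x)" if "S \<in> sets K" for S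
    by (rule integrable_bounded[OF K.finite_measure_axioms, of _ c])
       (use that c in \<open>auto split: split_indicator\<close>)
  have cN: "integrable N (\<lambda>x. c * indicator S x)" if "S \<in> sets N" for S
    by (rule integrable_bounded[OF N.finite_measure_axioms, of _ c])
       (use that c in \<open>auto split: split_indicator\<close>)
  have splitK: "(\<integral>x. f x \<partial>K) = (\<integral>x. f x * indicator Y x \<partial>K) + (\<integral>x. f x * indicator Z x \<partial>K)"
    by (subst Bochner_Integration.integral_add[symmetric, OF iK[OF Y] iK[OF Z]])
       (auto intro!: Bochner_Integration.integral_cong simp: Z_def split: split_indicator)
  have splitN: "(\<integral>x. f x \<partial>N) = (\<integral>x. f x * indicator Y x \<partial>N) + (\<integral>x. f x * indicator Z x \<partial>N)"
    by (subst Bochner_Integration.integral_add[symmetric, OF iN[OF YN] iN[OF ZN]])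
       (auto intro!: Bochner_Integration.integral_cong simp: Z_def sp split: split_indicator)
  have mK: "(\<integral>x. c * indicator S x \<partial>K) = c * measure K S" if "S \<in> sets K" for S
    using that by simp
  have mN: "(\<integral>x. c * indicator S x \<partial>N) = c * measure N S" if "S \<in> sets N" for S
    using that by simp
  have A1: "c * measure N Y - (\<integral>x. f x * indicator Y x \<partial>N) \<le> c * measure K Y - (\<integral>x. f x * indicator Y x \<partial>K)"
    using le1 unfolding left_diff_distrib
    by (simp only: Bochner_Integration.integral_diff[OF cN[OF YN] iN[OF YN]] Bochner_Integration.integral_diff[OF cK[OF Y] iK[OF Y]] mK[OF Y] mN[OF YN])
  have A2: "(\<integral>x. f x * indicator Z x \<partial>K) + c * measure K Z \<le> (\<integral>x. f x * indicator Z x \<partial>N) + c * measure N Z"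
    using le2 unfolding distrib_right
    by (simp only: Bochner_Integration.integral_add[OF iN[OF ZN] cN[OF ZN]] Bochner_Integration.integral_add[OF iK[OF Z] cK[OF Z]] mK[OF Z] mN[OF ZN])
  have zK: "measure K Z = 1 - measure K Y" unfolding Z_def by (rule K.prob_compl[OF Y])
  have zN: "measure N Z = 1 - measure N Y" unfolding Z_def sp[symmetric] by (rule N.prob_compl[OF YN])
  have "(\<integral>x. f x \<partial>K) - (\<integral>x. f x \<partial>N) \<le> c * (measure K Y - measure N Y) + c * (measure N Z - measure K Z)"
    using A1 A2 unfolding splitK splitN by (simp add: algebra_simps)
  also have "\<dots> = 2 * (c * (measure K Y - measure N Y))" unfolding zK zN by (simp add: algebra_simps)
  also have "\<dots> \<le> 2 * (c * e)" using tv[OF Y] c by (intro mult_left_mono) auto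
  finally show ?thesis by simp
qed

lemma abs_integral_diff_le_tv:
  fixes f :: "'a \<Rightarrow> real"
  assumes K: "prob_space K" and N: "prob_space N" and s: "sets N = sets K"
    and f: "f \<in> borel_measurable K" and b: "\<And>x. x \<in> space K \<Longrightarrow> \<bar>f x\<bar> \<le> c" and c: "0 \<le> c"
    and tv: "\<And>D. D \<in> sets K \<Longrightarrow> \<bar>measure K D - measure N D\<bar> \<le> e"
  shows "\<bar>(\<integral>x. f x \<partial>K) - (\<integral>x. f x \<partial>N)\<bar> \<le> 2 * c * e"
proof -
  have "(\<integral>x. f x \<partial>K) - (\<integral>x. f x \<partial>N) \<le> 2 * c * e" by (rule integral_diff_le_tv[OF K N s f b c tv])
  moreover have "(\<integral>x. - f x \<partial>K) - (\<integral>x. - f x \<partial>N) \<le> 2 * c * e"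
    by (rule integral_diff_le_tv[OF K N s _ _ c tv]) (use f b in auto)
  ultimately show ?thesis by (simp add: abs_le_iff)
qed

section \<open>Correlations at a distance\<close>

context minorized_chain
begin

text \<open>
  By induction on the distance: conditioning on the time before the last replaces \<open>g\<close> by its \<open>P\<close>-average in the second
  argument, so \<open>g\<close> is generalised.
\<close>

lemma expectation_pair:
  assumes i: "1 \<le> i" and g: "case_prod g \<in> borel_measurable (M \<Otimes>\<^sub>M M)"
    and b: "\<And>x y. x \<in> space M \<Longrightarrow> y \<in> space M \<Longrightarrow> \<bar>g x y\<bar> \<le> (c::real)"
  shows "(\<integral>\<omega>. g (X i \<omega>) (X (i + k) \<omega>) \<partial>\<Omega>) = (\<integral>\<omega>. pint k (g (X i \<omega>)) (X i \<omega>) \<partial>\<Omega>)"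
  using g b
proof (induction k arbitrary: g)
  case 0
  show ?case
  proof (rule Bochner_Integration.integral_cong[OF refl])
    fix \<omega> assume "\<omega> \<in> space \<Omega>"
    then have x: "X i \<omega> \<in> space M" by (rule X_space[OF i])
    show "g (X i \<omega>) (X (i + 0) \<omega>) = pint 0 (g (X i \<omega>)) (X i \<omega>)"
      using pint_0[OF x measurable_Pair2[OF 0(1) x]] by simp
  qed
next
  case (Suc k)
  define g' where "g' x z = (\<integral>y. g x y \<partial>P z)" for x z
  have gx: "g x \<in> borel_measurable M" if "x \<in> space M" for x
    using measurable_Pair2[OF Suc(2) that] by simp
  have ik: "1 \<le> i + k" using i by simp
  have Xi[measurable]: "X i \<in> past (i + k) \<rightarrow>\<^sub>M M" using i by (intro X_past) auto
  have Hm: "(\<lambda>(\<omega>, y). g (X i \<omega>) y) \<in> borel_measurable (past (i + k) \<Otimes>\<^sub>M M)"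
  proof -
    have "(\<lambda>z. (X i (fst z), snd z)) \<in> past (i + k) \<Otimes>\<^sub>M M \<rightarrow>\<^sub>M M \<Otimes>\<^sub>M M" by measurable
    from measurable_compose[OF this Suc(2)] show ?thesis by (simp add: case_prod_beta)
  qed
  have "(\<integral>\<omega>. g (X i \<omega>) (X (i + Suc k) \<omega>) \<partial>\<Omega>) = (\<integral>\<omega>. g' (X i \<omega>) (X (i + k) \<omega>) \<partial>\<Omega>)"
    unfolding g'_def add_Suc_right
    by (rule integral_step[OF ik Hm, of c]) (use Suc(3) X_space[OF i] in auto)
  also have "\<dots> = (\<integral>\<omega>. pint k (g' (X i \<omega>)) (X i \<omega>) \<partial>\<Omega>)"
  proof (rule Suc.IH)
    have m: "(\<lambda>z. (fst (fst z), snd z)) \<in> (M \<Otimes>\<^sub>M M) \<Otimes>\<^sub>M M \<rightarrow>\<^sub>M M \<Otimes>\<^sub>M M" by measurable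
    have m2: "(\<lambda>(z, y). g (fst z) y) \<in> borel_measurable ((M \<Otimes>\<^sub>M M) \<Otimes>\<^sub>M M)"
      using measurable_compose[OF m Suc(2)] by (simp add: case_prod_beta)
    show "case_prod g' \<in> borel_measurable (M \<Otimes>\<^sub>M M)"
      unfolding g'_def case_prod_beta
      by (rule borel_measurable_kernel_integral[OF m2 measurable_compose[OF measurable_snd P_subkernel]])
    show "\<bar>g' x z\<bar> \<le> c" if "x \<in> space M" "z \<in> space M" for x z
      unfolding g'_def by (rule P_integral_bounded[OF that(2) gx[OF that(1)] Suc(3)[OF that(1)]])
  qed
  also have "\<dots> = (\<integral>\<omega>. pint (Suc k) (g (X i \<omega>)) (X i \<omega>) \<partial>\<Omega>)"
  proof (rule Bochner_Integration.integral_cong[OF refl])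
    fix \<omega> assume "\<omega> \<in> space \<Omega>"
    then have x: "X i \<omega> \<in> space M" by (rule X_space[OF i])
    have "pint (k + 1) (g (X i \<omega>)) (X i \<omega>) = pint k (pint 1 (g (X i \<omega>))) (X i \<omega>)"
      by (rule pint_add[OF x gx[OF x] Suc(3)[OF x]])
    also have "\<dots> = pint k (g' (X i \<omega>)) (X i \<omega>)"
      unfolding pint_def[of k]
    proof (rule Bochner_Integration.integral_cong[OF refl])
      fix z assume "z \<in> space (kernel_pow M P k (X i \<omega>))"
      then have z: "z \<in> space M" by (simp add: pow_space[OF x])
      have "pint (Suc 0) (g (X i \<omega>)) z = (\<integral>y. pint 0 (g (X i \<omega>)) y \<partial>P z)"
        by (rule pint_Suc[OF z gx[OF x] Suc(3)[OF x]])
      also have "\<dots> = g' (X i \<omega>) z" unfolding g'_def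
        by (rule Bochner_Integration.integral_cong[OF refl]) (use z pint_0[OF _ gx[OF x]] in simp)
      finally show "pint 1 (g (X i \<omega>)) z = g' (X i \<omega>) z" by simp
    qed
    finally show "pint k (g' (X i \<omega>)) (X i \<omega>) = pint (Suc k) (g (X i \<omega>)) (X i \<omega>)" by simp
  qed
  finally show ?case .
qed

lemma expectation_pair_decay:
  assumes i: "1 \<le> i" and g: "case_prod g \<in> borel_measurable (M \<Otimes>\<^sub>M M)"
    and b: "\<And>x y. x \<in> space M \<Longrightarrow> y \<in> space M \<Longrightarrow> \<bar>g x y\<bar> \<le> (c::real)"
    and z: "\<And>x. x \<in> space M \<Longrightarrow> (\<integral>y. g x y \<partial>\<pi>) = 0"
  shows "\<bar>\<integral>\<omega>. g (X i \<omega>) (X (i + k) \<omega>) \<partial>\<Omega>\<bar> \<le> c * decay k"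
proof -
  have e: "(\<integral>\<omega>. g (X i \<omega>) (X (i + k) \<omega>) \<partial>\<Omega>) = (\<integral>\<omega>. pint k (g (X i \<omega>)) (X i \<omega>) \<partial>\<Omega>)"
    by (rule expectation_pair[OF i g b])
  show ?thesis unfolding e
  proof (rule abs_integral_le_bound[OF prob_space_axioms])
  have m: "(\<lambda>(x, z). pint k (\<lambda>y. g z y) x) \<in> borel_measurable (M \<Otimes>\<^sub>M M)"
    using measurable_compose[OF measurable_pair_swap' g] by (intro pint_measurable2) (simp add: case_prod_beta)
  have "(\<lambda>\<omega>. (X i \<omega>, X i \<omega>)) \<in> \<Omega> \<rightarrow>\<^sub>M M \<Otimes>\<^sub>M M" using i by simp
  from measurable_compose[OF this m] show "(\<lambda>\<omega>. pint k (g (X i \<omega>)) (X i \<omega>)) \<in> borel_measurable \<Omega>" by simp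
  fix \<omega> assume "\<omega> \<in> space \<Omega>"
  then have x: "X i \<omega> \<in> space M" by (rule X_space[OF i])
  show "\<bar>pint k (g (X i \<omega>)) (X i \<omega>)\<bar> \<le> c * decay k"
    by (rule pint_decay[OF x _ b[OF x] z[OF x]]) (use measurable_Pair2[OF g x] in simp)
  qed
qed

text \<open>
  The indicator of a \<open>\<pi>\<close>-null set is a \<open>\<pi>\<close>-centred function, so geometric forgetting makes it unlikely that the
  chain is in such a set at a late time, whatever its initial law.
\<close>

lemma prob_null_set_decay:
  assumes N: "N \<in> sets M" "measure \<pi> N = 0" and s: "1 \<le> s"
  shows "prob {\<omega> \<in> space \<Omega>. X s \<omega> \<in> N} \<le> decay (s - 1)"
proof -
  interpret pi: prob_space \<pi> by (rule pi_prob)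
  have Ns: "{\<omega> \<in> space \<Omega>. X s \<omega> \<in> N} \<in> sets \<Omega>"
    using measurable_sets[OF X_measurable[OF s] N(1)] by (simp add: vimage_def Int_def conj_commute)
  have "\<bar>\<integral>\<omega>. (\<lambda>x y. indicator N y :: real) (X 1 \<omega>) (X (1 + (s - 1)) \<omega>) \<partial>\<Omega>\<bar> \<le> 1 * decay (s - 1)"
  proof (rule expectation_pair_decay)
    show "case_prod (\<lambda>x y. indicator N y :: real) \<in> borel_measurable (M \<Otimes>\<^sub>M M)"
      using N(1) unfolding case_prod_beta by (intro measurable_compose[OF measurable_snd]) simp
    show "(\<integral>y. indicator N y \<partial>\<pi>) = (0::real)" using N by simp
  qed (auto split: split_indicator)
  moreover have "(\<integral>\<omega>. indicator N (X s \<omega>) \<partial>\<Omega>) = prob {\<omega> \<in> space \<Omega>. X s \<omega> \<in> N}"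
  proof -
    have "(\<integral>\<omega>. (indicator N (X s \<omega>) :: real) \<partial>\<Omega>) = (\<integral>\<omega>. indicator {\<omega> \<in> space \<Omega>. X s \<omega> \<in> N} \<omega> \<partial>\<Omega>)"
      by (rule Bochner_Integration.integral_cong) (auto split: split_indicator)
    also have "\<dots> = prob {\<omega> \<in> space \<Omega>. X s \<omega> \<in> N}" using Ns by (simp add: Int_absorb1[of _ "space \<Omega>"] sets.Int_space_eq2)
    finally show ?thesis .
  qed
  ultimately show ?thesis using s by simp
qed

end

section \<open>The telescoping decomposition\<close>

definition index_pairs :: "nat \<Rightarrow> (nat \<times> nat) set" where
  "index_pairs n = {(i, j). 1 \<le> i \<and> i < j \<and> j \<le> n}"

lemma index_pairs_subset: "index_pairs n \<subseteq> {1..n} \<times> {1..n}"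
  by (auto simp: index_pairs_def)

lemma finite_index_pairs[simp]: "finite (index_pairs n)"
  by (rule finite_subset[OF index_pairs_subset]) simp

text \<open>
  The pairs \<open>(i, j)\<close> with \<open>j - i > k\<close>, grouped by \<open>l = j - k - 1\<close>. In lag \<open>k\<close> the term \<open>(i, j)\<close> is an increment
  from time \<open>l\<close> to time \<open>Suc l\<close>, and \<open>i \<le> l\<close> says that \<open>X i\<close> is known at time \<open>l\<close>.
\<close>

lemma sum_shifted_pairs:
  fixes f :: "nat \<Rightarrow> nat \<Rightarrow> real"
  shows "(\<Sum>(i, j)\<in>index_pairs n. if k < j - i then f i j else 0) =
    (\<Sum>l=1..<n. \<Sum>i=1..l. if Suc l + k \<le> n then f i (Suc l + k) else 0)"
proof -
  let ?S = "Sigma {1..<n} (\<lambda>l. {1..l})"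
  have "(\<Sum>(i, j)\<in>index_pairs n. if k < j - i then f i j else 0) = (\<Sum>z\<in>{z \<in> index_pairs n. k < snd z - fst z}. f (fst z) (snd z))"
    unfolding case_prod_beta by (rule sum.inter_filter[symmetric]) simp
  also have "\<dots> = (\<Sum>z\<in>{z \<in> ?S. Suc (fst z) + k \<le> n}. f (snd z) (Suc (fst z) + k))"
    by (rule sum.reindex_bij_witness[of _ "\<lambda>z. (snd z, Suc (fst z) + k)" "\<lambda>z. (snd z - Suc k, fst z)"])
       (auto simp: index_pairs_def)
  also have "\<dots> = (\<Sum>z\<in>?S. if Suc (fst z) + k \<le> n then f (snd z) (Suc (fst z) + k) else 0)"
    by (rule sum.inter_filter) simp
  also have "\<dots> = (\<Sum>(l, i)\<in>?S. if Suc l + k \<le> n then f i (Suc l + k) else 0)"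
    unfolding case_prod_beta ..
  also have "\<dots> = (\<Sum>l=1..<n. \<Sum>i=1..l. if Suc l + k \<le> n then f i (Suc l + k) else 0)"
    by (rule sum.Sigma[symmetric]) auto
  finally show ?thesis .
qed

text \<open>
  The rate of convergence in total variation holds off the \<open>\<pi>\<close>-null set \<open>N0\<close>, which the initial law may charge.
\<close>

locale ergodic_chain = dominated_chain \<Omega> M P chi X \<mu> \<pi> m \<delta> \<nu> \<delta>\<^sub>M
  for \<Omega> :: "'w measure" and M :: "'a measure" and P chi X \<mu> \<pi> m \<delta> \<nu> \<delta>\<^sub>M +
  fixes L \<rho> :: real and N0 :: "'a set"
  assumes rho: "0 < \<rho>" and L: "0 < L"
    and N0: "N0 \<in> sets M" "measure \<pi> N0 = 0"
    and ergodic: "\<And>x k D. x \<in> space M - N0 \<Longrightarrow> D \<in> sets M \<Longrightarrow>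
      \<bar>measure (kernel_pow M P k x) D - measure \<pi> D\<bar> \<le> L * \<rho> ^ k"
begin

text \<open>
  Enough blocks of \<open>m\<close> steps to bring \<open>(1 - \<delta>)\<^sup>q\<close> down to \<open>exp (- u) / n\<close>; later times \<open>s \<le> n\<close> all satisfy
  \<open>X s \<notin> N0\<close>, except with probability \<open>2 exp (- u)\<close>.
\<close>

definition burn_in :: "real \<Rightarrow> nat \<Rightarrow> nat" where "burn_in u n = m * nat \<lceil>(u + ln n) / \<delta>\<rceil>"

text \<open>
  Pairs at distance at most \<open>t\<close>, pairs whose averages over \<open>t\<close> steps have converged, and pairs met during the
  burn-in.
\<close>

definition remainder_bound :: "real \<Rightarrow> nat \<Rightarrow> nat \<Rightarrow> real \<Rightarrow> real" where
  "remainder_bound A n t u =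
     A * (real n * real t) + 2 * A * (L * \<rho> ^ t) * (real n)\<^sup>2 + A * (real (burn_in u n))\<^sup>2"

context
  fixes p :: "nat \<Rightarrow> nat \<Rightarrow> 'a \<Rightarrow> 'a \<Rightarrow> real" and A B u :: real and n t :: nat
  assumes pm: "\<And>i j. i \<in> {1..n} \<Longrightarrow> j \<in> {1..n} \<Longrightarrow> case_prod (p i j) \<in> borel_measurable (M \<Otimes>\<^sub>M M)"
    and pb: "\<And>i j x y. i \<in> {1..n} \<Longrightarrow> j \<in> {1..n} \<Longrightarrow> x \<in> space M \<Longrightarrow> y \<in> space M \<Longrightarrow> \<bar>p i j x y\<bar> \<le> A"
    and p1: "\<And>i j y. i \<in> {1..n} \<Longrightarrow> j \<in> {1..n} \<Longrightarrow> y \<in> space M \<Longrightarrow> (\<integral>x. p i j x y \<partial>\<pi>) = 0"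
    and p2: "\<And>i j x. i \<in> {1..n} \<Longrightarrow> j \<in> {1..n} \<Longrightarrow> x \<in> space M \<Longrightarrow> (\<integral>y. p i j x y \<partial>\<pi>) = 0"
    and pn: "\<And>i k x. i \<in> {1..n} \<Longrightarrow> k < t \<Longrightarrow> x \<in> space M \<Longrightarrow>
      (\<Sum>j=i+1..n. \<integral>y. (pint k (p i j x) y)\<^sup>2 \<partial>\<nu>) \<le> B\<^sup>2"
    and A: "0 < A" and B: "0 \<le> B" and u: "1 \<le> u" and n: "2 \<le> n"
begin

lemma p_measurable2: "i \<in> {1..n} \<Longrightarrow> j \<in> {1..n} \<Longrightarrow> x \<in> space M \<Longrightarrow> p i j x \<in> borel_measurable M"
  using measurable_Pair2[OF pm[of i j], of x] by simp

lemma pint_p_measurable: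
  assumes "i \<in> {1..n}" "j \<in> {1..n}"
  shows "(\<lambda>(x, y). pint k (p i j x) y) \<in> borel_measurable (M \<Otimes>\<^sub>M M)"
proof -
  have "(\<lambda>(y, x). p i j x y) \<in> borel_measurable (M \<Otimes>\<^sub>M M)"
    using measurable_compose[OF measurable_pair_swap' pm[OF assms]] by (simp add: case_prod_beta)
  then have "(\<lambda>(y, x). pint k (\<lambda>y. p i j x y) y) \<in> borel_measurable (M \<Otimes>\<^sub>M M)"
    by (rule pint_measurable2)
  from measurable_compose[OF measurable_pair_swap' this] show ?thesis by (simp add: case_prod_beta)
qed

text \<open>
  The term of lag \<open>k\<close> in the telescoping sum for \<open>p i j (X i) (X j)\<close>, and what remains after
  \<open>min t (j - i)\<close> lags.
\<close>

definition diff_term :: "nat \<Rightarrow> nat \<Rightarrow> nat \<Rightarrow> 'w \<Rightarrow> real" where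
  "diff_term k i j \<omega> = pint k (p i j (X i \<omega>)) (X (j - k) \<omega>) - pint (Suc k) (p i j (X i \<omega>)) (X (j - Suc k) \<omega>)"

definition rem_term :: "nat \<Rightarrow> nat \<Rightarrow> 'w \<Rightarrow> real" where
  "rem_term i j \<omega> = pint (min t (j - i)) (p i j (X i \<omega>)) (X (j - min t (j - i)) \<omega>)"

definition lag_sum :: "nat \<Rightarrow> 'w \<Rightarrow> real" where
  "lag_sum k \<omega> = (\<Sum>l=1..<n. \<Sum>i=1..l. if Suc l + k \<le> n then diff_term k i (Suc l + k) \<omega> else 0)"

lemma decomposition:
  assumes w: "\<omega> \<in> space \<Omega>"
  shows "(\<Sum>(i, j)\<in>index_pairs n. p i j (X i \<omega>) (X j \<omega>)) =
    (\<Sum>k<t. lag_sum k \<omega>)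
    + (\<Sum>(i, j)\<in>index_pairs n. rem_term i j \<omega>)"
proof -
  have one: "p i j (X i \<omega>) (X j \<omega>) = (\<Sum>k<t. if k < j - i then diff_term k i j \<omega> else 0) + rem_term i j \<omega>"
    if ij: "(i, j) \<in> index_pairs n" for i j
  proof -
    have i: "i \<in> {1..n}" and j: "j \<in> {1..n}" and lt: "i < j" using ij by (auto simp: index_pairs_def)
    let ?T = "min t (j - i)" and ?f = "\<lambda>k. pint k (p i j (X i \<omega>)) (X (j - k) \<omega>)"
    have xi: "X i \<omega> \<in> space M" and xj: "X j \<omega> \<in> space M" using i j w by (auto intro: X_space)
    have "(\<Sum>k<t. if k < j - i then diff_term k i j \<omega> else 0) = (\<Sum>k\<in>{k \<in> {..<t}. k < j - i}. diff_term k i j \<omega>)"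
      by (rule sum.inter_filter[symmetric]) simp
    also have "{k \<in> {..<t}. k < j - i} = {..<?T}" by auto
    also have "(\<Sum>k<?T. diff_term k i j \<omega>) = (\<Sum>k<?T. ?f k - ?f (Suc k))" by (simp add: diff_term_def)
    also have "\<dots> = ?f 0 - ?f ?T" by (rule sum_lessThan_telescope')
    also have "?f 0 = p i j (X i \<omega>) (X j \<omega>)" using pint_0[OF xj p_measurable2[OF i j xi]] by simp
    also have "?f ?T = rem_term i j \<omega>" by (simp add: rem_term_def)
    finally show ?thesis by simp
  qed
  have "(\<Sum>(i, j)\<in>index_pairs n. p i j (X i \<omega>) (X j \<omega>)) =
     (\<Sum>(i, j)\<in>index_pairs n. (\<Sum>k<t. if k < j - i then diff_term k i j \<omega> else 0) + rem_term i j \<omega>)"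
    by (rule sum.cong) (auto simp: one)
  also have "\<dots> = (\<Sum>(i, j)\<in>index_pairs n. \<Sum>k<t. if k < j - i then diff_term k i j \<omega> else 0) + (\<Sum>(i, j)\<in>index_pairs n. rem_term i j \<omega>)"
    by (simp add: case_prod_beta sum.distrib)
  also have "(\<Sum>(i, j)\<in>index_pairs n. \<Sum>k<t. if k < j - i then diff_term k i j \<omega> else 0) =
      (\<Sum>k<t. \<Sum>(i, j)\<in>index_pairs n. if k < j - i then diff_term k i j \<omega> else 0)"
    unfolding case_prod_beta by (rule sum.swap)
  finally show ?thesis by (simp only: sum_shifted_pairs lag_sum_def)
qed

text \<open>
  An instance of \<open>degenerate_martingale_tail\<close>: averaging over \<open>P\<^sup>k\<close> in the second argument preserves the bound \<open>A\<close> and,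
  by Fubini, the centring in the first argument. The variance proxy is enlarged from \<open>B\<close> to \<open>B + A\<close> to make it positive.
\<close>

lemma lag_tail:
  assumes k: "k < t"
  shows "\<exists>E\<in>sets \<Omega>. prob E \<le> (2 + \<delta>\<^sub>M) * exp (- u) \<and> (\<forall>\<omega>\<in>space \<Omega> - E.
    lag_sum k \<omega>
     \<le> lag_bound A (B + A) n u)"
proof -
  \<comment> \<open>Zero outside the relevant indices, so that the bounds hold for all indices.\<close>
  define q where "q i l x y = (if 1 \<le> i \<and> i < l \<and> l + k \<le> n then pint k (p i (l + k) x) y else 0)" for i l x y
  have qm: "case_prod (q i l) \<in> borel_measurable (M \<Otimes>\<^sub>M M)" for i l
  proof (cases "1 \<le> i \<and> i < l \<and> l + k \<le> n")
    case True
    then have "i \<in> {1..n}" "l + k \<in> {1..n}" by auto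
    from pint_p_measurable[OF this] True show ?thesis by (simp add: q_def[abs_def])
  next
    case False
    then have "q i l = (\<lambda>x y. 0)" by (simp only: q_def[abs_def] if_False)
    then show ?thesis by simp
  qed
  have qb: "\<bar>q i l x y\<bar> \<le> A" if "x \<in> space M" "y \<in> space M" for i l x y
  proof (cases "1 \<le> i \<and> i < l \<and> l + k \<le> n")
    case True
    then have ij: "i \<in> {1..n}" "l + k \<in> {1..n}" by auto
    have "\<bar>pint k (p i (l + k) x) y\<bar> \<le> A"
      by (rule pint_bounded[OF that(2) p_measurable2[OF ij that(1)] pb[OF ij that(1)]])
    then show ?thesis using True by (simp add: q_def)
  next
    case False
    then have "q i l x y = 0" by (simp only: q_def if_False)
    then show ?thesis using A by simp
  qed
  have q0: "(\<integral>x. q i l x y \<partial>\<pi>) = 0" if y: "y \<in> space M" for i l y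
  proof (cases "1 \<le> i \<and> i < l \<and> l + k \<le> n")
    case True
    then have ij: "i \<in> {1..n}" "l + k \<in> {1..n}" by auto
    have cong: "borel_measurable (\<pi> \<Otimes>\<^sub>M kernel_pow M P k y) = borel_measurable (M \<Otimes>\<^sub>M M)"
      by (rule measurable_cong_sets[OF sets_pair_measure_cong[OF pi_sets pow_sets[OF y]] refl])
    have "(\<integral>x. q i l x y \<partial>\<pi>) = (\<integral>x. (\<integral>z. p i (l + k) x z \<partial>kernel_pow M P k y) \<partial>\<pi>)"
      using True by (simp add: q_def pint_def)
    also have "\<dots> = (\<integral>z. (\<integral>x. p i (l + k) x z \<partial>\<pi>) \<partial>kernel_pow M P k y)"
      by (rule Fubini_bounded[OF prob_space.finite_measure[OF pi_prob] pow_finite[OF y], where c = A])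
         (use pm[OF ij] pb[OF ij] in \<open>simp_all add: cong pow_space[OF y]\<close>)
    also have "\<dots> = (\<integral>z. 0 \<partial>kernel_pow M P k y)"
      by (rule Bochner_Integration.integral_cong[OF refl]) (use p1[OF ij] in \<open>simp add: pow_space[OF y]\<close>)
    finally show ?thesis by simp
  next
    case False
    then have "q i l x y = 0" for x by (simp only: q_def if_False)
    then show ?thesis by simp
  qed
  have qn: "(\<Sum>l\<in>{i..<n}. \<integral>y. (q i (Suc l) x y)\<^sup>2 \<partial>\<nu>) \<le> (B + A)\<^sup>2" if x: "x \<in> space M" for i x
  proof (cases "i \<in> {1..n}")
    case True
    have "(\<Sum>l\<in>{i..<n}. \<integral>y. (q i (Suc l) x y)\<^sup>2 \<partial>\<nu>) =
        (\<Sum>l\<in>{i..<n}. if Suc l + k \<le> n then \<integral>y. (pint k (p i (Suc l + k) x) y)\<^sup>2 \<partial>\<nu> else 0)"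
      using True by (intro sum.cong) (auto simp: q_def)
    also have "\<dots> = (\<Sum>l\<in>{l \<in> {i..<n}. Suc l + k \<le> n}. \<integral>y. (pint k (p i (Suc l + k) x) y)\<^sup>2 \<partial>\<nu>)"
      by (rule sum.inter_filter[symmetric]) simp
    also have "\<dots> = (\<Sum>j\<in>{i+1+k..n}. \<integral>y. (pint k (p i j x) y)\<^sup>2 \<partial>\<nu>)"
      by (rule sum.reindex_bij_witness[of _ "\<lambda>j. j - Suc k" "\<lambda>l. Suc l + k"]) auto
    also have "\<dots> \<le> (\<Sum>j=i+1..n. \<integral>y. (pint k (p i j x) y)\<^sup>2 \<partial>\<nu>)"
      by (rule sum_mono2) auto
    also have "\<dots> \<le> B\<^sup>2" by (rule pn[OF True k x])
    also have "\<dots> \<le> (B + A)\<^sup>2" using A B by (intro power_mono) auto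
    finally show ?thesis .
  next
    case False
    have "(\<Sum>l\<in>{i..<n}. \<integral>y. (q i (Suc l) x y)\<^sup>2 \<partial>\<nu>) = 0"
      by (rule sum.neutral) (use False in \<open>auto simp: q_def\<close>)
    then show ?thesis by simp
  qed
  have e: "(\<Sum>i=1..l. q i (Suc l) (X i \<omega>) (X (Suc l) \<omega>)) - (\<integral>y. (\<Sum>i=1..l. q i (Suc l) (X i \<omega>) y) \<partial>P (X l \<omega>))
     = (\<Sum>i=1..l. if Suc l + k \<le> n then diff_term k i (Suc l + k) \<omega> else 0)"
    if l: "l \<in> {1..<n}" and w: "\<omega> \<in> space \<Omega>" for l \<omega>
  proof -
    have xl: "X l \<omega> \<in> space M" using l w by (intro X_space) auto
    have qP: "integrable (P (X l \<omega>)) (q i (Suc l) (X i \<omega>))" if i: "i \<in> {1..l}" for i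
    proof -
      have xi: "X i \<omega> \<in> space M" using i w by (intro X_space) auto
      show ?thesis
        by (rule integrable_bounded[OF P_finite[OF xl], of _ A])
           (use qb[OF xi] measurable_Pair2[OF qm xi] xl in \<open>auto simp: borel_P[OF xl]\<close>)
    qed
    have "(\<integral>y. (\<Sum>i=1..l. q i (Suc l) (X i \<omega>) y) \<partial>P (X l \<omega>)) = (\<Sum>i=1..l. \<integral>y. q i (Suc l) (X i \<omega>) y \<partial>P (X l \<omega>))"
      by (rule Bochner_Integration.integral_sum) (rule qP)
    then have "(\<Sum>i=1..l. q i (Suc l) (X i \<omega>) (X (Suc l) \<omega>)) - (\<integral>y. (\<Sum>i=1..l. q i (Suc l) (X i \<omega>) y) \<partial>P (X l \<omega>))
      = (\<Sum>i=1..l. q i (Suc l) (X i \<omega>) (X (Suc l) \<omega>) - (\<integral>y. q i (Suc l) (X i \<omega>) y \<partial>P (X l \<omega>)))"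
      by (simp only: sum_subtractf)
    also have "\<dots> = (\<Sum>i=1..l. if Suc l + k \<le> n then diff_term k i (Suc l + k) \<omega> else 0)"
    proof (rule sum.cong[OF refl])
      fix i assume i: "i \<in> {1..l}"
      have xi: "X i \<omega> \<in> space M" using i w by (intro X_space) auto
      show "q i (Suc l) (X i \<omega>) (X (Suc l) \<omega>) - (\<integral>y. q i (Suc l) (X i \<omega>) y \<partial>P (X l \<omega>))
          = (if Suc l + k \<le> n then diff_term k i (Suc l + k) \<omega> else 0)"
      proof (cases "Suc l + k \<le> n")
        case True
        have ij: "i \<in> {1..n}" "Suc l + k \<in> {1..n}" using i True by auto
        have qe: "q i (Suc l) (X i \<omega>) y = pint k (p i (Suc l + k) (X i \<omega>)) y" for y
          using i True by (simp add: q_def)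
        have s: "Suc l + k - k = Suc l" "Suc l + k - Suc k = l" by auto
        have "pint (Suc k) (p i (Suc l + k) (X i \<omega>)) (X l \<omega>) = (\<integral>y. q i (Suc l) (X i \<omega>) y \<partial>P (X l \<omega>))"
          unfolding qe by (rule pint_Suc[OF xl p_measurable2[OF ij xi] pb[OF ij xi]])
        then show ?thesis using True unfolding diff_term_def s qe by simp
      next
        case False
        then have "q i (Suc l) x y = 0" for x y by (simp add: q_def)
        then show ?thesis using False by simp
      qed
    qed
    finally show ?thesis .
  qed
  have BA: "0 < B + A" and n1: "1 \<le> n" using A B n by auto
  obtain E where E: "E \<in> sets \<Omega>" "prob E \<le> (2 + \<delta>\<^sub>M) * exp (- u)"
    "\<And>\<omega>. \<omega> \<in> space \<Omega> - E \<Longrightarrow> (\<Sum>l=1..<n. (\<Sum>i=1..l. q i (Suc l) (X i \<omega>) (X (Suc l) \<omega>)) - (\<integral>y. (\<Sum>i=1..l. q i (Suc l) (X i \<omega>) y) \<partial>P (X l \<omega>)))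
       \<le> lag_bound A (B + A) n u"
    using degenerate_martingale_tail[OF qm qb q0 qn A BA u n1] by blast
  show ?thesis
  proof (intro bexI[OF _ E(1)] conjI E(2) ballI)
    fix \<omega> assume w: "\<omega> \<in> space \<Omega> - E"
    have "lag_sum k \<omega> =
       (\<Sum>l=1..<n. (\<Sum>i=1..l. q i (Suc l) (X i \<omega>) (X (Suc l) \<omega>)) - (\<integral>y. (\<Sum>i=1..l. q i (Suc l) (X i \<omega>) y) \<partial>P (X l \<omega>)))"
      unfolding lag_sum_def by (rule sum.cong[OF refl], rule e[symmetric]) (use w in auto)
    also note E(3)[OF w]
    finally show "lag_sum k \<omega>
     \<le> lag_bound A (B + A) n u" .
  qed
qed

text \<open>
  A term with \<open>j > i + t\<close> is \<open>P\<^sup>t p (X\<^sub>i, X\<^bsub>j-t\<^esub>)\<close>. If \<open>X\<^bsub>j-t\<^esub> \<notin> N0\<close>, it differs from \<open>\<integral>p (X\<^sub>i, \<cdot>) d\<pi> = 0\<close> by at most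
  \<open>2 A L \<rho>\<^sup>t\<close>. Otherwise \<open>i < j - t \<le> burn_in u n\<close>, outside an event of small probability, so there are at most
  \<open>(burn_in u n)\<^sup>2\<close> such pairs; they contribute at most \<open>A\<close> each.
\<close>

lemma remainder_tail:
  "\<exists>E\<in>sets \<Omega>. prob E \<le> 2 * exp (- u) \<and> (\<forall>\<omega>\<in>space \<Omega> - E.
    (\<Sum>(i, j)\<in>index_pairs n. rem_term i j \<omega>) \<le> remainder_bound A n t u)"
proof -
  let ?s = "burn_in u n"
  let ?F = "\<lambda>s. {\<omega> \<in> space \<Omega>. X s \<omega> \<in> N0}"
  let ?E = "\<Union>s\<in>{?s<..n}. ?F s"
  have F: "?F s \<in> sets \<Omega>" if "s \<in> {?s<..n}" for s
    using measurable_sets[OF X_measurable[of s] N0(1)] that by (simp add: vimage_def Int_def conj_commute)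
  have E: "?E \<in> sets \<Omega>" using F by (intro sets.finite_UN) auto
  have pE: "prob ?E \<le> 2 * exp (- u)"
  proof -
    let ?q = "nat \<lceil>(u + ln n) / \<delta>\<rceil>"
    have ul: "0 \<le> u + ln n" using u ln_ge_zero[of "real n"] n by linarith
    have qge: "(u + ln n) / \<delta> \<le> real ?q" using real_nat_ceiling_ge by blast
    then have dq: "u + ln n \<le> \<delta> * real ?q" using \<delta> by (simp add: pos_divide_le_eq mult.commute)
    \<comment> \<open>From \<open>1 - \<delta> \<le> exp (- \<delta>)\<close> and \<open>\<delta> q \<ge> u + ln n\<close>.\<close>
    have "(1 - \<delta>) ^ ?q \<le> exp (- \<delta>) ^ ?q"
      using delta_le_1 exp_ge_add_one_self[of "- \<delta>"] by (intro power_mono) auto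
    also have "\<dots> = exp (- (\<delta> * real ?q))" by (simp add: exp_of_nat_mult[symmetric] mult.commute)
    also have "\<dots> \<le> exp (- (u + ln n))" using dq by simp
    also have "\<dots> = exp (- u) / n"
    proof -
      have "exp (- (u + ln n)) = exp (- u - ln n)" by (rule arg_cong[where f = exp]) simp
      also have "\<dots> = exp (- u) / exp (ln n)" by (rule exp_diff)
      finally show ?thesis using n by simp
    qed
    finally have qle: "(1 - \<delta>) ^ ?q \<le> exp (- u) / n" .
    have "prob ?E \<le> (\<Sum>s\<in>{?s<..n}. prob (?F s))"
      by (rule finite_measure_subadditive_finite) (use F in auto)
    also have "\<dots> \<le> (\<Sum>s\<in>{?s<..n}. 2 * (exp (- u) / n))"
    proof (rule sum_mono)
      fix s assume s: "s \<in> {?s<..n}"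
      then have "prob (?F s) \<le> decay (s - 1)" by (intro prob_null_set_decay N0) auto
      also have "\<dots> \<le> 2 * (1 - \<delta>) ^ ?q"
      proof -
        have "m * ?q \<le> s - 1" using s by (auto simp: burn_in_def)
        then have "?q \<le> (s - 1) div m" using m by (metis div_le_mono nonzero_mult_div_cancel_left not_one_le_zero)
        then show ?thesis unfolding decay_def using delta_le_1 \<delta> by (intro mult_left_mono power_decreasing) auto
      qed
      finally show "prob (?F s) \<le> 2 * (exp (- u) / n)" using qle by linarith
    qed
    also have "\<dots> = real (n - ?s) * (2 * (exp (- u) / n))" by simp
    also have "\<dots> \<le> real n * (2 * (exp (- u) / n))" by (intro mult_right_mono) auto
    also have "\<dots> = 2 * exp (- u)" using n by simp
    finally show ?thesis .
  qed
  have bound: "(\<Sum>(i, j)\<in>index_pairs n. rem_term i j \<omega>) \<le> remainder_bound A n t u"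
    if w: "\<omega> \<in> space \<Omega> - ?E" for \<omega>
  proof -
    let ?e = "2 * A * (L * \<rho> ^ t)"
    have e0: "0 \<le> ?e" using A L rho by simp
    have w': "\<omega> \<in> space \<Omega>" using w by simp
    have one: "rem_term i j \<omega> \<le> (if j \<le> i + t then A else 0) + ?e + (if i + t < j \<and> j \<le> ?s + t then A else 0)"
      if ij: "(i, j) \<in> index_pairs n" for i j
    proof -
      have i: "i \<in> {1..n}" and j: "j \<in> {1..n}" and lt: "i < j" using ij by (auto simp: index_pairs_def)
      have xi: "X i \<omega> \<in> space M" using i w' by (auto intro: X_space)
      let ?x = "X (j - min t (j - i)) \<omega>"
      have x: "?x \<in> space M" using i lt w' by (intro X_space) auto
      have rA: "\<bar>rem_term i j \<omega>\<bar> \<le> A"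
        unfolding rem_term_def by (rule pint_bounded[OF x p_measurable2[OF i j xi] pb[OF i j xi]])
      show ?thesis
      proof (cases "j \<le> i + t \<or> j \<le> ?s + t")
        case True
        then show ?thesis using rA e0 A by auto
      next
        case False
        then have mt: "min t (j - i) = t" and jt: "j - t \<in> {?s<..n}" and jt1: "1 \<le> j - t" using j by auto
        have xN: "X (j - t) \<omega> \<in> space M - N0"
          using w w' jt X_space[OF jt1 w'] by auto
        let ?x = "X (j - t) \<omega>"
        have x: "?x \<in> space M" using xN by simp
        have "\<bar>(\<integral>y. p i j (X i \<omega>) y \<partial>kernel_pow M P t ?x) - (\<integral>y. p i j (X i \<omega>) y \<partial>\<pi>)\<bar> \<le> 2 * A * (L * \<rho> ^ t)"
        proof (rule abs_integral_diff_le_tv[OF pow_prob[OF x] pi_prob])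
          show "sets \<pi> = sets (kernel_pow M P t ?x)" by (simp add: pow_sets[OF x])
          show "p i j (X i \<omega>) \<in> borel_measurable (kernel_pow M P t ?x)"
            using p_measurable2[OF i j xi] by (simp add: borel_pow[OF x])
          show "\<bar>p i j (X i \<omega>) y\<bar> \<le> A" if "y \<in> space (kernel_pow M P t ?x)" for y
            using that pb[OF i j xi] by (simp add: pow_space[OF x])
          show "\<bar>measure (kernel_pow M P t ?x) D - measure \<pi> D\<bar> \<le> L * \<rho> ^ t" if "D \<in> sets (kernel_pow M P t ?x)" for D
            using that by (intro ergodic[OF xN]) (simp add: pow_sets[OF x])
        qed (use A in simp)
        then have "\<bar>rem_term i j \<omega>\<bar> \<le> ?e"
          unfolding rem_term_def mt pint_def using p2[OF i j xi] by simp
        then show ?thesis using False by simp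
      qed
    qed
    have c1: "(\<Sum>(i, j)\<in>index_pairs n. if j \<le> i + t then A else 0) \<le> A * (real n * real t)"
    proof -
      have "(\<Sum>(i, j)\<in>index_pairs n. if j \<le> i + t then A else 0) = (\<Sum>z\<in>{z \<in> index_pairs n. snd z \<le> fst z + t}. A)"
        unfolding case_prod_beta by (rule sum.inter_filter[symmetric]) simp
      also have "\<dots> = real (card {z \<in> index_pairs n. snd z \<le> fst z + t}) * A" by simp
      also have "card {z \<in> index_pairs n. snd z \<le> fst z + t} \<le> card (Sigma {1..n} (\<lambda>i. {i+1..i+t}))"
        by (rule card_mono) (auto simp: index_pairs_def)
      also have "card (Sigma {1..n} (\<lambda>i. {i+1..i+t})) = n * t" by (subst card_SigmaI) auto
      finally show ?thesis using A by (simp add: mult_right_mono mult.commute)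
    qed
    have c3: "(\<Sum>(i, j)\<in>index_pairs n. if i + t < j \<and> j \<le> ?s + t then A else 0) \<le> A * (real ?s)\<^sup>2"
    proof -
      have "(\<Sum>(i, j)\<in>index_pairs n. if i + t < j \<and> j \<le> ?s + t then A else 0) =
         (\<Sum>z\<in>{z \<in> index_pairs n. fst z + t < snd z \<and> snd z \<le> ?s + t}. A)"
        unfolding case_prod_beta by (rule sum.inter_filter[symmetric]) simp
      also have "\<dots> = real (card {z \<in> index_pairs n. fst z + t < snd z \<and> snd z \<le> ?s + t}) * A" by simp
      also have "card {z \<in> index_pairs n. fst z + t < snd z \<and> snd z \<le> ?s + t} \<le> card ({1..?s} \<times> {t+1..?s+t})"
        by (rule card_mono) (auto simp: index_pairs_def)
      also have "card ({1..?s} \<times> {t+1..?s+t}) = ?s * ?s" by (simp add: card_cartesian_product)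
      finally show ?thesis using A by (simp add: mult_right_mono mult.commute power2_eq_square)
    qed
    have c2: "(\<Sum>(i, j)\<in>index_pairs n. ?e) \<le> ?e * (real n)\<^sup>2"
    proof -
      have "card (index_pairs n) \<le> card ({1..n} \<times> {1..n})" by (rule card_mono[OF _ index_pairs_subset]) simp
      then have "real (card (index_pairs n)) \<le> (real n)\<^sup>2"
        by (simp add: card_cartesian_product power2_eq_square flip: of_nat_mult)
      from mult_right_mono[OF this e0] show ?thesis by (simp add: case_prod_beta mult.commute)
    qed
    have "(\<Sum>(i, j)\<in>index_pairs n. rem_term i j \<omega>) \<le>
      (\<Sum>(i, j)\<in>index_pairs n. (if j \<le> i + t then A else 0) + ?e + (if i + t < j \<and> j \<le> ?s + t then A else 0))"
      by (rule sum_mono) (use one in auto)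
    also have "\<dots> = (\<Sum>(i, j)\<in>index_pairs n. if j \<le> i + t then A else 0) + (\<Sum>(i, j)\<in>index_pairs n. ?e)
      + (\<Sum>(i, j)\<in>index_pairs n. if i + t < j \<and> j \<le> ?s + t then A else 0)"
      unfolding case_prod_beta by (simp only: sum.distrib)
    finally show ?thesis using c1 c2 c3 unfolding remainder_bound_def by linarith
  qed
  show ?thesis by (intro bexI[OF _ E] conjI pE ballI bound)
qed

text \<open>
  Correlations decay geometrically in \<open>j - i\<close>, so each \<open>i\<close> contributes a bounded amount.
\<close>

lemma mean_bound:
  "(\<Sum>(i, j)\<in>index_pairs n. \<bar>\<integral>\<omega>. p i j (X i \<omega>) (X j \<omega>) \<partial>\<Omega>\<bar>) \<le> real n * (A * K0)"
proof -
  have "(\<Sum>(i, j)\<in>index_pairs n. \<bar>\<integral>\<omega>. p i j (X i \<omega>) (X j \<omega>) \<partial>\<Omega>\<bar>) \<le> (\<Sum>(i, j)\<in>index_pairs n. A * decay (j - i))"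
  proof (rule sum_mono)
    fix z assume z: "z \<in> index_pairs n"
    obtain i j where ij: "z = (i, j)" by (cases z)
    have i: "i \<in> {1..n}" and j: "j \<in> {1..n}" and lt: "i < j" using z by (auto simp: index_pairs_def ij)
    have "\<bar>\<integral>\<omega>. p i j (X i \<omega>) (X (i + (j - i)) \<omega>) \<partial>\<Omega>\<bar> \<le> A * decay (j - i)"
      by (rule expectation_pair_decay[OF _ pm[OF i j] pb[OF i j] p2[OF i j]]) (use i in auto)
    then show "(case z of (i, j) \<Rightarrow> \<bar>\<integral>\<omega>. p i j (X i \<omega>) (X j \<omega>) \<partial>\<Omega>\<bar>) \<le> (case z of (i, j) \<Rightarrow> A * decay (j - i))"
      using lt by (simp add: ij)
  qed
  also have "\<dots> \<le> (\<Sum>(i, j)\<in>Sigma {1..n} (\<lambda>i. {i..n}). A * decay (j - i))"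
    by (rule sum_mono2) (use A decay_nonneg in \<open>auto simp: index_pairs_def\<close>)
  also have "\<dots> = (\<Sum>i=1..n. \<Sum>j=i..n. A * decay (j - i))"
    by (rule sum.Sigma[symmetric]) auto
  also have "\<dots> \<le> (\<Sum>i=1..n. A * K0)"
    unfolding sum_distrib_left[symmetric] by (intro sum_mono mult_left_mono decay_sum_le) (use A in auto)
  finally show ?thesis by simp
qed

theorem U_statistic_tail:
  "\<exists>E\<in>sets \<Omega>. prob E \<le> (real t * (2 + \<delta>\<^sub>M) + 2) * exp (- u) \<and> (\<forall>\<omega>\<in>space \<Omega> - E.
    (\<Sum>(i, j)\<in>index_pairs n. p i j (X i \<omega>) (X j \<omega>) - (\<integral>\<omega>. p i j (X i \<omega>) (X j \<omega>) \<partial>\<Omega>)) \<le>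
      real t * (lag_bound A (B + A) n u)
      + remainder_bound A n t u + real n * (A * K0))"
proof -
  let ?b = "lag_bound A (B + A) n u"
  have "\<forall>k\<in>{..<t}. \<exists>E. E \<in> sets \<Omega> \<and> prob E \<le> (2 + \<delta>\<^sub>M) * exp (- u) \<and> (\<forall>\<omega>\<in>space \<Omega> - E.
    lag_sum k \<omega> \<le> ?b)"
    using lag_tail by blast
  from bchoice[OF this] obtain E where E: "\<And>k. k < t \<Longrightarrow> E k \<in> sets \<Omega>" "\<And>k. k < t \<Longrightarrow> prob (E k) \<le> (2 + \<delta>\<^sub>M) * exp (- u)"
    "\<And>k \<omega>. k < t \<Longrightarrow> \<omega> \<in> space \<Omega> - E k \<Longrightarrow> lag_sum k \<omega> \<le> ?b"
    by auto
  obtain F where F: "F \<in> sets \<Omega>" "prob F \<le> 2 * exp (- u)"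
    "\<And>\<omega>. \<omega> \<in> space \<Omega> - F \<Longrightarrow> (\<Sum>(i, j)\<in>index_pairs n. rem_term i j \<omega>) \<le> remainder_bound A n t u"
    using remainder_tail by blast
  have U: "(\<Union>k<t. E k) \<in> sets \<Omega>" using E(1) by (intro sets.finite_UN) auto
  show ?thesis
  proof (intro bexI conjI ballI)
    show "(\<Union>k<t. E k) \<union> F \<in> sets \<Omega>" using U F(1) by auto
    have "prob (\<Union>k<t. E k) \<le> (\<Sum>k<t. prob (E k))"
      by (rule finite_measure_subadditive_finite) (use E(1) in auto)
    also have "\<dots> \<le> (\<Sum>k<t. (2 + \<delta>\<^sub>M) * exp (- u))" by (rule sum_mono) (use E(2) in auto)
    finally have "prob (\<Union>k<t. E k) \<le> real t * ((2 + \<delta>\<^sub>M) * exp (- u))" by simp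
    moreover have "prob ((\<Union>k<t. E k) \<union> F) \<le> prob (\<Union>k<t. E k) + prob F" by (rule measure_Un_le[OF U F(1)])
    ultimately show "prob ((\<Union>k<t. E k) \<union> F) \<le> (real t * (2 + \<delta>\<^sub>M) + 2) * exp (- u)"
      using F(2) by (simp add: distrib_right mult.assoc)
    fix \<omega> assume w: "\<omega> \<in> space \<Omega> - ((\<Union>k<t. E k) \<union> F)"
    have "(\<Sum>(i, j)\<in>index_pairs n. p i j (X i \<omega>) (X j \<omega>) - (\<integral>\<omega>. p i j (X i \<omega>) (X j \<omega>) \<partial>\<Omega>)) =
      (\<Sum>(i, j)\<in>index_pairs n. p i j (X i \<omega>) (X j \<omega>)) - (\<Sum>(i, j)\<in>index_pairs n. \<integral>\<omega>. p i j (X i \<omega>) (X j \<omega>) \<partial>\<Omega>)"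
      unfolding case_prod_beta by (simp only: sum_subtractf)
    moreover have "- (\<Sum>(i, j)\<in>index_pairs n. \<integral>\<omega>. p i j (X i \<omega>) (X j \<omega>) \<partial>\<Omega>) \<le> real n * (A * K0)"
    proof -
      have "\<bar>\<Sum>(i, j)\<in>index_pairs n. \<integral>\<omega>. p i j (X i \<omega>) (X j \<omega>) \<partial>\<Omega>\<bar> \<le> (\<Sum>(i, j)\<in>index_pairs n. \<bar>\<integral>\<omega>. p i j (X i \<omega>) (X j \<omega>) \<partial>\<Omega>\<bar>)"
        unfolding case_prod_beta by (rule sum_abs)
      then show ?thesis using mean_bound by linarith
    qed
    moreover have "(\<Sum>k<t. lag_sum k \<omega>) \<le> (\<Sum>k<t. ?b)"
      by (rule sum_mono) (use E(3) w in auto)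
    moreover have "(\<Sum>k<t. ?b) = real t * ?b" by simp
    moreover have "(\<Sum>(i, j)\<in>index_pairs n. rem_term i j \<omega>) \<le> remainder_bound A n t u"
      by (rule F(3)) (use w in auto)
    ultimately show "(\<Sum>(i, j)\<in>index_pairs n. p i j (X i \<omega>) (X j \<omega>) - (\<integral>\<omega>. p i j (X i \<omega>) (X j \<omega>) \<partial>\<Omega>)) \<le>
      real t * ?b + remainder_bound A n t u + real n * (A * K0)"
      using decomposition[of \<omega>] w by simp
  qed
qed

end

end

section \<open>Collecting the terms\<close>

lemma ln_power3_le: "1 \<le> x \<Longrightarrow> (ln x) ^ 3 \<le> 27 * x" for x :: real
proof -
  assume x: "1 \<le> x"
  define y where "y = ln x / 3"
  have y0: "0 \<le> y" using x by (simp add: y_def)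
  have "y ^ 3 \<le> exp y ^ 3" using exp_ge_add_one_self[of y] y0 by (intro power_mono) linarith+
  also have "\<dots> = exp (3 * y)" by (simp add: exp_of_nat_mult[symmetric])
  also have "\<dots> = x" using x by (simp add: y_def)
  finally show ?thesis by (simp add: y_def power_divide)
qed

lemma ln_power2_le: "1 \<le> x \<Longrightarrow> (ln x)\<^sup>2 \<le> 4 * x" for x :: real
proof -
  assume x: "1 \<le> x"
  define y where "y = ln x / 2"
  have y0: "0 \<le> y" using x by (simp add: y_def)
  have "y\<^sup>2 \<le> (exp y)\<^sup>2" using exp_ge_add_one_self[of y] y0 by (intro power_mono) linarith+
  also have "\<dots> = exp (2 * y)" by (simp add: exp_double)
  also have "\<dots> = x" using x by (simp add: y_def)
  finally show ?thesis by (simp add: y_def power_divide)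
qed

lemma powr_three_halves: "0 < u \<Longrightarrow> u powr (3 / 2) = u * sqrt u"
proof -
  assume u: "0 < u"
  have "u powr (3 / 2) = u powr (1 + 1 / 2)" by simp
  also have "\<dots> = u powr 1 * u powr (1 / 2)" by (rule powr_add)
  finally show ?thesis using u by (simp add: powr_half_sqrt)
qed

text \<open>
  If \<open>ln n \<le> u\<close>, the logarithm is absorbed by \<open>u\<close>. Otherwise \<open>u < ln n\<close>, and the left side is at most
  \<open>\<surd>(2 n (ln n)\<^sup>3)\<close>, which is of order \<open>n\<close>.
\<close>

lemma max_term_le:
  fixes u :: real and n :: nat
  assumes u: "1 \<le> u" and n: "2 \<le> n"
  shows "sqrt (real n * (u + ln n)) * u \<le> 2 * sqrt n * u powr (3 / 2) + 8 * real n"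
proof -
  have l0: "0 \<le> ln (real n)" using n by simp
  have pu: "u powr (3 / 2) = u * sqrt u" using u by (intro powr_three_halves) simp
  show ?thesis
  proof (cases "ln (real n) \<le> u")
    case True
    have "sqrt (real n * (u + ln n)) \<le> sqrt (4 * (real n * u))"
    proof (rule real_sqrt_le_mono)
      have "real n * (u + ln n) \<le> real n * (4 * u)" using True u by (intro mult_left_mono) auto
      then show "real n * (u + ln n) \<le> 4 * (real n * u)" by simp
    qed
    also have "\<dots> = 2 * sqrt n * sqrt u" by (simp add: real_sqrt_mult)
    finally have "sqrt (real n * (u + ln n)) * u \<le> 2 * sqrt n * sqrt u * u"
      using u by (intro mult_right_mono) auto
    then show ?thesis unfolding pu by (simp add: mult_ac add_increasing2)
  next
    case False
    then have ul: "u \<le> ln n" by simp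
    have "sqrt (real n * (u + ln n)) * u \<le> sqrt (real n * (2 * ln n)) * ln n"
      using ul u l0 by (intro mult_mono real_sqrt_le_mono mult_left_mono) auto
    also have "\<dots> = sqrt (real n * (2 * ln n) * (ln n)\<^sup>2)" using l0 by (simp add: real_sqrt_mult)
    also have "\<dots> \<le> sqrt ((8 * real n)\<^sup>2)"
    proof (rule real_sqrt_le_mono)
      have "real n * (2 * ln n) * (ln n)\<^sup>2 = 2 * real n * (ln (real n)) ^ 3"
        by (simp add: power2_eq_square power3_eq_cube)
      also have "\<dots> \<le> 2 * real n * (27 * real n)"
        using n by (intro mult_left_mono ln_power3_le) auto
      also have "\<dots> \<le> (8 * real n)\<^sup>2" by (simp add: power2_eq_square)
      finally show "real n * (2 * ln n) * (ln n)\<^sup>2 \<le> (8 * real n)\<^sup>2" .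
    qed
    also have "\<dots> = 8 * real n" by (rule real_sqrt_unique[OF refl]) simp
    finally show ?thesis using u by (simp add: add_increasing)
  qed
qed

text \<open>
  This is where \<open>r > 2 / ln (1 / \<rho>)\<close> matters: \<open>\<rho> powr (r ln n) = n powr (- r ln (1 / \<rho>)) \<le> n\<^bsup>-2\<^esup>\<close>, which pays for the number
  of pairs. The factor \<open>1 / \<rho>\<close> accounts for the rounding in \<open>t_index\<close>.
\<close>

lemma rate_at_t_index:
  fixes \<rho> r :: real
  assumes rho: "0 < \<rho>" "\<rho> < 1" and r: "2 / ln (1 / \<rho>) < r" and n: "2 \<le> n"
  shows "\<rho> ^ t_index r n * (real n)\<^sup>2 \<le> 1 / \<rho>"
proof -
  have l0: "0 < ln (real n)" using n by simp
  have lr: "0 < ln (1 / \<rho>)" using rho by simp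
  have r2: "2 \<le> r * ln (1 / \<rho>)" using r lr by (simp add: pos_divide_less_eq)
  have "r * ln (real n) - 1 \<le> real (t_index r n)" unfolding t_index_def by linarith
  then have "(r * ln (real n) - 1) * ln (1 / \<rho>) \<le> real (t_index r n) * ln (1 / \<rho>)"
    using lr by (intro mult_right_mono) auto
  moreover have "2 * ln (real n) \<le> r * ln (1 / \<rho>) * ln (real n)" using r2 l0 by (intro mult_right_mono) auto
  ultimately have e: "2 * ln (real n) - ln (1 / \<rho>) \<le> real (t_index r n) * ln (1 / \<rho>)"
    by (simp add: algebra_simps)
  have "\<rho> ^ t_index r n = exp (- (real (t_index r n) * ln (1 / \<rho>)))"
    using rho by (simp add: ln_div exp_of_nat_mult)
  also have "\<dots> \<le> exp (ln (1 / \<rho>) - 2 * ln (real n))" using e by simp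
  also have "\<dots> = (1 / \<rho>) / (real n)\<^sup>2"
    using rho n by (simp add: exp_diff exp_double)
  finally have le: "\<rho> ^ t_index r n \<le> (1 / \<rho>) / (real n)\<^sup>2" .
  have "0 < (real n)\<^sup>2" using n by simp
  from le show ?thesis unfolding pos_le_divide_eq[OF \<open>0 < (real n)\<^sup>2\<close>] .
qed

context ergodic_chain
begin

lemma burn_in_square_le:
  assumes u: "1 \<le> u" and n: "2 \<le> n"
  shows "(real (burn_in u n))\<^sup>2 \<le> 2 * K0\<^sup>2 * (u\<^sup>2 + real n)"
proof -
  have l0: "0 \<le> ln (real n)" using n by simp
  have "real (nat \<lceil>(u + ln n) / \<delta>\<rceil>) \<le> (u + ln n) / \<delta> + 1"
    using u l0 \<delta> by (simp add: of_nat_nat zero_le_divide_iff)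
  also have "\<dots> \<le> (2 * u + ln n) / \<delta>"
  proof -
    have "1 \<le> u / \<delta>" using u \<delta> delta_le_1 by (simp add: pos_le_divide_eq)
    then show ?thesis by (simp add: add_divide_distrib)
  qed
  finally have "real (burn_in u n) \<le> real m * ((2 * u + ln n) / \<delta>)"
    unfolding burn_in_def of_nat_mult by (rule mult_left_mono) simp
  also have "\<dots> = K0 / 2 * (2 * u + ln n)" by (simp add: K0_def)
  finally have "(real (burn_in u n))\<^sup>2 \<le> (K0 / 2 * (2 * u + ln n))\<^sup>2" by (intro power_mono) auto
  also have "\<dots> = K0\<^sup>2 / 4 * (2 * u + ln n)\<^sup>2" by (simp add: power_mult_distrib power_divide)
  also have "\<dots> \<le> K0\<^sup>2 / 4 * (8 * (u\<^sup>2 + real n))"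
  proof (rule mult_left_mono)
    have "(2 * u + ln n)\<^sup>2 \<le> 2 * (2 * u)\<^sup>2 + 2 * (ln n)\<^sup>2"
      using square_diff_le[of "2 * u" "- ln n"] by simp
    also have "\<dots> \<le> 8 * u\<^sup>2 + 2 * (4 * real n)"
      using ln_power2_le[of "real n"] n by (simp add: power_mult_distrib)
    finally show "(2 * u + ln n)\<^sup>2 \<le> 8 * (u\<^sup>2 + real n)" by simp
  qed simp
  also have "\<dots> = 2 * K0\<^sup>2 * (u\<^sup>2 + real n)" by (simp add: algebra_simps)
  finally show ?thesis .
qed

definition kappa :: "real \<Rightarrow> real" where
  "kappa r = r * (64 * K0 + 16 * K0 * sqrt \<delta>\<^sub>M + 1) + 4 * L / \<rho> + 4 * K0\<^sup>2 + 2 * K0"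

text \<open>
  Each contribution of \<open>U_statistic_tail\<close> is compared with the bracket \<open>\<Phi>\<close> of the statement. Those that carry no
  logarithm of their own, the last three, use \<open>1 \<le> 2 ln n\<close>.
\<close>

lemma total_bound:
  fixes A B u r \<Phi> :: real and t n :: nat
  assumes rho1: "\<rho> < 1" and r: "2 / ln (1 / \<rho>) < r" and n: "2 \<le> n" and u: "1 \<le> u" and A: "0 < A" and B: "0 \<le> B"
  defines "t \<equiv> t_index r n"
  defines "\<Phi> \<equiv> (A + B * sqrt n) * u + (2 * A * sqrt n) * u powr (3 / 2) + A * (u\<^sup>2 + n)"
  shows "real t * lag_bound A (B + A) n u + remainder_bound A n t u + real n * (A * K0)
      \<le> kappa r * ln n * \<Phi>"
proof -
  let ?l = "ln (real n)"
  have "ln (2::real) \<le> ?l" using n by simp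
  then have l: "1 / 2 \<le> ?l" using ln2_ge_two_thirds by linarith
  have K: "0 < K0" by (rule K0_pos)
  have lr: "0 < ln (1 / \<rho>)" using rho rho1 by simp
  have r0: "0 < r" using r lr by (meson divide_pos_pos less_trans zero_less_numeral)
  have t: "real t \<le> r * ?l" using r0 l unfolding t_def t_index_def by (simp add: of_nat_nat)
  have pu: "u powr (3 / 2) = u * sqrt u" using u by (intro powr_three_halves) simp
  have sn: "0 \<le> sqrt (real n)" by simp
  define a b c d e where "a = A * u" and "b = B * sqrt n * u" and "c = 2 * A * sqrt n * u powr (3 / 2)"
    and "d = A * u\<^sup>2" and "e = A * real n"
  have pos: "0 \<le> a" "0 \<le> b" "0 \<le> c" "0 \<le> d" "0 \<le> e"
    using A B u by (auto simp: a_def b_def c_def d_def e_def)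
  have Phi: "\<Phi> = a + b + c + d + e"
    unfolding \<Phi>_def a_def b_def c_def d_def e_def by (simp add: algebra_simps)
  have Phi0: "0 \<le> \<Phi>" using pos unfolding Phi by linarith
  have T1: "8 * K0 * A * sqrt (real n * (u + ln n)) * u \<le> 64 * K0 * \<Phi>"
  proof -
    have "8 * K0 * A * sqrt (real n * (u + ln n)) * u = 8 * K0 * A * (sqrt (real n * (u + ln n)) * u)" by simp
    also have "\<dots> \<le> 8 * K0 * A * (2 * sqrt n * u powr (3 / 2) + 8 * real n)"
      using K A by (intro mult_left_mono max_term_le u n) auto
    also have "\<dots> = 8 * K0 * (c + 8 * e)" by (simp add: c_def e_def algebra_simps)
    also have "\<dots> \<le> 8 * K0 * (8 * \<Phi>)"
    proof (rule mult_left_mono)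
      have "c + 8 * e = 8 * e + c" by simp
      also have "\<dots> \<le> 8 * e + 8 * c" using pos(3) by simp
      also have "\<dots> = 8 * (c + e)" by simp
      also have "\<dots> \<le> 8 * \<Phi>" using pos unfolding Phi by simp
      finally show "c + 8 * e \<le> 8 * \<Phi>" .
    qed (use K in simp)
    finally show ?thesis by simp
  qed
  have T2: "16 * K0 * sqrt \<delta>\<^sub>M * (B + A) * sqrt n * u \<le> 16 * K0 * sqrt \<delta>\<^sub>M * \<Phi>"
  proof -
    \<comment> \<open>The correction \<open>A \<surd>n u\<close> from \<open>B + A\<close> is absorbed by \<open>2 A \<surd>n u\<^bsup>3/2\<^esup>\<close>.\<close>
    have "1 \<le> sqrt u" using u by simp
    then have "A * sqrt n * u * 1 \<le> A * sqrt n * u * sqrt u" using A u by (intro mult_left_mono) auto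
    then have "A * sqrt n * u * 2 \<le> c" unfolding c_def pu by (simp add: mult_ac)
    moreover have "0 \<le> A * sqrt n * u" using A u by simp
    moreover have "(B + A) * sqrt n * u = b + A * sqrt n * u" by (simp add: b_def algebra_simps)
    ultimately have "(B + A) * sqrt n * u \<le> \<Phi>" using pos unfolding Phi by linarith
    then have "16 * K0 * sqrt \<delta>\<^sub>M * ((B + A) * sqrt n * u) \<le> 16 * K0 * sqrt \<delta>\<^sub>M * \<Phi>"
      using K \<delta>\<^sub>M by (intro mult_left_mono) auto
    then show ?thesis by (simp add: mult_ac)
  qed
  have S1: "real t * lag_bound A (B + A) n u
      \<le> r * (64 * K0 + 16 * K0 * sqrt \<delta>\<^sub>M) * (?l * \<Phi>)"
  proof -
    have "real t * lag_bound A (B + A) n u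
      \<le> real t * ((64 * K0 + 16 * K0 * sqrt \<delta>\<^sub>M) * \<Phi>)"
    proof (rule mult_left_mono)
      show "lag_bound A (B + A) n u
        \<le> (64 * K0 + 16 * K0 * sqrt \<delta>\<^sub>M) * \<Phi>"
        unfolding lag_bound_def distrib_right[of "64 * K0" "16 * K0 * sqrt \<delta>\<^sub>M" \<Phi>] by (rule add_mono[OF T1 T2])
    qed simp
    also have "\<dots> \<le> (r * ?l) * ((64 * K0 + 16 * K0 * sqrt \<delta>\<^sub>M) * \<Phi>)"
      using t K \<delta>\<^sub>M Phi0 by (intro mult_right_mono) auto
    finally show ?thesis by (simp add: mult_ac)
  qed
  have eP: "e \<le> \<Phi>" using pos unfolding Phi by linarith
  have S2: "A * (real n * real t) \<le> r * (?l * \<Phi>)"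
  proof -
    have "A * (real n * real t) = real t * e" by (simp add: e_def)
    also have "\<dots> \<le> (r * ?l) * \<Phi>" using t eP pos r0 l by (intro mult_mono) auto
    finally show ?thesis by simp
  qed
  have one: "\<Phi> \<le> 2 * (?l * \<Phi>)"
  proof -
    have "1 / 2 * \<Phi> \<le> ?l * \<Phi>" by (rule mult_right_mono[OF l Phi0])
    then show ?thesis by simp
  qed
  have A\<Phi>: "A \<le> \<Phi>"
  proof -
    have "A * 1 \<le> a" unfolding a_def using A u by (intro mult_left_mono) auto
    then show ?thesis using pos unfolding Phi by linarith
  qed
  have S3: "2 * A * (L * \<rho> ^ t) * (real n)\<^sup>2 \<le> 4 * L / \<rho> * (?l * \<Phi>)"
  proof -
    have "2 * A * (L * \<rho> ^ t) * (real n)\<^sup>2 = 2 * L * A * (\<rho> ^ t * (real n)\<^sup>2)" by simp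
    also have "\<dots> \<le> 2 * L * A * (1 / \<rho>)"
      unfolding t_def using L A by (intro mult_left_mono rate_at_t_index rho rho1 r n) auto
    also have "\<dots> = 2 * L / \<rho> * A" by simp
    also have "\<dots> \<le> 2 * L / \<rho> * (2 * (?l * \<Phi>))"
      using L rho A\<Phi> one by (intro mult_left_mono) auto
    finally show ?thesis by simp
  qed
  have S4: "A * (real (burn_in u n))\<^sup>2 \<le> 4 * K0\<^sup>2 * (?l * \<Phi>)"
  proof -
    have "A * (real (burn_in u n))\<^sup>2 \<le> A * (2 * K0\<^sup>2 * (u\<^sup>2 + real n))"
      using A by (intro mult_left_mono burn_in_square_le u n) auto
    also have "\<dots> = 2 * K0\<^sup>2 * (d + e)" by (simp add: d_def e_def algebra_simps)
    also have "\<dots> \<le> 2 * K0\<^sup>2 * (2 * (?l * \<Phi>))"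
    proof (rule mult_left_mono)
      have "d + e \<le> \<Phi>" using pos unfolding Phi by linarith
      then show "d + e \<le> 2 * (?l * \<Phi>)" using one by linarith
    qed simp
    finally show ?thesis by simp
  qed
  have S5: "real n * (A * K0) \<le> 2 * K0 * (?l * \<Phi>)"
  proof -
    have "real n * (A * K0) = K0 * e" by (simp add: e_def)
    also have "\<dots> \<le> K0 * (2 * (?l * \<Phi>))" using K eP one by (intro mult_left_mono) auto
    finally show ?thesis by simp
  qed
  have "kappa r * ln n * \<Phi> = r * (64 * K0 + 16 * K0 * sqrt \<delta>\<^sub>M) * (?l * \<Phi>) + r * (?l * \<Phi>) + 4 * L / \<rho> * (?l * \<Phi>)
     + 4 * K0\<^sup>2 * (?l * \<Phi>) + 2 * K0 * (?l * \<Phi>)"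
    unfolding kappa_def by (simp only: distrib_right distrib_left mult.assoc mult_1_right mult_1_left)
  then show ?thesis using S1 S2 S3 S4 S5 unfolding remainder_bound_def by linarith
qed

end

section \<open>The constants of the statement\<close>

lemma A_const_bound:
  assumes bk: "\<And>i j. i \<in> {1..n} \<Longrightarrow> j \<in> {1..n} \<Longrightarrow> bounded_kernel M (h i j)"
    and i: "i \<in> {1..n}" and j: "j \<in> {1..n}" and x: "x \<in> space M" and y: "y \<in> space M"
  shows "2 * \<bar>h i j x y\<bar> \<le> A_const M h n"
proof -
  obtain c where c: "\<forall>x\<in>space M. \<forall>y\<in>space M. \<bar>h i j x y\<bar> \<le> c"
    using bk[OF i j] by (auto simp: bounded_kernel_def)
  let ?S = "\<lambda>i j. SUP (x, y)\<in>space M \<times> space M. \<bar>h i j x y\<bar>"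
  have "(case (x, y) of (x, y) \<Rightarrow> \<bar>h i j x y\<bar>) \<le> ?S i j"
    by (rule cSUP_upper) (use x y c in \<open>auto simp: bdd_above_def\<close>)
  then have "\<bar>h i j x y\<bar> \<le> ?S i j" by simp
  also have "\<dots> \<le> (MAX j\<in>{1..n}. ?S i j)" using j by (intro Max_ge) auto
  also have "\<dots> \<le> (MAX i\<in>{1..n}. MAX j\<in>{1..n}. ?S i j)" using i by (intro Max_ge) auto
  finally show ?thesis unfolding A_const_def by simp
qed

lemma canonical_mean_eq:
  assumes c: "canonical \<pi> f" and x: "x \<in> space \<pi>"
  shows "(\<integral>z. f z x \<partial>\<pi>) = canonical_mean \<pi> f" "(\<integral>z. f x z \<partial>\<pi>) = canonical_mean \<pi> f"
proof -
  let ?P = "\<lambda>c. \<forall>x\<in>space \<pi>. (\<integral>z. f z x \<partial>\<pi>) = c \<and> (\<integral>z. f x z \<partial>\<pi>) = c"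
  have "?P (\<integral>z. f z x \<partial>\<pi>)"
  proof
    fix y assume y: "y \<in> space \<pi>"
    show "(\<integral>z. f z y \<partial>\<pi>) = (\<integral>z. f z x \<partial>\<pi>) \<and> (\<integral>z. f y z \<partial>\<pi>) = (\<integral>z. f z x \<partial>\<pi>)"
      using c x y unfolding canonical_def by metis
  qed
  moreover have "c = c'" if "?P c" "?P c'" for c c' using that x by auto
  ultimately have "?P (canonical_mean \<pi> f)"
    unfolding canonical_mean_def by (intro theI[of ?P]) blast+
  then show "(\<integral>z. f z x \<partial>\<pi>) = canonical_mean \<pi> f" "(\<integral>z. f x z \<partial>\<pi>) = canonical_mean \<pi> f" using x by auto
qed

context ergodic_chain
begin

context
  fixes h :: "nat \<Rightarrow> nat \<Rightarrow> 'a \<Rightarrow> 'a \<Rightarrow> real" and n :: nat and r :: real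
  assumes n: "2 \<le> n"
    and bk: "\<And>i j. i \<in> {1..n} \<Longrightarrow> j \<in> {1..n} \<Longrightarrow> bounded_kernel M (h i j)"
    and can: "\<And>i j. i \<in> {1..n} \<Longrightarrow> j \<in> {1..n} \<Longrightarrow> canonical \<pi> (h i j)"
begin

lemma h_measurable: "i \<in> {1..n} \<Longrightarrow> j \<in> {1..n} \<Longrightarrow> case_prod (h i j) \<in> borel_measurable (M \<Otimes>\<^sub>M M)"
  using bk by (simp add: bounded_kernel_def)

lemma h_bounded:
  assumes "i \<in> {1..n}" "j \<in> {1..n}" "x \<in> space M" "y \<in> space M"
  shows "\<bar>h i j x y\<bar> \<le> A_const M h n / 2"
proof -
  have "2 * \<bar>h i j x y\<bar> \<le> A_const M h n" by (rule A_const_bound[OF bk assms])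
  then show ?thesis by simp
qed

lemma h_integrable:
  assumes i: "i \<in> {1..n}" and j: "j \<in> {1..n}" and x: "x \<in> space M"
  shows "integrable \<pi> (h i j x)" "integrable \<pi> (\<lambda>z. h i j z x)"
proof -
  have fin: "finite_measure \<pi>" using pi_prob prob_space.finite_measure by blast
  have m1: "h i j x \<in> borel_measurable \<pi>"
    using measurable_Pair2[OF h_measurable[OF i j] x] by (simp cong: measurable_cong_sets)
  have m2: "(\<lambda>z. h i j z x) \<in> borel_measurable \<pi>"
    using measurable_Pair1[OF h_measurable[OF i j] x] by (simp cong: measurable_cong_sets)
  show "integrable \<pi> (h i j x)"
    by (rule integrable_bounded[OF fin m1, of "A_const M h n / 2"]) (use h_bounded[OF i j x] in simp)
  show "integrable \<pi> (\<lambda>z. h i j z x)"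
    by (rule integrable_bounded[OF fin m2, of "A_const M h n / 2"]) (use h_bounded[OF i j _ x] in simp)
qed

lemma mean_bounded:
  assumes i: "i \<in> {1..n}" and j: "j \<in> {1..n}"
  shows "\<bar>canonical_mean \<pi> (h i j)\<bar> \<le> A_const M h n / 2"
proof -
  obtain x where x: "x \<in> space M" using space_nonempty by blast
  have "\<bar>\<integral>z. h i j x z \<partial>\<pi>\<bar> \<le> A_const M h n / 2"
  proof (rule abs_integral_le_bound[OF pi_prob])
    show "h i j x \<in> borel_measurable \<pi>" using h_integrable(1)[OF i j x] by simp
    show "\<bar>h i j x z\<bar> \<le> A_const M h n / 2" if "z \<in> space \<pi>" for z
      using h_bounded[OF i j x] that by simp
  qed
  then show ?thesis using canonical_mean_eq(2)[OF can[OF i j]] x by simp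
qed

lemma A_const_nonneg: "0 \<le> A_const M h n"
proof -
  have i: "1 \<in> {1..n}" using n by simp
  show ?thesis using mean_bounded[OF i i] by linarith
qed

lemma centered_measurable:
  "i \<in> {1..n} \<Longrightarrow> j \<in> {1..n} \<Longrightarrow> case_prod (centered \<pi> h i j) \<in> borel_measurable (M \<Otimes>\<^sub>M M)"
  using h_measurable[of i j] unfolding centered_def[abs_def] case_prod_beta by simp

lemma centered_bounded:
  assumes "i \<in> {1..n}" "j \<in> {1..n}" "x \<in> space M" "y \<in> space M"
  shows "\<bar>centered \<pi> h i j x y\<bar> \<le> A_const M h n"
  using h_bounded[OF assms] mean_bounded[OF assms(1,2)] unfolding centered_def by linarith

lemma centered_integral:
  assumes i: "i \<in> {1..n}" and j: "j \<in> {1..n}" and x: "x \<in> space M"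
  shows "(\<integral>y. centered \<pi> h i j x y \<partial>\<pi>) = 0" "(\<integral>y. centered \<pi> h i j y x \<partial>\<pi>) = 0"
proof -
  interpret pi: prob_space \<pi> by (rule pi_prob)
  have x': "x \<in> space \<pi>" using x by simp
  have p1: "measure \<pi> (space \<pi>) = 1" by (rule pi.prob_space)
  show "(\<integral>y. centered \<pi> h i j x y \<partial>\<pi>) = 0"
    unfolding centered_def
    by (subst Bochner_Integration.integral_diff[OF h_integrable(1)[OF i j x]])
       (use p1 canonical_mean_eq(2)[OF can[OF i j] x'] in simp_all)
  show "(\<integral>y. centered \<pi> h i j y x \<partial>\<pi>) = 0"
    unfolding centered_def
    by (subst Bochner_Integration.integral_diff[OF h_integrable(2)[OF i j x]])
       (use p1 canonical_mean_eq(1)[OF can[OF i j] x'] in simp_all)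
qed

text \<open>
  The suprema and maxima in \<open>B_const\<close> are over bounded families, so each member lies below them.
\<close>

lemma B_const_bound:
  assumes k: "k \<le> t_index r n" and i: "i \<in> {1..n}" and x: "x \<in> space M"
  shows "(\<Sum>j=i+1..n. \<integral>y. (pint k (centered \<pi> h i j x) y)\<^sup>2 \<partial>\<nu>) \<le> (B_const M P \<pi> \<nu> r h n)\<^sup>2"
    and "0 \<le> B_const M P \<pi> \<nu> r h n"
proof -
  let ?A = "A_const M h n"
  let ?f = "\<lambda>k i x. \<Sum>j=i+1..n. \<integral>y. (\<integral>z. centered \<pi> h i j x z \<partial>kernel_pow M P k y)\<^sup>2 \<partial>\<nu>"
  let ?g = "\<lambda>k. MAX i\<in>{1..n}. SUP x\<in>space M. ?f k i x"
  let ?B1 = "MAX k\<in>{0..t_index r n}. ?g k"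
  let ?B2 = "MAX k\<in>{0..t_index r n}. MAX j\<in>{1..n}. SUP y\<in>space M.
          \<Sum>i=1..j-1. \<integral>x'. (\<integral>z. centered \<pi> h i j x' z \<partial>kernel_pow M P k y)\<^sup>2 \<partial>\<pi>"
  have B: "B_const M P \<pi> \<nu> r h n = sqrt (max ?B1 ?B2)" by (simp only: B_const_def)
  have ub: "?f k i x \<le> (\<Sum>j=i+1..n. ?A\<^sup>2)" if x: "x \<in> space M" for x
  proof (rule sum_mono)
    fix j assume "j \<in> {i+1..n}"
    then have j: "j \<in> {1..n}" by auto
    have cm: "centered \<pi> h i j x \<in> borel_measurable M"
      using measurable_Pair2[OF centered_measurable[OF i j] x] by simp
    have "\<bar>\<integral>y. (pint k (centered \<pi> h i j x) y)\<^sup>2 \<partial>\<nu>\<bar> \<le> ?A\<^sup>2"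
    proof (rule abs_integral_le_bound[OF nu_prob])
      show "(\<lambda>y. (pint k (centered \<pi> h i j x) y)\<^sup>2) \<in> borel_measurable \<nu>"
        using pint_measurable[OF cm, of k] by simp
      fix y assume "y \<in> space \<nu>"
      then have y: "y \<in> space M" by simp
      have "\<bar>pint k (centered \<pi> h i j x) y\<bar>\<^sup>2 \<le> ?A\<^sup>2"
        by (rule power_mono[OF pint_bounded[OF y cm centered_bounded[OF i j x]] abs_ge_zero])
      then show "\<bar>(pint k (centered \<pi> h i j x) y)\<^sup>2\<bar> \<le> ?A\<^sup>2" by simp
    qed
    then show "(\<integral>y. (\<integral>z. centered \<pi> h i j x z \<partial>kernel_pow M P k y)\<^sup>2 \<partial>\<nu>) \<le> ?A\<^sup>2"
      unfolding pint_def by linarith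
  qed
  have "?f k i x \<le> (SUP x\<in>space M. ?f k i x)"
    by (rule cSUP_upper[OF x]) (use ub in \<open>auto simp only: bdd_above_def intro: exI\<close>)
  also have "\<dots> \<le> ?g k" using i by (intro Max_ge) auto
  also have "\<dots> \<le> ?B1" using k by (intro Max_ge) auto
  also have "\<dots> \<le> max ?B1 ?B2" by simp
  finally have le: "?f k i x \<le> max ?B1 ?B2" .
  have "0 \<le> ?f k i x" by (intro sum_nonneg) simp
  then have m0: "0 \<le> max ?B1 ?B2" using le by (rule order_trans)
  show "0 \<le> B_const M P \<pi> \<nu> r h n" unfolding B by (rule real_sqrt_ge_zero[OF m0])
  show "(\<Sum>j=i+1..n. \<integral>y. (pint k (centered \<pi> h i j x) y)\<^sup>2 \<partial>\<nu>) \<le> (B_const M P \<pi> \<nu> r h n)\<^sup>2"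
    unfolding B real_sqrt_pow2[OF m0] pint_def by (rule le)
qed

lemma hX_measurable:
  assumes "(i, j) \<in> index_pairs n"
  shows "(\<lambda>\<omega>. h i j (X i \<omega>) (X j \<omega>)) \<in> borel_measurable \<Omega>"
proof -
  have ij: "i \<in> {1..n}" "j \<in> {1..n}" using assms by (auto simp: index_pairs_def)
  have "(\<lambda>\<omega>. (X i \<omega>, X j \<omega>)) \<in> \<Omega> \<rightarrow>\<^sub>M M \<Otimes>\<^sub>M M" using ij by (intro measurable_Pair X_measurable) auto
  from measurable_compose[OF this h_measurable[OF ij]] show ?thesis by simp
qed

lemma U_stat_measurable: "U_stat \<Omega> X h n \<in> borel_measurable \<Omega>"
  unfolding U_stat_def[abs_def] index_pairs_def[symmetric]
  by (rule borel_measurable_sum) (use hX_measurable in \<open>auto simp: case_prod_beta\<close>)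

lemma U_stat_centered:
  "U_stat \<Omega> X h n \<omega> = (\<Sum>(i, j)\<in>index_pairs n. centered \<pi> h i j (X i \<omega>) (X j \<omega>) - (\<integral>\<omega>. centered \<pi> h i j (X i \<omega>) (X j \<omega>) \<partial>\<Omega>))"
  unfolding U_stat_def index_pairs_def[symmetric]
proof (rule sum.cong[OF refl])
  fix z assume z: "z \<in> index_pairs n"
  obtain i j where ij: "z = (i, j)" by (cases z)
  have ij': "i \<in> {1..n}" "j \<in> {1..n}" "1 \<le> i" "1 \<le> j" using z by (auto simp: ij index_pairs_def)
  have "integrable \<Omega> (\<lambda>\<omega>. h i j (X i \<omega>) (X j \<omega>))"
  proof (rule integrable_bounded[OF finite_measure_axioms hX_measurable])
    show "(i, j) \<in> index_pairs n" using z ij by simp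
    show "\<bar>h i j (X i \<omega>) (X j \<omega>)\<bar> \<le> A_const M h n / 2" if "\<omega> \<in> space \<Omega>" for \<omega>
      by (rule h_bounded[OF ij'(1,2) X_space[OF ij'(3) that] X_space[OF ij'(4) that]])
  qed
  then have "(\<integral>\<omega>. centered \<pi> h i j (X i \<omega>) (X j \<omega>) \<partial>\<Omega>) = (\<integral>\<omega>. h i j (X i \<omega>) (X j \<omega>) \<partial>\<Omega>) - canonical_mean \<pi> (h i j)"
    unfolding centered_def by (subst Bochner_Integration.integral_diff) (auto simp: prob_space)
  then show "(case z of (i, j) \<Rightarrow> h i j (X i \<omega>) (X j \<omega>) - (\<integral>\<omega>'. h i j (X i \<omega>') (X j \<omega>') \<partial>\<Omega>)) =
     (case z of (i, j) \<Rightarrow> centered \<pi> h i j (X i \<omega>) (X j \<omega>) - (\<integral>\<omega>. centered \<pi> h i j (X i \<omega>) (X j \<omega>) \<partial>\<Omega>))"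
    by (simp add: ij centered_def)
qed

text \<open>
  The coefficient \<open>G\<close> of \<open>\<surd>u\<close> is the only point in which the two parts of the final theorem differ. Of the constant
  in front of \<open>exp (- u)\<close>, the part \<open>r (2 + \<delta>\<^sub>M)\<close> counts the exceptional events of the lags; the part \<open>8\<close>
  covers the remainder and makes the claim trivial for \<open>u < 1\<close>.
\<close>

theorem U_stat_concentration:
  fixes A B G u :: real
  assumes rho1: "\<rho> < 1" and r: "2 / ln (1 / \<rho>) < r" and u: "0 < u" and G: "0 \<le> G"
  defines "A \<equiv> A_const M h n" and "B \<equiv> B_const M P \<pi> \<nu> r h n"
  shows "1 - (r * (2 + \<delta>\<^sub>M) + 8) * exp (- u) * ln n \<le> prob {\<omega> \<in> space \<Omega>. U_stat \<Omega> X h n \<omega> \<le>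
    kappa r * ln n * (G * sqrt u + (A + B * sqrt n) * u + (2 * A * sqrt n) * u powr (3 / 2) + A * (u\<^sup>2 + n))}"
proof -
  let ?\<Phi> = "(A + B * sqrt n) * u + (2 * A * sqrt n) * u powr (3 / 2) + A * (u\<^sup>2 + n)"
  let ?R = "kappa r * ln n * (G * sqrt u + (A + B * sqrt n) * u + (2 * A * sqrt n) * u powr (3 / 2) + A * (u\<^sup>2 + n))"
  let ?S = "{\<omega> \<in> space \<Omega>. U_stat \<Omega> X h n \<omega> \<le> ?R}"
  have S: "?S \<in> sets \<Omega>" using U_stat_measurable by simp
  have lr: "0 < ln (1 / \<rho>)" using rho rho1 by simp
  have r0: "0 < r" using r lr by (meson divide_pos_pos less_trans zero_less_numeral)
  have "ln (2::real) \<le> ln (real n)" using n by simp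
  then have l: "2 / 3 \<le> ln (real n)" using ln2_ge_two_thirds by linarith
  have k0: "0 < kappa r" using r0 K0_pos L rho \<delta>\<^sub>M unfolding kappa_def by (simp add: add_pos_pos)
  have A0: "0 \<le> A" unfolding A_def by (rule A_const_nonneg)
  obtain x0 where x0: "x0 \<in> space M" using space_nonempty by blast
  have B0: "0 \<le> B" unfolding B_def by (rule B_const_bound(2)[where k = 0 and i = 1 and x = x0]) (use x0 n in auto)
  have RPhi: "kappa r * ln n * ?\<Phi> \<le> ?R"
    using k0 l G u by (intro mult_left_mono) auto
  have Phi0: "0 \<le> ?\<Phi>" using A0 B0 u by simp
  have R0: "0 \<le> ?R"
    by (rule order_trans[OF _ RPhi]) (use k0 l Phi0 in \<open>intro mult_nonneg_nonneg; simp\<close>)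
  have c: "0 < r * (2 + \<delta>\<^sub>M)" using r0 \<delta>\<^sub>M by simp
  consider "u < 1" | "1 \<le> u" "A = 0" | "1 \<le> u" "0 < A" using A0 by linarith
  then show ?thesis
  proof cases
    case 1
    have "1 / 3 \<le> exp (- u)"
    proof -
      have "exp u \<le> exp 1" using 1 by simp
      also have "\<dots> \<le> 3" by (rule exp_le)
      finally show ?thesis by (simp add: exp_minus field_simps)
    qed
    \<comment> \<open>The probability claimed is negative, as \<open>8 \<cdot> (1/3) \<cdot> (2/3) > 1\<close>.\<close>
    then have e: "1 / 3 * (2 / 3) \<le> exp (- u) * ln n" using l by (intro mult_mono) auto
    have "8 * (1 / 3 * (2 / 3)) \<le> (r * (2 + \<delta>\<^sub>M) + 8) * (exp (- u) * ln n)"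
      by (rule mult_mono[OF _ e]) (use c in auto)
    then have "1 - (r * (2 + \<delta>\<^sub>M) + 8) * exp (- u) * ln n \<le> 0" by (simp add: mult.assoc)
    then show ?thesis using measure_nonneg order_trans by blast
  next
    case 2
    \<comment> \<open>If \<open>A = 0\<close>, all kernels vanish; the tail bounds need a positive bound \<open>A\<close>.\<close>
    have z: "h i j x y = 0" if "i \<in> {1..n}" "j \<in> {1..n}" "x \<in> space M" "y \<in> space M" for i j x y
      using h_bounded[OF that] 2 unfolding A_def by simp
    have "U_stat \<Omega> X h n \<omega> = 0" if w: "\<omega> \<in> space \<Omega>" for \<omega>
      unfolding U_stat_def index_pairs_def[symmetric]
    proof (rule sum.neutral, rule ballI)
      fix q assume q: "q \<in> index_pairs n"
      obtain i j where ij: "q = (i, j)" by (cases q)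
      have ij': "i \<in> {1..n}" "j \<in> {1..n}" "1 \<le> i" "1 \<le> j" using q by (auto simp: ij index_pairs_def)
      have z': "h i j (X i \<omega>) (X j \<omega>) = 0" if "\<omega> \<in> space \<Omega>" for \<omega>
        by (rule z[OF ij'(1,2) X_space[OF ij'(3) that] X_space[OF ij'(4) that]])
      have "(\<integral>\<omega>'. h i j (X i \<omega>') (X j \<omega>') \<partial>\<Omega>) = (\<integral>\<omega>'. 0 \<partial>\<Omega>)"
        by (rule Bochner_Integration.integral_cong[OF refl z'])
      then show "(case q of (i, j) \<Rightarrow> h i j (X i \<omega>) (X j \<omega>) - (\<integral>\<omega>'. h i j (X i \<omega>') (X j \<omega>') \<partial>\<Omega>)) = 0"
        using z'[OF w] by (simp add: ij)
    qed
    then have "?S = space \<Omega>" using R0 by auto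
    then have "prob ?S = 1" by (simp only: prob_space)
    then show ?thesis using c l by simp
  next
    case 3
    have "\<exists>E\<in>sets \<Omega>. prob E \<le> (real (t_index r n) * (2 + \<delta>\<^sub>M) + 2) * exp (- u) \<and> (\<forall>\<omega>\<in>space \<Omega> - E.
    (\<Sum>(i, j)\<in>index_pairs n. centered \<pi> h i j (X i \<omega>) (X j \<omega>) - (\<integral>\<omega>. centered \<pi> h i j (X i \<omega>) (X j \<omega>) \<partial>\<Omega>)) \<le>
      real (t_index r n) * lag_bound A (B + A) n u
      + remainder_bound A n (t_index r n) u + real n * (A * K0))"
    proof (rule U_statistic_tail)
      show "case_prod (centered \<pi> h i j) \<in> borel_measurable (M \<Otimes>\<^sub>M M)" if "i \<in> {1..n}" "j \<in> {1..n}" for i j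
        by (rule centered_measurable[OF that])
      show "\<bar>centered \<pi> h i j x y\<bar> \<le> A" if "i \<in> {1..n}" "j \<in> {1..n}" "x \<in> space M" "y \<in> space M" for i j x y
        unfolding A_def by (rule centered_bounded[OF that])
      show "(\<integral>x. centered \<pi> h i j x y \<partial>\<pi>) = 0" if "i \<in> {1..n}" "j \<in> {1..n}" "y \<in> space M" for i j y
        by (rule centered_integral(2)[OF that])
      show "(\<integral>y. centered \<pi> h i j x y \<partial>\<pi>) = 0" if "i \<in> {1..n}" "j \<in> {1..n}" "x \<in> space M" for i j x
        by (rule centered_integral(1)[OF that])
      show "(\<Sum>j=i+1..n. \<integral>y. (pint k (centered \<pi> h i j x) y)\<^sup>2 \<partial>\<nu>) \<le> B\<^sup>2"
        if "i \<in> {1..n}" "k < t_index r n" "x \<in> space M" for i k x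
        unfolding B_def by (rule B_const_bound(1)[OF less_imp_le[OF that(2)] that(1,3)])
    qed (fact 3 B0 n)+
    then obtain E where E: "E \<in> sets \<Omega>" "prob E \<le> (real (t_index r n) * (2 + \<delta>\<^sub>M) + 2) * exp (- u)"
      "\<And>\<omega>. \<omega> \<in> space \<Omega> - E \<Longrightarrow> U_stat \<Omega> X h n \<omega> \<le>
      real (t_index r n) * lag_bound A (B + A) n u
      + remainder_bound A n (t_index r n) u + real n * (A * K0)"
      unfolding U_stat_centered by blast
    have sub: "space \<Omega> - E \<subseteq> ?S"
    proof
      fix \<omega> assume w: "\<omega> \<in> space \<Omega> - E"
      have "U_stat \<Omega> X h n \<omega> \<le> kappa r * ln n * ?\<Phi>"
        by (rule order_trans[OF E(3)[OF w] total_bound[OF rho1 r n 3 B0]])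
      then have "U_stat \<Omega> X h n \<omega> \<le> ?R" using RPhi by (rule order_trans)
      then show "\<omega> \<in> ?S" using w by simp
    qed
    have "1 - prob E = prob (space \<Omega> - E)" by (rule prob_compl[OF E(1), symmetric])
    also have "\<dots> \<le> prob ?S" by (rule finite_measure_mono[OF sub S])
    finally have "1 - prob E \<le> prob ?S" .
    moreover have "prob E \<le> (r * (2 + \<delta>\<^sub>M) + 8) * exp (- u) * ln n"
    proof -
      have t: "real (t_index r n) \<le> r * ln n" using r0 l unfolding t_index_def by (simp add: of_nat_nat)
      have "real (t_index r n) * (2 + \<delta>\<^sub>M) + 2 \<le> r * ln n * (2 + \<delta>\<^sub>M) + 8 * ln n"
        using t l \<delta>\<^sub>M by (intro add_mono mult_right_mono) auto
      also have "\<dots> = (r * (2 + \<delta>\<^sub>M) + 8) * ln n" by (simp add: algebra_simps)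
      finally have "(real (t_index r n) * (2 + \<delta>\<^sub>M) + 2) * exp (- u) \<le> (r * (2 + \<delta>\<^sub>M) + 8) * ln n * exp (- u)"
        by (intro mult_right_mono) auto
      from order_trans[OF E(2) this] show ?thesis by (simp add: mult_ac)
    qed
    ultimately show ?thesis by linarith
  qed
qed

end

end

theorem theorem1:
  fixes \<Omega> :: "'w measure" and M :: "'a measure"
    and P :: "'a \<Rightarrow> 'a measure" and X :: "nat \<Rightarrow> 'w \<Rightarrow> 'a"
    and chi \<psi> \<mu> \<pi> \<nu> :: "'a measure"
    and m :: nat and \<delta>\<^sub>m \<delta>\<^sub>M L \<rho> r :: real
  assumes chain: "markov_chain \<Omega> M P chi X"
    and irreducible: "maximal_irreducibility_measure M P \<psi>"
    and small: "m \<ge> 1" "\<delta>\<^sub>m > 0" "\<mu> \<in> space (prob_algebra M)"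
      "\<And>x D. x \<in> space M \<Longrightarrow> D \<in> sets M \<Longrightarrow>
         \<delta>\<^sub>m * measure \<mu> D \<le> measure (kernel_pow M P m x) D"
    and invariant: "invariant_distribution M P \<pi>"
    and dominated: "\<delta>\<^sub>M > 0" "\<nu> \<in> space (prob_algebra M)"
      "\<And>x D. x \<in> space M \<Longrightarrow> D \<in> sets M \<Longrightarrow> measure (P x) D \<le> \<delta>\<^sub>M * measure \<nu> D"
    and ergodic: "0 < \<rho>" "\<rho> < 1" "L > 0"
      "AE x in \<pi>. \<forall>k. tv_norm M (\<lambda>D. measure (kernel_pow M P k x) D - measure \<pi> D) \<le> L * \<rho> ^ k"
    and r: "r > 2 / ln (1 / \<rho>)"
  shows "\<exists>\<beta> \<kappa> :: real. \<beta> > 0 \<and> \<kappa> > 0 \<and>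
    (\<forall>n\<ge>2. \<forall>h :: nat \<Rightarrow> nat \<Rightarrow> 'a \<Rightarrow> 'a \<Rightarrow> real.
      (\<forall>i\<in>{1..n}. \<forall>j\<in>{1..n}. bounded_kernel M (h i j) \<and> canonical \<pi> (h i j)) \<longrightarrow>
      (let A = A_const M h n; B = B_const M P \<pi> \<nu> r h n; C = C_const \<Omega> X \<pi> \<nu> h n in
        ((\<forall>i\<in>{1..n}. \<forall>j\<in>{1..n}. \<forall>x\<in>space M. \<forall>y\<in>space M. h i j x y = h 1 j x y) \<longrightarrow>
          (\<forall>u>0. measure \<Omega> {\<omega> \<in> space \<Omega>. U_stat \<Omega> X h n \<omega> \<le>
              \<kappa> * ln n * ((A * ln n * sqrt n) * sqrt u + (A + B * sqrt n) * u
                + (2 * A * sqrt n) * u powr (3 / 2) + A * (u\<^sup>2 + n))}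
            \<ge> 1 - \<beta> * exp (- u) * ln n)) \<and>
        (absolutely_continuous \<pi> chi \<and> (\<exists>p>1. density_norm \<pi> p chi < \<infinity>) \<longrightarrow>
          (\<forall>u>0. measure \<Omega> {\<omega> \<in> space \<Omega>. U_stat \<Omega> X h n \<omega> \<le>
              \<kappa> * ln n * ((C + A * ln n * sqrt n) * sqrt u + (A + B * sqrt n) * u
                + (2 * A * sqrt n) * u powr (3 / 2) + A * (u\<^sup>2 + n))}
            \<ge> 1 - \<beta> * exp (- u) * ln n))))"
proof -
  have pi: "prob_space \<pi>" "sets \<pi> = sets M"
    using invariant by (auto simp: invariant_distribution_def space_prob_algebra)
  have pi_space: "space \<pi> = space M" by (rule sets_eq_imp_space_eq[OF pi(2)])
  have P: "P \<in> M \<rightarrow>\<^sub>M prob_algebra M" using chain by (simp add: markov_chain_def)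
  \<comment> \<open>A measurable null set that contains all points where the rate fails for some \<open>k\<close>.\<close>
  obtain N0 where N0: "N0 \<in> null_sets \<pi>"
    and good: "{x \<in> space \<pi>. \<not> (\<forall>k. tv_norm M (\<lambda>D. measure (kernel_pow M P k x) D - measure \<pi> D) \<le> L * \<rho> ^ k)} \<subseteq> N0"
    using ergodic(4) unfolding eventually_ae_filter by blast
  interpret mp: markov_process \<Omega> M P chi X by unfold_locales (rule chain)
  have tv: "\<bar>measure (kernel_pow M P k x) D - measure \<pi> D\<bar> \<le> L * \<rho> ^ k"
    if x: "x \<in> space M - N0" and D: "D \<in> sets M" for x k D
  proof -
    have x': "x \<in> space M" using x by simp
    interpret Pk: prob_space "kernel_pow M P k x" by (rule mp.pow_prob[OF x'])
    interpret pi: prob_space \<pi> by (rule pi(1))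
    have le1: "\<bar>measure (kernel_pow M P k x) D - measure \<pi> D\<bar> \<le> 1" for D
      using Pk.prob_le_1[of D] pi.prob_le_1[of D] measure_nonneg[of "kernel_pow M P k x" D] measure_nonneg[of \<pi> D] by linarith
    have "\<bar>measure (kernel_pow M P k x) D - measure \<pi> D\<bar> \<le> tv_norm M (\<lambda>D. measure (kernel_pow M P k x) D - measure \<pi> D)"
      unfolding tv_norm_def by (rule cSUP_upper[OF D]) (use le1 in \<open>auto simp: bdd_above_def\<close>)
    also have "\<dots> \<le> L * \<rho> ^ k" using good x pi_space by auto
    finally show ?thesis .
  qed
  interpret C: ergodic_chain \<Omega> M P chi X \<mu> \<pi> m \<delta>\<^sub>m \<nu> \<delta>\<^sub>M L \<rho> N0
  proof
    show "N0 \<in> sets M" using N0 pi(2) by auto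
    show "measure \<pi> N0 = 0" using N0 by (simp add: measure_eq_0_null_sets)
  qed (fact small invariant dominated ergodic tv)+
  have lr: "0 < ln (1 / \<rho>)" using ergodic(1,2) by simp
  have r0: "0 < r" using r lr by (meson divide_pos_pos less_trans zero_less_numeral)
  have kappa: "0 < C.kappa r"
    using r0 C.K0_pos ergodic(1,3) dominated(1) unfolding C.kappa_def by (simp add: add_pos_pos)
  have beta: "0 < r * (2 + \<delta>\<^sub>M) + 8" using r0 dominated(1) by (simp add: add_pos_pos)
  have main: "1 - (r * (2 + \<delta>\<^sub>M) + 8) * exp (- u) * ln (real n) \<le> measure \<Omega> {\<omega> \<in> space \<Omega>. U_stat \<Omega> X h n \<omega> \<le>
      C.kappa r * ln (real n) * ((c + A_const M h n * ln (real n) * sqrt (real n)) * sqrt u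
        + (A_const M h n + B_const M P \<pi> \<nu> r h n * sqrt (real n)) * u
        + (2 * A_const M h n * sqrt (real n)) * u powr (3 / 2) + A_const M h n * (u\<^sup>2 + real n))}"
    if n: "2 \<le> n" and h: "\<forall>i\<in>{1..n}. \<forall>j\<in>{1..n}. bounded_kernel M (h i j) \<and> canonical \<pi> (h i j)"
      and u: "0 < u" and c: "0 \<le> c" for n :: nat and h and u c :: real
  proof -
    have bk: "\<And>i j. i \<in> {1..n} \<Longrightarrow> j \<in> {1..n} \<Longrightarrow> bounded_kernel M (h i j)"
      and can: "\<And>i j. i \<in> {1..n} \<Longrightarrow> j \<in> {1..n} \<Longrightarrow> canonical \<pi> (h i j)" using h by blast+
    have "0 \<le> A_const M h n" by (rule C.A_const_nonneg[OF n bk can])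
    then have G: "0 \<le> c + A_const M h n * ln (real n) * sqrt (real n)" using n c by simp
    show ?thesis by (rule C.U_stat_concentration[OF n bk can ergodic(2) r u G])
  qed
  have C0: "0 \<le> C_const \<Omega> X \<pi> \<nu> h n" for h n
    unfolding C_const_def by (intro real_sqrt_ge_zero sum_nonneg Bochner_Integration.integral_nonneg) simp
  show ?thesis
    unfolding Let_def
    by (intro exI[of _ "r * (2 + \<delta>\<^sub>M) + 8"] exI[of _ "C.kappa r"] conjI beta kappa allI impI)
       (use main[OF _ _ _ order_refl] main[OF _ _ _ C0] in \<open>simp_all only: add_0\<close>)
qed

end
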